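(* Let $f,g:\mathbb{R}\to\mathbb{R}$ be locally Lipschitz maps of class $C^1$ and let $p:\mathbb{R}\to\mathbb{R}$, and assume: (A1) $p$ is continuous and periodic with minimal period $T>0$; (A2) $f$ is bounded and $f(x)\ge 0$ for all $x\in\mathbb{R}$; (A3) $g$ is a strictly decreasing homeomorphism (of $\mathbb{R}$ onto $\mathbb{R}$); (A4) there exist $c,d\ge 0$ such that $|g(x)|\le c+d|x|$ for all $x\in\mathbb{R}$. Let $F(x)=\int_0^x f(s)\,ds$ and consider the planar system $$\dot x=y-F(x),\qquad \dot y=-g(x)+p(t).$$ Then the $T$-periodic solution of this system is unique (the system has exactly one $T$-periodic solution), and it is a global saddle for the Poincaré map $P$, i.e. the corresponding fixed point of $P$ is a global saddle of $P$.
   Context: The system is equivalent to the Liénard equation $\ddot x+f(x)\dot x+g(x)=p(t)$. For $q\in\mathbb{R}^2$ let $u(t,q)$ be the solution of the system with $u(0,q)=q$; under the assumptions it is defined for all $t\in\mathbb{R}$. The Poincaré map is $P(q)=u(T,q)$; it is an orientation preserving $C^1$ diffeomorphism of $\mathbb{R}^2$, and $T$-periodic solutions correspond to fixed points of $P$. Definitions (for a $C^1$ diffeomorphism $h$ of $\mathbb{R}^2$ with a fixed point $q_0$). $q_0$ is a local saddle if $Dh(q_0)$ has real eigenvalues $\lambda,\mu$ with $0<|\lambda|<1<|\mu|$. Put $W^s=W^s(q_0,h)=\{x\in\mathbb{R}^2:\lim_{n\to\infty}h^n(x)=q_0\}$ and $W^u=W^u(q_0,h)=W^s(q_0,h^{-1})$.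 Each of these is the image of a continuous injective curve $\tau:\mathbb{R}\to\mathbb{R}^2$ with $\tau(0)=q_0$; the images of $[0,+\infty)$ and $(-\infty,0]$ are its two branches $\beta^+$, $\beta^-$. For continuous bijections $\zeta:[0,+\infty)\to\beta^+$, $\zeta':(-\infty,0]\to\beta^-$, put $\mathcal{L}(\beta^+)=\bigcap_{t\ge 0}\overline{\zeta([t,+\infty))}$ and $\mathcal{L}(\beta^-)=\bigcap_{t\le 0}\overline{\zeta'((-\infty,t])}$ (closures in $\mathbb{R}^2$; independent of the parametrisation). $\mathcal{L}(W^s)$ (resp. $\mathcal{L}(W^u)$) is the union of the limit sets of the two branches of $W^s$ (resp. $W^u$). A homoclinic contact is a point of $(W^u\cap W^s\setminus\{q_0\})\cup(\mathcal{L}(W^u)\cap\overline{W^s})\cup(\mathcal{L}(W^s)\cap\overline{W^u})$. The point $q_0$ is a global saddle of $h$ if it is a local saddle, there are no homoclinic contacts, $W^s$ and $W^u$ are unbounded sets, and for all $x\notin W^s\cup W^u\cup\{q_0\}$ both $\|h^n(x)\|\to\infty$ and $\|h^{-n}(x)\|\to\infty$ as $n\to\infty$. *)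

theory Defs
  imports "HOL-Analysis.Analysis"
begin

(* The interval integral is oriented, so this is also correct for x < 0. *)
definition lienard_F :: "(real \<Rightarrow> real) \<Rightarrow> real \<Rightarrow> real" where
  "lienard_F f x = (LBINT s=0..x. f s)"

definition lienard_solution ::
    "(real \<Rightarrow> real) \<Rightarrow> (real \<Rightarrow> real) \<Rightarrow> (real \<Rightarrow> real) \<Rightarrow> (real \<Rightarrow> real \<times> real) \<Rightarrow> bool" where
  "lienard_solution f g p u \<longleftrightarrow>
     (\<forall>t. (u has_vector_derivative
             (snd (u t) - lienard_F f (fst (u t)), - g (fst (u t)) + p t)) (at t))"

(* Under the standing assumptions, for every q there is exactly one solution on the whole
   real line with u 0 = q; the description operator selects it. *)
definition lienard_flow ::
    "(real \<Rightarrow> real) \<Rightarrow> (real \<Rightarrow> real) \<Rightarrow> (real \<Rightarrow> real) \<Rightarrow> real \<Rightarrow> real \<times> real \<Rightarrow> real \<times> real" where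
  "lienard_flow f g p t q = (THE u. lienard_solution f g p u \<and> u 0 = q) t"

definition poincare_map ::
    "(real \<Rightarrow> real) \<Rightarrow> (real \<Rightarrow> real) \<Rightarrow> (real \<Rightarrow> real) \<Rightarrow> real \<Rightarrow> real \<times> real \<Rightarrow> real \<times> real" where
  "poincare_map f g p T q = lienard_flow f g p T q"

definition C1_map :: "(real \<times> real \<Rightarrow> real \<times> real) \<Rightarrow> bool" where
  "C1_map h \<longleftrightarrow>
     (\<exists>h' :: real \<times> real \<Rightarrow> (real \<times> real) \<Rightarrow>\<^sub>L (real \<times> real).
        (\<forall>x. (h has_derivative blinfun_apply (h' x)) (at x)) \<and> continuous_on UNIV h')"

definition C1_diffeomorphism :: "(real \<times> real \<Rightarrow> real \<times> real) \<Rightarrow> bool" where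
  "C1_diffeomorphism h \<longleftrightarrow> bij h \<and> C1_map h \<and> C1_map (inv h)"

definition real_eigenvalue :: "(real \<times> real \<Rightarrow> real \<times> real) \<Rightarrow> real \<Rightarrow> bool" where
  "real_eigenvalue A \<kappa> \<longleftrightarrow> (\<exists>v. v \<noteq> 0 \<and> A v = \<kappa> *\<^sub>R v)"

definition local_saddle :: "(real \<times> real \<Rightarrow> real \<times> real) \<Rightarrow> real \<times> real \<Rightarrow> bool" where
  "local_saddle h q0 \<longleftrightarrow>
     (\<exists>D \<kappa> \<mu>. (h has_derivative D) (at q0) \<and> real_eigenvalue D \<kappa> \<and> real_eigenvalue D \<mu> \<and>
        0 < \<bar>\<kappa>\<bar> \<and> \<bar>\<kappa>\<bar> < 1 \<and> 1 < \<bar>\<mu>\<bar>)"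

definition stable_set :: "(real \<times> real \<Rightarrow> real \<times> real) \<Rightarrow> real \<times> real \<Rightarrow> (real \<times> real) set" where
  "stable_set h q0 = {x. (\<lambda>n. (h ^^ n) x) \<longlonglongrightarrow> q0}"

definition unstable_set :: "(real \<times> real \<Rightarrow> real \<times> real) \<Rightarrow> real \<times> real \<Rightarrow> (real \<times> real) set" where
  "unstable_set h q0 = stable_set (inv h) q0"

definition curves_onto :: "real \<times> real \<Rightarrow> (real \<times> real) set \<Rightarrow> (real \<Rightarrow> real \<times> real) set" where
  "curves_onto q0 W = {\<tau>. continuous_on UNIV \<tau> \<and> inj \<tau> \<and> \<tau> 0 = q0 \<and> range \<tau> = W}"

definition branches :: "real \<times> real \<Rightarrow> (real \<times> real) set \<Rightarrow> (real \<times> real) set set" where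
  "branches q0 W = (\<Union>\<tau>\<in>curves_onto q0 W. {\<tau> ` {0..}, \<tau> ` {..0}})"

(* As the limit set does not depend on the parametrisation, the union over all
   parametrisations avoids choosing one.  Continuous bijections from {..0} onto a branch are
   those from {0..} precomposed with t \<mapsto> - t and yield the same limit set, so one
   definition serves both branches. *)
definition branch_limit_set :: "(real \<times> real) set \<Rightarrow> (real \<times> real) set" where
  "branch_limit_set \<beta> =
     (\<Union>\<zeta>\<in>{\<zeta> :: real \<Rightarrow> real \<times> real. continuous_on {0..} \<zeta> \<and> bij_betw \<zeta> {0..} \<beta>}.
        \<Inter>t\<in>{0..}. closure (\<zeta> ` {t..}))"

definition limit_set :: "real \<times> real \<Rightarrow> (real \<times> real) set \<Rightarrow> (real \<times> real) set" where
  "limit_set q0 W = (\<Union>\<beta>\<in>branches q0 W. branch_limit_set \<beta>)"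

definition homoclinic_contacts ::
    "(real \<times> real \<Rightarrow> real \<times> real) \<Rightarrow> real \<times> real \<Rightarrow> (real \<times> real) set" where
  "homoclinic_contacts h q0 =
     (let Ws = stable_set h q0; Wu = unstable_set h q0
      in (Wu \<inter> Ws - {q0}) \<union> (limit_set q0 Wu \<inter> closure Ws) \<union> (limit_set q0 Ws \<inter> closure Wu))"

(* That the stable and unstable sets are injective curves through q0 is a general fact about
   local saddles of C1 diffeomorphisms.  It is listed because branches and limit sets are
   meaningful only then; without a parametrising curve the unions above would be empty. *)
definition global_saddle :: "(real \<times> real \<Rightarrow> real \<times> real) \<Rightarrow> real \<times> real \<Rightarrow> bool" where
  "global_saddle h q0 \<longleftrightarrow>
     C1_diffeomorphism h \<and> h q0 = q0 \<and> local_saddle h q0 \<and>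
     curves_onto q0 (stable_set h q0) \<noteq> {} \<and> curves_onto q0 (unstable_set h q0) \<noteq> {} \<and>
     homoclinic_contacts h q0 = {} \<and>
     \<not> bounded (stable_set h q0) \<and> \<not> bounded (unstable_set h q0) \<and>
     (\<forall>x. x \<notin> stable_set h q0 \<union> unstable_set h q0 \<union> {q0} \<longrightarrow>
        filterlim (\<lambda>n. norm ((h ^^ n) x)) at_top sequentially \<and>
        filterlim (\<lambda>n. norm ((inv h ^^ n) x)) at_top sequentially)"

end

theory Submission
  imports Defs
begin

text \<open>
  Put \<open>G = - g\<close>. The difference \<open>(X, Y)\<close> of two solutions satisfies \<open>X' = Y - a X\<close>, \<open>Y' = b X\<close> with
  \<open>a\<close> bounded and \<open>b \<ge> 0\<close>, so the componentwise order is preserved forward in time, and a solution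
  that becomes comparable with a different bounded one escapes to infinity. If instead \<open>X Y < 0\<close>
  for all \<open>t \<ge> 0\<close>, then the difference tends to \<open>0\<close>. Hence the points with bounded forward orbit
  are pairwise incomparable; every line of slope \<open>M + 1\<close>, where \<open>M\<close> bounds \<open>\<bar>f\<bar>\<close>, contains exactly one
  of them, because its two ends run off to infinity in opposite directions. So they form a properly
  embedded line. The Poincare map acts on this line with bounded orbits and therefore has a fixed
  point \<open>q0\<close>, and the line is the stable set of \<open>q0\<close>. Only a bound on \<open>\<bar>f\<bar>\<close> has been used, so time
  reversal \<open>(x, y, t) \<mapsto> (x, - y, - t)\<close>, which replaces \<open>f\<close> by \<open>- f\<close>, gives the unstable set. The sign
  of \<open>f\<close> enters only in the linearisation at \<open>q0\<close>, whose determinant is at most \<open>1\<close>.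
\<close>

section \<open>Differential inequalities\<close>

text \<open>The obstacle is that g is only strictly decreasing: its derivative may vanish, so
  neither escape nor decay of a difference comes with an exponential rate. Compactness replaces the
  rate: if one of two solutions stays in a strip |x| \<le> R, then a gap of at least \<delta> in x
  forces a gap of at least some \<gamma> > 0 in G (\<open>G_gap\<close>), and the y-difference grows
  by a definite amount per unit of time. This is why one solution of each compared pair is assumed
  bounded. The slope M + 1 has two virtues: it is positive, so any two points of such a line are
  comparable, and it exceeds the Lipschitz constant M of F, so the velocity y - F(x) of x has the
  sign of x at the far ends. Two points of the plane are always comparable, either as they stand or
  after the reflection of y. Hence at most one point has an orbit that is bounded in both time
  directions; this yields uniqueness of the fixed point and excludes homoclinic points.
  Hyperbolicity at \<open>q0\<close> rests on G' not vanishing identically along the periodic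
  solution: otherwise x, hence y, hence p would be constant, against the minimality of the
  period.\<close>

lemma gronwall_norm:
  fixes E E' :: "real \<Rightarrow> 'a::real_inner"
  assumes deriv: "\<And>s. 0 \<le> s \<Longrightarrow> s \<le> t \<Longrightarrow> (E has_vector_derivative E' s) (at s)"
    and bound: "\<And>s. 0 \<le> s \<Longrightarrow> s \<le> t \<Longrightarrow> norm (E' s) \<le> K * norm (E s) + \<eta>"
    and "K \<ge> 0" "t \<ge> 0"
  shows "(norm (E t))\<^sup>2 \<le> ((norm (E 0))\<^sup>2 + \<eta>\<^sup>2 * t) * exp ((2 * K + 1) * t)"
proof -
  define k where "k = 2 * K + 1"
  \<comment> \<open>The squared norm is differentiable also where E vanishes. The cross term 2
    \<eta> |E| is at most \<open>|E|\<^sup>2 + \<eta>\<^sup>2\<close>, whence the 1 in 2 K + 1; as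
    the exponential weight is at most 1 for s \<ge> 0, the remainder can be subtracted as
    \<open>\<eta>\<^sup>2 * s\<close>.\<close>
  define \<psi> where "\<psi> s = exp (- k * s) * (E s \<bullet> E s) - \<eta>\<^sup>2 * s" for s
  have "\<psi> t \<le> \<psi> 0"
  proof (rule DERIV_nonpos_imp_nonincreasing[OF \<open>t \<ge> 0\<close>])
    fix s assume s: "0 \<le> s" "s \<le> t"
    have E: "((\<lambda>s. E s \<bullet> E s) has_real_derivative 2 * (E s \<bullet> E' s)) (at s)"
      using deriv[OF s]
      by (auto simp: has_vector_derivative_def has_field_derivative_def inner_commute
          fun_eq_iff intro!: derivative_eq_intros)
    have D: "(\<psi> has_real_derivative
        exp (- k * s) * (2 * (E s \<bullet> E' s) - k * (E s \<bullet> E s)) - \<eta>\<^sup>2) (at s)"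
      unfolding \<psi>_def by (auto intro!: derivative_eq_intros E simp: algebra_simps)
    have "2 * (E s \<bullet> E' s) \<le> 2 * (norm (E s) * norm (E' s))"
      using norm_cauchy_schwarz by auto
    also have "\<dots> \<le> 2 * (norm (E s) * (K * norm (E s) + \<eta>))"
      using bound[OF s] by (intro mult_left_mono) auto
    also have "\<dots> \<le> k * (norm (E s))\<^sup>2 + \<eta>\<^sup>2"
      using sum_squares_bound[of "norm (E s)" \<eta>]
      by (simp add: k_def algebra_simps power2_eq_square)
    finally have "2 * (E s \<bullet> E' s) - k * (E s \<bullet> E s) \<le> \<eta>\<^sup>2"
      by (simp add: dot_square_norm)
    then have "exp (- k * s) * (2 * (E s \<bullet> E' s) - k * (E s \<bullet> E s)) \<le> exp (- k * s) * \<eta>\<^sup>2"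
      by (intro mult_left_mono) auto
    also have "\<dots> \<le> 1 * \<eta>\<^sup>2"
      using s \<open>K \<ge> 0\<close> by (intro mult_right_mono) (auto simp: k_def mult_le_0_iff)
    finally show "\<exists>y. (\<psi> has_real_derivative y) (at s) \<and> y \<le> 0"
      using D by fastforce
  qed
  then have "exp (- k * t) * (norm (E t))\<^sup>2 \<le> (norm (E 0))\<^sup>2 + \<eta>\<^sup>2 * t"
    by (simp add: \<psi>_def dot_square_norm)
  then have "exp (k * t) * (exp (- k * t) * (norm (E t))\<^sup>2)
      \<le> exp (k * t) * ((norm (E 0))\<^sup>2 + \<eta>\<^sup>2 * t)"
    by (intro mult_left_mono) auto
  moreover have "exp (k * t) * (exp (- k * t) * (norm (E t))\<^sup>2) = (norm (E t))\<^sup>2"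
    by (simp add: mult.assoc[symmetric] exp_minus)
  ultimately have "(norm (E t))\<^sup>2 \<le> exp (k * t) * ((norm (E 0))\<^sup>2 + \<eta>\<^sup>2 * t)" by linarith
  then show ?thesis by (simp add: k_def mult.commute)
qed

text \<open>Squaring removes the corner of the negative part at 0, so the squared distance to a
  quadrant can be differentiated along a curve.\<close>

lemma has_real_derivative_min_0_squared:
  "((\<lambda>x::real. (min x 0)\<^sup>2) has_real_derivative 2 * min x 0) (at x)"
proof -
  consider "x < 0" | "x > 0" | "x = 0" by linarith
  then show ?thesis
  proof cases
    case 1
    have "((\<lambda>x::real. x\<^sup>2) has_real_derivative 2 * x) (at x)"
      by (auto intro!: derivative_eq_intros)
    moreover have "\<forall>\<^sub>F y in nhds x. y\<^sup>2 = (min y 0)\<^sup>2"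
      using eventually_nhds_in_open[of "{..<0}" x] 1 by (auto elim!: eventually_mono)
    ultimately show ?thesis using 1 DERIV_cong_ev[OF refl, of "\<lambda>x. x\<^sup>2" "\<lambda>x. (min x 0)\<^sup>2" x "2 * x" "2 * min x 0"] by simp
  next
    case 2
    have "((\<lambda>x::real. 0) has_real_derivative 0) (at x)" by simp
    moreover have "\<forall>\<^sub>F y in nhds x. 0 = (min y 0)\<^sup>2"
      using eventually_nhds_in_open[of "{0<..}" x] 2 by (auto elim!: eventually_mono)
    ultimately show ?thesis using 2 DERIV_cong_ev[OF refl, of "\<lambda>x. 0" "\<lambda>x. (min x 0)\<^sup>2" x 0 "2 * min x 0"] by simp
  next
    case 3
    have "(\<lambda>h::real. (min h 0)\<^sup>2 / h) \<midarrow>0\<rightarrow> 0"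
    proof (rule Lim_null_comparison)
      show "\<forall>\<^sub>F h::real in at 0. norm ((min h 0)\<^sup>2 / h) \<le> \<bar>h\<bar>"
        by (rule always_eventually) (auto simp: min_def power2_eq_square)
      show "(\<lambda>h::real. \<bar>h\<bar>) \<midarrow>0\<rightarrow> 0"
        by (auto intro!: tendsto_eq_intros)
    qed
    then show ?thesis by (simp add: 3 DERIV_def)
  qed
qed

text \<open>Gronwall's inequality for the squared distance of \<open>(X, Y)\<close> to the closed first quadrant.\<close>
lemma quadrant_invariant:
  fixes X Y X' Y' :: "real \<Rightarrow> real"
  assumes X: "\<And>s. a \<le> s \<Longrightarrow> s \<le> b \<Longrightarrow> (X has_real_derivative X' s) (at s)"
    and Y: "\<And>s. a \<le> s \<Longrightarrow> s \<le> b \<Longrightarrow> (Y has_real_derivative Y' s) (at s)"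
    and X': "\<And>s. a \<le> s \<Longrightarrow> s \<le> b \<Longrightarrow> X s < 0 \<Longrightarrow> X' s \<ge> k * (min (X s) 0 + min (Y s) 0)"
    and Y': "\<And>s. a \<le> s \<Longrightarrow> s \<le> b \<Longrightarrow> Y s < 0 \<Longrightarrow> Y' s \<ge> k * (min (X s) 0 + min (Y s) 0)"
    and "X a \<ge> 0" "Y a \<ge> 0" "k \<ge> 0" "a \<le> b"
  shows "X b \<ge> 0 \<and> Y b \<ge> 0"
proof -
  define \<phi> where "\<phi> s = (min (X s) 0)\<^sup>2 + (min (Y s) 0)\<^sup>2" for s
  \<comment> \<open>The rate 4 k arises because the derivative of \<phi> is at most 2 k times the
    square of the sum of the two negative parts, and that square is at most 2 \<phi>.\<close>
  define \<psi> where "\<psi> s = exp (- (4 * k) * s) * \<phi> s" for s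
  have "\<psi> b \<le> \<psi> a"
  proof (rule DERIV_nonpos_imp_nonincreasing[OF \<open>a \<le> b\<close>])
    fix s assume s: "a \<le> s" "s \<le> b"
    have D\<phi>: "(\<phi> has_real_derivative 2 * min (X s) 0 * X' s + 2 * min (Y s) 0 * Y' s) (at s)"
      unfolding \<phi>_def
      using DERIV_chain2[OF has_real_derivative_min_0_squared X[OF s]]
        DERIV_chain2[OF has_real_derivative_min_0_squared Y[OF s]] by (rule DERIV_add)
    have D: "(\<psi> has_real_derivative exp (- (4 * k) * s) *
        (2 * min (X s) 0 * X' s + 2 * min (Y s) 0 * Y' s - 4 * k * \<phi> s)) (at s)"
      unfolding \<psi>_def by (auto intro!: derivative_eq_intros D\<phi> simp: algebra_simps)
    let ?x = "min (X s) 0" and ?y = "min (Y s) 0"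
    have "?x * X' s \<le> ?x * (k * (?x + ?y))"
      using X'[OF s] by (cases "X s < 0") (auto intro: mult_left_mono_neg)
    moreover have "?y * Y' s \<le> ?y * (k * (?x + ?y))"
      using Y'[OF s] by (cases "Y s < 0") (auto intro: mult_left_mono_neg)
    moreover have "2 * (?x * (k * (?x + ?y))) + 2 * (?y * (k * (?x + ?y))) \<le> 4 * k * \<phi> s"
    proof -
      have "2 * (?x + ?y)\<^sup>2 \<le> 4 * \<phi> s"
        using sum_squares_bound[of ?x ?y] unfolding \<phi>_def
        by (simp add: power2_sum)
      then have "k * (2 * (?x + ?y)\<^sup>2) \<le> k * (4 * \<phi> s)"
        using \<open>k \<ge> 0\<close> by (rule mult_left_mono)
      then show ?thesis by (simp add: algebra_simps power2_eq_square)
    qed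
    ultimately have "2 * ?x * X' s + 2 * ?y * Y' s - 4 * k * \<phi> s \<le> 0" by linarith
    then show "\<exists>y. (\<psi> has_real_derivative y) (at s) \<and> y \<le> 0"
      using D by (meson exp_ge_zero mult_nonneg_nonpos)
  qed
  also have "\<psi> a = 0"
    using \<open>X a \<ge> 0\<close> \<open>Y a \<ge> 0\<close> by (simp add: \<psi>_def \<phi>_def)
  finally have "\<phi> b \<le> 0" by (simp add: \<psi>_def mult_le_0_iff not_le[symmetric])
  then have "min (X b) 0 = 0 \<and> min (Y b) 0 = 0"
    unfolding \<phi>_def by (metis sum_power2_le_zero_iff)
  then show ?thesis by linarith
qed

text \<open>Cooperativity means that the off-diagonal influence has the right sign: Y enters the
  derivative of X with coefficient 1, and \<open>Y'\<close> is nonnegative as soon as X is.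
  \<open>Y'\<close> stays abstract so that both an increment of the nonlinear G and a linear term
  \<beta> X fit. The rate L + 1 dominates the coefficients L and 1 at once.\<close>

lemma cooperative_quadrant_invariant:
  fixes X Y \<alpha> Y' :: "real \<Rightarrow> real"
  assumes X: "\<And>s. a \<le> s \<Longrightarrow> s \<le> b \<Longrightarrow> (X has_real_derivative Y s - \<alpha> s * X s) (at s)"
    and Y: "\<And>s. a \<le> s \<Longrightarrow> s \<le> b \<Longrightarrow> (Y has_real_derivative Y' s) (at s)"
    and \<alpha>: "\<And>s. a \<le> s \<Longrightarrow> s \<le> b \<Longrightarrow> \<bar>\<alpha> s\<bar> \<le> L"
    and Y'_neg: "\<And>s. a \<le> s \<Longrightarrow> s \<le> b \<Longrightarrow> X s < 0 \<Longrightarrow> L * X s \<le> Y' s"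
    and Y'_nonneg: "\<And>s. a \<le> s \<Longrightarrow> s \<le> b \<Longrightarrow> 0 \<le> X s \<Longrightarrow> 0 \<le> Y' s"
    and "X a \<ge> 0" "Y a \<ge> 0" "a \<le> b"
  shows "X b \<ge> 0 \<and> Y b \<ge> 0"
proof (rule quadrant_invariant[OF X Y, where k = "L + 1"])
  have "L \<ge> 0" using \<alpha>[of a] \<open>a \<le> b\<close> by simp
  then show "L + 1 \<ge> 0" by simp
  fix s assume s: "a \<le> s" "s \<le> b"
  have m1: "(L + 1) * min (Y s) 0 \<le> 1 * min (Y s) 0"
    using \<open>L \<ge> 0\<close> by (intro mult_right_mono_neg) auto
  have m2: "(L + 1) * min (X s) 0 \<le> L * min (X s) 0" by (simp add: algebra_simps)
  have m: "(L + 1) * (min (X s) 0 + min (Y s) 0) \<le> L * min (X s) 0 + min (Y s) 0"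
    unfolding distrib_left using add_mono[OF m2 m1] by simp
  show "(L + 1) * (min (X s) 0 + min (Y s) 0) \<le> Y s - \<alpha> s * X s" if "X s < 0"
  proof -
    have "L * X s \<le> - \<alpha> s * X s"
      using \<alpha>[OF s] that by (intro mult_right_mono_neg) auto
    moreover have "min (X s) 0 = X s" "min (Y s) 0 \<le> Y s" using that by auto
    ultimately show ?thesis using m by simp
  qed
  show "(L + 1) * (min (X s) 0 + min (Y s) 0) \<le> Y' s"
    using m Y'_neg[OF s] Y'_nonneg[OF s] \<open>L \<ge> 0\<close> by (cases "X s < 0") auto
qed (use assms in auto)

lemma interval_integral_has_vector_derivative:
  fixes h :: "real \<Rightarrow> 'a::euclidean_space"
  assumes "continuous_on UNIV h"
  shows "((\<lambda>t. LBINT s=0..t. h s) has_vector_derivative h t) (at t)"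
proof -
  define N where "N = \<bar>t\<bar> + 1"
  have *: "((\<lambda>t. LBINT s=ereal 0..ereal t. h s) has_vector_derivative h t) (at t within {- N..N})"
    by (rule interval_integral_FTC2) (use assms in \<open>auto simp: N_def intro: continuous_on_subset\<close>)
  have "at t within {- N..N} = at t"
    by (rule at_within_interior) (auto simp: N_def)
  then show ?thesis using * by (simp add: zero_ereal_def)
qed

lemma has_vector_derivative_reflect:
  assumes "(f has_vector_derivative f') (at (- t))"
  shows "((\<lambda>t. f (- t)) has_vector_derivative - f') (at t)"
proof -
  have "(uminus has_vector_derivative (- 1 :: real)) (at t)"
    by (auto intro!: derivative_eq_intros)
  from vector_diff_chain_at[OF this, of f f'] assms show ?thesis by (simp add: o_def)
qed

text \<open>In the norm weighted by exp (- L |t|), integration from 0 gains the factor 1 / L. For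
  large L this makes the Picard operator a contraction on the whole line at once.\<close>

lemma antiderivative_weighted_bound:
  fixes H h :: "real \<Rightarrow> 'a::euclidean_space"
  assumes H: "\<And>t. (H has_vector_derivative h t) (at t)" and "H 0 = 0"
    and h: "\<And>t. norm (h t) \<le> C * exp (L * \<bar>t\<bar>)" and "L > 0"
  shows "norm (H t) \<le> C / L * exp (L * \<bar>t\<bar>)"
proof -
  have pos: "norm (K t) \<le> C / L * exp (L * t)"
    if K: "\<And>t. (K has_vector_derivative k t) (at t)" and "K 0 = 0"
      and k: "\<And>t. norm (k t) \<le> C * exp (L * \<bar>t\<bar>)" and "t > 0"
    for K k :: "real \<Rightarrow> 'a" and t
  proof -
    have "norm (K t - K 0) \<le> C / L * exp (L * t) - C / L * exp (L * 0)"
    proof (rule differentiable_bound_general[OF \<open>t > 0\<close>])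
      show "continuous_on {0..t} K"
        using K by (meson continuous_at_imp_continuous_on has_vector_derivative_continuous)
      show "continuous_on {0..t} (\<lambda>t. C / L * exp (L * t))"
        by (intro continuous_intros)
      show "(K has_vector_derivative k s) (at s)" for s by (rule K)
      show "((\<lambda>t. C / L * exp (L * t)) has_vector_derivative C * exp (L * s)) (at s)" for s
        unfolding has_real_derivative_iff_has_vector_derivative[symmetric]
        using \<open>L > 0\<close> by (auto intro!: derivative_eq_intros)
      show "norm (k s) \<le> C * exp (L * s)" if "0 < s" for s
        using k[of s] that by simp
    qed
    moreover have "0 \<le> C" using k[of 0] norm_ge_zero[of "k 0"] by (simp del: norm_ge_zero)
    ultimately show ?thesis using \<open>K 0 = 0\<close> \<open>L > 0\<close>
      by simp (smt (verit) divide_nonneg_pos)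
  qed
  have "0 \<le> C" using h[of 0] norm_ge_zero[of "h 0"] by (simp del: norm_ge_zero)
  consider "t > 0" | "t < 0" | "t = 0" by linarith
  then show ?thesis
  proof cases
    case 1
    then show ?thesis using pos[OF H \<open>H 0 = 0\<close> h 1] by simp
  next
    case 2
    have "((\<lambda>t. H (- t)) has_vector_derivative - h (- t)) (at t)" for t
      by (rule has_vector_derivative_reflect[OF H])
    moreover have "norm (- h (- t)) \<le> C * exp (L * \<bar>t\<bar>)" for t
      using h[of "- t"] by simp
    ultimately show ?thesis
      using pos[of "\<lambda>t. H (- t)" "\<lambda>t. - h (- t)" "- t"] \<open>H 0 = 0\<close> 2 by simp
  next
    case 3
    then show ?thesis using \<open>H 0 = 0\<close> \<open>0 \<le> C\<close> \<open>L > 0\<close> by simp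
  qed
qed

section \<open>Global solutions and divided differences\<close>

text \<open>Banach's fixed point theorem for the Picard operator. The unknown is rescaled to w = exp
  (- L |t|) u, so that weighted functions become bounded continuous ones and the complete space
  \<open>bcontfun\<close> can be used.\<close>

lemma global_ode_solution_exists:
  fixes V :: "real \<Rightarrow> 'a::euclidean_space \<Rightarrow> 'a"
  assumes cont: "continuous_on UNIV (\<lambda>(t, x). V t x)"
    and lip: "\<And>t x y. norm (V t x - V t y) \<le> K * norm (x - y)"
    and bound: "\<And>t. norm (V t 0) \<le> C"
  obtains u where "u 0 = q" "\<And>t. (u has_vector_derivative V t (u t)) (at t)"
proof -
  \<comment> \<open>The contraction factor is |K| / L, at most 1/2 by this choice; the summand 1
    keeps L positive when K = 0.\<close>
  define L where "L = 2 * \<bar>K\<bar> + 1"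
  have "L > 0" by (simp add: L_def)
  have lip': "norm (V t x - V t y) \<le> \<bar>K\<bar> * norm (x - y)" for t x y
    using lip[of t x y] by (smt (verit) mult_right_mono norm_ge_zero)
  define k where "k w s = V s (exp (L * \<bar>s\<bar>) *\<^sub>R w s)" for w :: "real \<Rightarrow> 'a" and s
  define J where "J w t = (LBINT s=0..t. k w s)" for w and t :: real
  define \<Phi> where "\<Phi> w t = exp (- (L * \<bar>t\<bar>)) *\<^sub>R (q + J w t)" for w t
  have k_cont: "continuous_on UNIV (k w)" if "continuous_on UNIV w" for w
  proof -
    have "continuous_on UNIV (\<lambda>s. (s, exp (L * \<bar>s\<bar>) *\<^sub>R w s))"
      by (intro continuous_intros that)
    from continuous_on_compose2[OF cont this] show ?thesis by (simp add: k_def[abs_def])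
  qed
  have J_deriv: "(J w has_vector_derivative k w t) (at t)" if "continuous_on UNIV w" for w t
    unfolding J_def[abs_def] by (rule interval_integral_has_vector_derivative[OF k_cont[OF that]])
  have J_0: "J w 0 = 0" for w by (simp add: J_def zero_ereal_def)
  have mem: "\<Phi> w \<in> bcontfun" if w: "w \<in> bcontfun" for w
  proof -
    have w_cont: "continuous_on UNIV w" using w by (simp add: bcontfun_def)
    obtain B where B: "\<And>t. norm (w t) \<le> B"
      using w by (auto simp: bcontfun_def bounded_iff)
    have "norm (k w s) \<le> (C + \<bar>K\<bar> * B) * exp (L * \<bar>s\<bar>)" for s
    proof -
      have "norm (k w s) \<le> norm (V s 0) + norm (k w s - V s 0)"
        by (metis norm_triangle_sub add.commute)
      also have "norm (k w s - V s 0) \<le> \<bar>K\<bar> * norm (exp (L * \<bar>s\<bar>) *\<^sub>R w s - 0)"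
        unfolding k_def by (rule lip')
      also have "\<dots> \<le> \<bar>K\<bar> * (exp (L * \<bar>s\<bar>) * B)"
        using B by (intro mult_left_mono) (auto intro: mult_left_mono)
      also have "norm (V s 0) \<le> C * exp (L * \<bar>s\<bar>)"
      proof -
        have "C * 1 \<le> C * exp (L * \<bar>s\<bar>)"
          using order_trans[OF norm_ge_zero bound[of 0]] \<open>L > 0\<close> by (intro mult_left_mono) auto
        then show ?thesis using bound[of s] by simp
      qed
      finally show ?thesis by (simp add: algebra_simps)
    qed
    from antiderivative_weighted_bound[OF J_deriv[OF w_cont] J_0 this \<open>L > 0\<close>]
    have J: "norm (J w t) \<le> (C + \<bar>K\<bar> * B) / L * exp (L * \<bar>t\<bar>)" for t .
    have "norm (\<Phi> w t) \<le> norm q + (C + \<bar>K\<bar> * B) / L" for t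
    proof -
      have "norm (\<Phi> w t) = exp (- (L * \<bar>t\<bar>)) * norm (q + J w t)" by (simp add: \<Phi>_def)
      also have "\<dots> \<le> exp (- (L * \<bar>t\<bar>)) * (norm q + (C + \<bar>K\<bar> * B) / L * exp (L * \<bar>t\<bar>))"
        using norm_triangle_ineq[of q "J w t"] J[of t] by (intro mult_left_mono) auto
      also have "\<dots> = exp (- (L * \<bar>t\<bar>)) * norm q + (C + \<bar>K\<bar> * B) / L"
        by (simp add: distrib_left exp_minus)
      also have "exp (- (L * \<bar>t\<bar>)) * norm q \<le> 1 * norm q"
        using \<open>L > 0\<close> by (intro mult_right_mono) auto
      finally show ?thesis by simp
    qed
    moreover have "continuous_on UNIV (J w)"
      using J_deriv[OF w_cont]
      by (meson continuous_at_imp_continuous_on has_vector_derivative_continuous)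
    then have "continuous_on UNIV (\<Phi> w)"
      unfolding \<Phi>_def[abs_def] by (intro continuous_intros)
    ultimately show ?thesis by (auto simp: bcontfun_def bounded_iff)
  qed
  define S where "S w = Bcontfun (\<Phi> (apply_bcontfun w))" for w
  have S: "apply_bcontfun (S w) = \<Phi> (apply_bcontfun w)" for w
    unfolding S_def using Bcontfun_inverse[OF mem[OF apply_bcontfun]] .
  have contraction: "dist (S v) (S w) \<le> 1 / 2 * dist v w" for v w
  proof (rule dist_bound)
    fix t
    let ?J = "\<lambda>t. J (apply_bcontfun v) t - J (apply_bcontfun w) t"
    have "norm (?J t) \<le> (\<bar>K\<bar> * dist v w) / L * exp (L * \<bar>t\<bar>)"
    proof (rule antiderivative_weighted_bound[OF _ _ _ \<open>L > 0\<close>])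
      show "(?J has_vector_derivative k (apply_bcontfun v) t - k (apply_bcontfun w) t) (at t)" for t
        by (intro has_vector_derivative_diff J_deriv) auto
      show "?J 0 = 0" by (simp add: J_0)
      show "norm (k (apply_bcontfun v) t - k (apply_bcontfun w) t)
          \<le> \<bar>K\<bar> * dist v w * exp (L * \<bar>t\<bar>)" for t
      proof -
        have "norm (k (apply_bcontfun v) t - k (apply_bcontfun w) t)
            \<le> \<bar>K\<bar> * norm (exp (L * \<bar>t\<bar>) *\<^sub>R v t - exp (L * \<bar>t\<bar>) *\<^sub>R w t)"
          unfolding k_def by (rule lip')
        also have "\<dots> = \<bar>K\<bar> * (exp (L * \<bar>t\<bar>) * dist (v t) (w t))"
          by (simp add: scaleR_diff_right[symmetric] dist_norm)
        also have "\<dots> \<le> \<bar>K\<bar> * (exp (L * \<bar>t\<bar>) * dist v w)"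
          by (intro mult_left_mono dist_bounded) auto
        finally show ?thesis by (simp add: ac_simps)
      qed
    qed
    then have "exp (- (L * \<bar>t\<bar>)) * norm (?J t)
        \<le> exp (- (L * \<bar>t\<bar>)) * ((\<bar>K\<bar> * dist v w) / L * exp (L * \<bar>t\<bar>))"
      by (intro mult_left_mono) auto
    also have "\<dots> = \<bar>K\<bar> / L * dist v w" by (simp add: exp_minus)
    also have "\<dots> \<le> 1 / 2 * dist v w"
      by (intro mult_right_mono) (auto simp: L_def field_simps)
    also have "exp (- (L * \<bar>t\<bar>)) * norm (?J t) = dist (S v t) (S w t)"
      by (simp add: S \<Phi>_def dist_norm scaleR_diff_right[symmetric])
    finally show "dist (S v t) (S w t) \<le> 1 / 2 * dist v w" .
  qed
  obtain w where w: "S w = w"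
    using banach_fix_type[of "1/2" S] contraction by auto
  define u where "u t = q + J (apply_bcontfun w) t" for t
  have "exp (L * \<bar>t\<bar>) *\<^sub>R w t = u t" for t
    using fun_cong[OF S[of w], of t] by (simp add: w \<Phi>_def u_def exp_minus)
  then have "k (apply_bcontfun w) t = V t (u t)" for t by (simp add: k_def)
  moreover have "(u has_vector_derivative k (apply_bcontfun w) t) (at t)" for t
    unfolding u_def[abs_def]
    using has_vector_derivative_add[OF has_vector_derivative_const J_deriv, of "apply_bcontfun w"]
    by simp
  ultimately show ?thesis
    using that[of u] by (simp add: u_def J_0)
qed

text \<open>The divided difference of an antiderivative of f, in Hadamard's integral form. In
  contrast to the quotient it is defined on the diagonal, where it equals f, and it is jointly
  continuous in x and y.\<close>

definition slope :: "(real \<Rightarrow> real) \<Rightarrow> real \<Rightarrow> real \<Rightarrow> real" where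
  "slope f x y = integral {0..1} (\<lambda>\<theta>. f (y + \<theta> * (x - y)))"

lemma continuous_on_segment_path:
  "continuous_on UNIV f \<Longrightarrow> continuous_on A (\<lambda>\<theta>::real. f (y + \<theta> * (x - y) :: real))"
  by (rule continuous_on_compose2[of UNIV f]) (auto intro!: continuous_intros)

lemma slope_self: "slope f x x = f x"
  by (simp add: slope_def)

lemma slope_mult_diff:
  assumes "\<And>x. (F has_real_derivative f x) (at x)"
  shows "slope f x y * (x - y) = F x - F y"
proof -
  have "((\<lambda>\<theta>. f (y + \<theta> * (x - y)) * (x - y)) has_integral
      F (y + 1 * (x - y)) - F (y + 0 * (x - y))) {0..1}"
  proof (rule fundamental_theorem_of_calculus)
    fix \<theta> :: real
    have "((\<lambda>\<theta>. F (y + \<theta> * (x - y))) has_real_derivative f (y + \<theta> * (x - y)) * (x - y)) (at \<theta>)"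
      by (rule DERIV_chain2[OF assms]) (auto intro!: derivative_eq_intros)
    then show "((\<lambda>\<theta>. F (y + \<theta> * (x - y))) has_vector_derivative f (y + \<theta> * (x - y)) * (x - y))
        (at \<theta> within {0..1})"
      using has_real_derivative_iff_has_vector_derivative has_vector_derivative_at_within by blast
  qed simp
  from integral_unique[OF this] show ?thesis by (simp add: slope_def)
qed

lemma slope_bounds:
  assumes "continuous_on UNIV f" and "\<And>z. min x y \<le> z \<Longrightarrow> z \<le> max x y \<Longrightarrow> a \<le> f z \<and> f z \<le> b"
  shows "a \<le> slope f x y" "slope f x y \<le> b"
proof -
  have int: "(\<lambda>\<theta>. f (y + \<theta> * (x - y))) integrable_on {0..1}"
    by (intro integrable_continuous_real continuous_on_segment_path assms)
  have "a \<le> f (y + \<theta> * (x - y)) \<and> f (y + \<theta> * (x - y)) \<le> b" if "\<theta> \<in> {0..1}" for \<theta>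
  proof (rule assms(2))
    have "y + \<theta> * (x - y) \<in> closed_segment y x"
      using that unfolding closed_segment_def by (auto intro!: exI[of _ \<theta>] simp: algebra_simps)
    then show "min x y \<le> y + \<theta> * (x - y)" "y + \<theta> * (x - y) \<le> max x y"
      by (auto simp: closed_segment_eq_real_ivl split: if_splits)
  qed
  then show "a \<le> slope f x y" "slope f x y \<le> b"
    using integral_le[OF integrable_const_ivl[of a 0 1] int]
      integral_le[OF int integrable_const_ivl[of b 0 1]]
    by (auto simp: slope_def)
qed

lemma continuous_on_slope:
  assumes "continuous_on UNIV f"
  shows "continuous_on UNIV (\<lambda>z. slope f (fst z) (snd z))"
proof -
  have "continuous_on (UNIV \<times> cbox 0 1)
      (\<lambda>(z :: real \<times> real, \<theta> :: real). f (snd z + \<theta> * (fst z - snd z)))"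
    unfolding case_prod_beta
    by (rule continuous_on_compose2[OF assms]) (auto intro!: continuous_intros)
  from integral_continuous_on_param[OF this] show ?thesis
    by (simp add: slope_def[abs_def])
qed

section \<open>Planar linear systems\<close>

lemma gronwall_norm_two_sided:
  fixes E E' :: "real \<Rightarrow> 'a::real_inner"
  assumes deriv: "\<And>s. \<bar>s\<bar> \<le> N \<Longrightarrow> (E has_vector_derivative E' s) (at s)"
    and bound: "\<And>s. \<bar>s\<bar> \<le> N \<Longrightarrow> norm (E' s) \<le> K * norm (E s) + \<eta>"
    and "K \<ge> 0" "\<bar>t\<bar> \<le> N"
  shows "(norm (E t))\<^sup>2 \<le> ((norm (E 0))\<^sup>2 + \<eta>\<^sup>2 * \<bar>t\<bar>) * exp ((2 * K + 1) * \<bar>t\<bar>)"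
proof (cases "t \<ge> 0")
  case True
  have "(norm (E t))\<^sup>2 \<le> ((norm (E 0))\<^sup>2 + \<eta>\<^sup>2 * t) * exp ((2 * K + 1) * t)"
    by (rule gronwall_norm[where E' = E']) (use assms True in auto)
  then show ?thesis using True by simp
next
  case False
  have "(norm (E (- (- t))))\<^sup>2 \<le> ((norm (E (- 0)))\<^sup>2 + \<eta>\<^sup>2 * (- t)) * exp ((2 * K + 1) * (- t))"
  proof (rule gronwall_norm[where E = "\<lambda>s. E (- s)" and E' = "\<lambda>s. - E' (- s)"])
    fix s assume "0 \<le> s" "s \<le> - t"
    then have s: "\<bar>- s\<bar> \<le> N" using assms(4) by linarith
    show "((\<lambda>s. E (- s)) has_vector_derivative - E' (- s)) (at s)"
      by (rule has_vector_derivative_reflect[OF deriv[OF s]])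
    show "norm (- E' (- s)) \<le> K * norm (E (- s)) + \<eta>" using bound[OF s] by simp
  qed (use assms False in auto)
  then show ?thesis using False by simp
qed

text \<open>The matrix has rows (- \<alpha>, 1) and (\<beta>, 0). With derivatives as coefficients
  this is the variational field of the Lienard system; with divided differences it is the exact
  difference of two values of the nonlinear field.\<close>

definition lin_field :: "real \<Rightarrow> real \<Rightarrow> real \<times> real \<Rightarrow> real \<times> real" where
  "lin_field \<alpha> \<beta> z = (snd z - \<alpha> * fst z, \<beta> * fst z)"

lemma lin_field_diff: "lin_field \<alpha> \<beta> (z - w) = lin_field \<alpha> \<beta> z - lin_field \<alpha> \<beta> w"
  and lin_field_add: "lin_field \<alpha> \<beta> (z + w) = lin_field \<alpha> \<beta> z + lin_field \<alpha> \<beta> w"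
  and lin_field_scaleR: "lin_field \<alpha> \<beta> (r *\<^sub>R z) = r *\<^sub>R lin_field \<alpha> \<beta> z"
  by (auto simp: lin_field_def prod_eq_iff algebra_simps)

lemma norm_lin_field:
  assumes "\<bar>\<alpha>\<bar> \<le> L" "\<bar>\<beta>\<bar> \<le> L"
  shows "norm (lin_field \<alpha> \<beta> z) \<le> (2 * L + 1) * norm z"
proof -
  have 1: "\<bar>fst z\<bar> \<le> norm z" "\<bar>snd z\<bar> \<le> norm z"
    using norm_fst_le[of "fst z" "snd z"] norm_snd_le[of "snd z" "fst z"] by auto
  have "norm (lin_field \<alpha> \<beta> z) \<le> \<bar>snd z - \<alpha> * fst z\<bar> + \<bar>\<beta> * fst z\<bar>"
    unfolding lin_field_def using norm_Pair_le[of "snd z - \<alpha> * fst z" "\<beta> * fst z"] by simp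
  also have "\<dots> \<le> \<bar>snd z\<bar> + \<bar>\<alpha>\<bar> * \<bar>fst z\<bar> + \<bar>\<beta>\<bar> * \<bar>fst z\<bar>"
    using abs_triangle_ineq4[of "snd z" "\<alpha> * fst z"] by (simp add: abs_mult)
  also have "\<dots> \<le> norm z + L * norm z + L * norm z"
    using 1 assms by (intro add_mono mult_mono) auto
  finally show ?thesis by (simp add: algebra_simps)
qed

definition lin_sol :: "real \<Rightarrow> (real \<Rightarrow> real) \<Rightarrow> (real \<Rightarrow> real) \<Rightarrow> (real \<Rightarrow> real \<times> real) \<Rightarrow> bool" where
  "lin_sol T \<alpha> \<beta> u \<longleftrightarrow>
     (\<forall>t. 0 \<le> t \<longrightarrow> t \<le> T \<longrightarrow> (u has_vector_derivative lin_field (\<alpha> t) (\<beta> t) (u t)) (at t))"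

text \<open>\<open>lin_sol\<close> says nothing about times outside [0, T], so the solution is not
  unique as a function on the line and \<open>SOME\<close> is used. Only its value at T is
  determined, and that is all the propagator reads off.\<close>

definition propagator ::
    "real \<Rightarrow> (real \<Rightarrow> real) \<Rightarrow> (real \<Rightarrow> real) \<Rightarrow> real \<times> real \<Rightarrow> real \<times> real" where
  "propagator T \<alpha> \<beta> v = (SOME u. lin_sol T \<alpha> \<beta> u \<and> u 0 = v) T"

lemma common_bound_obtain:
  fixes \<alpha> \<beta> :: "real \<Rightarrow> real"
  assumes "continuous_on {0..T} \<alpha>" "continuous_on {0..T} \<beta>"
  obtains L :: real where "\<And>t. 0 \<le> t \<Longrightarrow> t \<le> T \<Longrightarrow> \<bar>\<alpha> t\<bar> \<le> L \<and> \<bar>\<beta> t\<bar> \<le> L"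
proof -
  have "bounded (\<alpha> ` {0..T} \<union> \<beta> ` {0..T})"
    using assms by (auto intro!: compact_imp_bounded compact_continuous_image compact_Icc)
  then obtain L where "\<forall>x \<in> \<alpha> ` {0..T} \<union> \<beta> ` {0..T}. norm x \<le> L"
    unfolding bounded_iff by blast
  then show ?thesis using that[of L] by auto
qed

lemma lin_sol_exists:
  assumes "continuous_on {0..T} \<alpha>" "continuous_on {0..T} \<beta>" "T \<ge> 0"
  obtains u where "lin_sol T \<alpha> \<beta> u" "u 0 = v"
proof -
  \<comment> \<open>Clamping time to [0, T] extends the coefficients to bounded continuous ones on
    the whole line. The solution then has two-sided derivatives also at 0 and T, as
    \<open>lin_sol\<close> demands.\<close>
  define \<kappa> where "\<kappa> t = max 0 (min t T)" for t
  have \<kappa>: "continuous_on UNIV \<kappa>" "\<And>t. \<kappa> t \<in> {0..T}"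
    using \<open>T \<ge> 0\<close> unfolding \<kappa>_def[abs_def] by (auto intro!: continuous_intros)
  have cont: "continuous_on UNIV (\<lambda>t. \<alpha> (\<kappa> t))" "continuous_on UNIV (\<lambda>t. \<beta> (\<kappa> t))"
    using assms \<kappa> by (auto intro: continuous_on_compose2)
  obtain L where "\<And>t. 0 \<le> t \<Longrightarrow> t \<le> T \<Longrightarrow> \<bar>\<alpha> t\<bar> \<le> L \<and> \<bar>\<beta> t\<bar> \<le> L"
    using common_bound_obtain[OF assms(1,2)] by blast
  then have L: "\<bar>\<alpha> (\<kappa> t)\<bar> \<le> L" "\<bar>\<beta> (\<kappa> t)\<bar> \<le> L" for t
    using \<kappa>(2)[of t] by auto
  obtain u where u: "u 0 = v"
    "\<And>t. (u has_vector_derivative lin_field (\<alpha> (\<kappa> t)) (\<beta> (\<kappa> t)) (u t)) (at t)"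
  proof (rule global_ode_solution_exists[where V = "\<lambda>t. lin_field (\<alpha> (\<kappa> t)) (\<beta> (\<kappa> t))" and q = v])
    show "continuous_on UNIV (\<lambda>(t, x). lin_field (\<alpha> (\<kappa> t)) (\<beta> (\<kappa> t)) x)"
      unfolding lin_field_def case_prod_beta
      by (intro continuous_intros continuous_on_compose2[OF cont(1)]
          continuous_on_compose2[OF cont(2)]) auto
    show "norm (lin_field (\<alpha> (\<kappa> t)) (\<beta> (\<kappa> t)) x - lin_field (\<alpha> (\<kappa> t)) (\<beta> (\<kappa> t)) y)
        \<le> (2 * L + 1) * norm (x - y)" for t x y
      unfolding lin_field_diff[symmetric] by (rule norm_lin_field[OF L])
    show "norm (lin_field (\<alpha> (\<kappa> t)) (\<beta> (\<kappa> t)) 0) \<le> 0" for t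
      by (simp add: lin_field_def)
  qed blast
  have "\<kappa> t = t" if "0 \<le> t" "t \<le> T" for t using that by (simp add: \<kappa>_def)
  then have "lin_sol T \<alpha> \<beta> u" unfolding lin_sol_def using u(2) by metis
  then show ?thesis using that u(1) by blast
qed

text \<open>The difference solves the first system with zero initial value and a forcing term caused
  by the coefficient errors, of size at most 2 \<epsilon> |v|, where Gronwall bounds |v|. The result
  is linear in \<epsilon> with a constant depending on L and T only: \<epsilon> = 0 gives
  uniqueness, small \<epsilon> gives continuity in the coefficients.\<close>

lemma lin_sol_perturbation:
  assumes u: "lin_sol T \<alpha> \<beta> u" and v: "lin_sol T \<alpha>' \<beta>' v" and "u 0 = v 0" "T \<ge> 0"
    and L: "\<And>t. 0 \<le> t \<Longrightarrow> t \<le> T \<Longrightarrow> \<bar>\<alpha> t\<bar> \<le> L \<and> \<bar>\<beta> t\<bar> \<le> L \<and> \<bar>\<alpha>' t\<bar> \<le> L \<and> \<bar>\<beta>' t\<bar> \<le> L"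
    and \<epsilon>: "\<And>t. 0 \<le> t \<Longrightarrow> t \<le> T \<Longrightarrow> \<bar>\<alpha> t - \<alpha>' t\<bar> \<le> \<epsilon> \<and> \<bar>\<beta> t - \<beta>' t\<bar> \<le> \<epsilon>"
  shows "norm (u T - v T) \<le> 3 * sqrt T * exp ((4 * L + 3) * T) * \<epsilon> * norm (v 0)"
proof -
  define k where "k = 2 * (2 * L + 1) + 1"
  have "L \<ge> 0" "\<epsilon> \<ge> 0" using L[of 0] \<epsilon>[of 0] \<open>T \<ge> 0\<close> by auto
  define \<eta> where "\<eta> = 3 * \<epsilon> * (norm (v 0) * exp (k * T / 2))"
  have v_bound: "norm (v t) \<le> norm (v 0) * exp (k * T / 2)" if t: "0 \<le> t" "t \<le> T" for t
  proof -
    have "(norm (v t))\<^sup>2 \<le> ((norm (v 0))\<^sup>2 + 0\<^sup>2 * t) * exp ((2 * (2 * L + 1) + 1) * t)"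
    proof (rule gronwall_norm)
      fix s assume s: "0 \<le> s" "s \<le> t"
      then show "(v has_vector_derivative lin_field (\<alpha>' s) (\<beta>' s) (v s)) (at s)"
        using v t by (simp add: lin_sol_def)
      show "norm (lin_field (\<alpha>' s) (\<beta>' s) (v s)) \<le> (2 * L + 1) * norm (v s) + 0"
        using norm_lin_field[of "\<alpha>' s" L "\<beta>' s"] L[of s] s t by simp
    qed (use \<open>L \<ge> 0\<close> t in auto)
    also have "\<dots> \<le> (norm (v 0))\<^sup>2 * exp (k * T)"
      using \<open>L \<ge> 0\<close> t by (auto simp: k_def intro!: mult_left_mono)
    also have "\<dots> = (norm (v 0) * exp (k * T / 2))\<^sup>2"
      by (simp add: power_mult_distrib exp_double[symmetric])
    finally show ?thesis by (rule power2_le_imp_le) simp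
  qed
  have "(norm (u T - v T))\<^sup>2 \<le> ((norm (u 0 - v 0))\<^sup>2 + \<eta>\<^sup>2 * T) * exp ((2 * (2 * L + 1) + 1) * T)"
  proof (rule gronwall_norm)
    fix t assume t: "0 \<le> t" "t \<le> T"
    show "((\<lambda>t. u t - v t) has_vector_derivative
        lin_field (\<alpha> t) (\<beta> t) (u t) - lin_field (\<alpha>' t) (\<beta>' t) (v t)) (at t)"
      using u v t by (intro has_vector_derivative_diff) (auto simp: lin_sol_def)
    have "lin_field (\<alpha> t) (\<beta> t) (u t) - lin_field (\<alpha>' t) (\<beta>' t) (v t)
        = lin_field (\<alpha> t) (\<beta> t) (u t - v t) + ((\<alpha>' t - \<alpha> t) * fst (v t), (\<beta> t - \<beta>' t) * fst (v t))"
      by (simp add: lin_field_def prod_eq_iff algebra_simps)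
    also have "norm \<dots> \<le> (2 * L + 1) * norm (u t - v t)
        + (\<bar>\<alpha>' t - \<alpha> t\<bar> * \<bar>fst (v t)\<bar> + \<bar>\<beta> t - \<beta>' t\<bar> * \<bar>fst (v t)\<bar>)"
      using norm_lin_field[of "\<alpha> t" L "\<beta> t"] L[OF t]
      by (intro norm_triangle_le add_mono order_trans[OF norm_Pair_le]) (auto simp: abs_mult)
    also have "\<bar>\<alpha>' t - \<alpha> t\<bar> * \<bar>fst (v t)\<bar> + \<bar>\<beta> t - \<beta>' t\<bar> * \<bar>fst (v t)\<bar>
        \<le> \<epsilon> * norm (v t) + \<epsilon> * norm (v t)"
      using \<epsilon>[OF t] norm_fst_le[of "fst (v t)" "snd (v t)"] \<open>\<epsilon> \<ge> 0\<close>
      by (intro add_mono mult_mono) auto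
    also have "\<dots> \<le> \<eta>"
    proof -
      have "\<epsilon> * norm (v t) \<le> \<epsilon> * (norm (v 0) * exp (k * T / 2))"
        using v_bound[OF t] \<open>\<epsilon> \<ge> 0\<close> by (rule mult_left_mono)
      moreover have "0 \<le> \<epsilon> * (norm (v 0) * exp (k * T / 2))"
        using \<open>\<epsilon> \<ge> 0\<close> by auto
      ultimately show ?thesis unfolding \<eta>_def by linarith
    qed
    finally show "norm (lin_field (\<alpha> t) (\<beta> t) (u t) - lin_field (\<alpha>' t) (\<beta>' t) (v t))
        \<le> (2 * L + 1) * norm (u t - v t) + \<eta>" by simp
  qed (use \<open>L \<ge> 0\<close> \<open>T \<ge> 0\<close> in auto)
  also have "\<dots> = (\<eta> * sqrt T * exp (k * T / 2))\<^sup>2"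
    using \<open>u 0 = v 0\<close> \<open>T \<ge> 0\<close> by (simp add: k_def power_mult_distrib exp_double[symmetric])
  finally have "norm (u T - v T) \<le> \<eta> * sqrt T * exp (k * T / 2)"
    by (rule power2_le_imp_le) (use \<open>\<epsilon> \<ge> 0\<close> \<open>T \<ge> 0\<close> in \<open>auto simp: \<eta>_def\<close>)
  also have "\<dots> = 3 * sqrt T * (exp (k * T / 2) * exp (k * T / 2)) * \<epsilon> * norm (v 0)"
    by (simp add: \<eta>_def)
  also have "exp (k * T / 2) * exp (k * T / 2) = exp ((4 * L + 3) * T)"
    unfolding exp_add[symmetric] by (simp add: k_def algebra_simps)
  finally show ?thesis .
qed

lemma lin_sol_unique:
  assumes "lin_sol T \<alpha> \<beta> u" "lin_sol T \<alpha> \<beta> v" "u 0 = v 0" "T \<ge> 0"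
    and "continuous_on {0..T} \<alpha>" "continuous_on {0..T} \<beta>"
  shows "u T = v T"
proof -
  obtain L where "\<And>t. 0 \<le> t \<Longrightarrow> t \<le> T \<Longrightarrow> \<bar>\<alpha> t\<bar> \<le> L \<and> \<bar>\<beta> t\<bar> \<le> L"
    using common_bound_obtain[OF assms(5,6)] by blast
  with lin_sol_perturbation[OF assms(1-4), of L 0] show ?thesis by simp
qed

lemma propagator_eq:
  assumes "lin_sol T \<alpha> \<beta> u" "T \<ge> 0" "continuous_on {0..T} \<alpha>" "continuous_on {0..T} \<beta>"
  shows "propagator T \<alpha> \<beta> (u 0) = u T"
proof -
  define v where "v = (SOME v. lin_sol T \<alpha> \<beta> v \<and> v 0 = u 0)"
  have v: "lin_sol T \<alpha> \<beta> v \<and> v 0 = u 0"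
    unfolding v_def by (rule someI[of _ u]) (use assms in auto)
  have "v T = u T"
    by (rule lin_sol_unique[OF conjunct1[OF v] assms(1) conjunct2[OF v] assms(2-4)])
  then show ?thesis by (simp add: propagator_def v_def)
qed

lemma propagator_perturbation:
  assumes "T \<ge> 0"
    and cont: "continuous_on {0..T} \<alpha>" "continuous_on {0..T} \<beta>"
      "continuous_on {0..T} \<alpha>'" "continuous_on {0..T} \<beta>'"
    and L: "\<And>t. 0 \<le> t \<Longrightarrow> t \<le> T \<Longrightarrow> \<bar>\<alpha> t\<bar> \<le> L \<and> \<bar>\<beta> t\<bar> \<le> L \<and> \<bar>\<alpha>' t\<bar> \<le> L \<and> \<bar>\<beta>' t\<bar> \<le> L"
    and \<epsilon>: "\<And>t. 0 \<le> t \<Longrightarrow> t \<le> T \<Longrightarrow> \<bar>\<alpha> t - \<alpha>' t\<bar> \<le> \<epsilon> \<and> \<bar>\<beta> t - \<beta>' t\<bar> \<le> \<epsilon>"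
  shows "norm (propagator T \<alpha> \<beta> v - propagator T \<alpha>' \<beta>' v)
      \<le> 3 * sqrt T * exp ((4 * L + 3) * T) * \<epsilon> * norm v"
proof -
  obtain u where u: "lin_sol T \<alpha> \<beta> u" "u 0 = v"
    using lin_sol_exists cont \<open>T \<ge> 0\<close> by blast
  obtain w where w: "lin_sol T \<alpha>' \<beta>' w" "w 0 = v"
    using lin_sol_exists cont \<open>T \<ge> 0\<close> by blast
  have "norm (u T - w T) \<le> 3 * sqrt T * exp ((4 * L + 3) * T) * \<epsilon> * norm (w 0)"
    by (rule lin_sol_perturbation[OF u(1) w(1) _ \<open>T \<ge> 0\<close> L \<epsilon>]) (simp_all add: u w)
  then show ?thesis
    using propagator_eq[OF u(1) \<open>T \<ge> 0\<close> cont(1,2)] propagator_eq[OF w(1) \<open>T \<ge> 0\<close> cont(3,4)]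
    by (simp add: u(2) w(2))
qed

lemma bounded_linear_propagator:
  assumes "T \<ge> 0" and cont: "continuous_on {0..T} \<alpha>" "continuous_on {0..T} \<beta>"
  shows "bounded_linear (propagator T \<alpha> \<beta>)"
proof -
  have add: "propagator T \<alpha> \<beta> (v + w) = propagator T \<alpha> \<beta> v + propagator T \<alpha> \<beta> w" for v w
  proof -
    obtain x where x: "lin_sol T \<alpha> \<beta> x" "x 0 = v"
      using lin_sol_exists cont \<open>T \<ge> 0\<close> by blast
    obtain y where y: "lin_sol T \<alpha> \<beta> y" "y 0 = w"
      using lin_sol_exists cont \<open>T \<ge> 0\<close> by blast
    have "lin_sol T \<alpha> \<beta> (\<lambda>t. x t + y t)"
      using x(1) y(1) unfolding lin_sol_def
      by (auto simp: lin_field_add intro!: has_vector_derivative_add)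
    from propagator_eq[OF this assms] propagator_eq[OF x(1) assms] propagator_eq[OF y(1) assms]
    show ?thesis by (simp add: x y)
  qed
  have scale: "propagator T \<alpha> \<beta> (r *\<^sub>R v) = r *\<^sub>R propagator T \<alpha> \<beta> v" for r v
  proof -
    obtain x where x: "lin_sol T \<alpha> \<beta> x" "x 0 = v"
      using lin_sol_exists cont \<open>T \<ge> 0\<close> by blast
    have "lin_sol T \<alpha> \<beta> (\<lambda>t. r *\<^sub>R x t)"
      using x(1) unfolding lin_sol_def lin_field_scaleR
      by (blast intro: bounded_linear.has_vector_derivative[OF bounded_linear_scaleR_right])
    from propagator_eq[OF this assms] propagator_eq[OF x(1) assms]
    show ?thesis by (simp add: x)
  qed
  have "linear (propagator T \<alpha> \<beta>)" by (rule linearI) (auto simp: add scale)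
  then show ?thesis by (simp add: linear_conv_bounded_linear)
qed

section \<open>The flow and its differentiability\<close>

lemma abs_fst_le_norm: "\<bar>fst z\<bar> \<le> norm z" for z :: "real \<times> real"
  using norm_fst_le[of "fst z" "snd z"] by simp

lemma abs_snd_le_norm: "\<bar>snd z\<bar> \<le> norm z" for z :: "real \<times> real"
  using norm_snd_le[of "snd z" "fst z"] by simp

lemma norm_le_abs_add_abs: "norm z \<le> \<bar>fst z\<bar> + \<bar>snd z\<bar>" for z :: "real \<times> real"
  using norm_Pair_le[of "fst z" "snd z"] by simp

text \<open>By compactness of [0, T], coefficients that are jointly continuous in parameter and time
  vary uniformly in time, and the perturbation bound turns this into continuity in operator norm. It
  is applied twice: with two trajectories, one of them fixed, for differentiability of the flow, and
  with equal trajectories for continuity of the derivative.\<close>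

lemma isCont_propagator:
  fixes \<alpha> \<beta> :: "'a::metric_space \<Rightarrow> real \<Rightarrow> real"
  assumes "T \<ge> 0"
    and \<alpha>: "continuous_on UNIV (\<lambda>(q, t). \<alpha> q t)" and \<beta>: "continuous_on UNIV (\<lambda>(q, t). \<beta> q t)"
  shows "isCont (\<lambda>q. Blinfun (propagator T (\<alpha> q) (\<beta> q))) q0"
proof -
  have cont: "continuous_on {0..T} (\<alpha> q)" "continuous_on {0..T} (\<beta> q)" for q
  proof -
    have "continuous_on {0..T} (\<lambda>t. (q, t))" by (intro continuous_intros)
    from continuous_on_compose2[OF \<alpha> this] continuous_on_compose2[OF \<beta> this]
    show "continuous_on {0..T} (\<alpha> q)" "continuous_on {0..T} (\<beta> q)" by simp_all
  qed
  obtain L where L: "\<And>t. 0 \<le> t \<Longrightarrow> t \<le> T \<Longrightarrow> \<bar>\<alpha> q0 t\<bar> \<le> L \<and> \<bar>\<beta> q0 t\<bar> \<le> L"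
    using common_bound_obtain[OF cont] by blast
  \<comment> \<open>L + 1 bounds the coefficients at all nearby parameters, since \<epsilon> is
    chosen at most 1; one constant then serves the whole neighbourhood.\<close>
  define C where "C = 3 * sqrt T * exp ((4 * (L + 1) + 3) * T)"
  have "C \<ge> 0" using \<open>T \<ge> 0\<close> by (simp add: C_def)
  show ?thesis
    unfolding isCont_def
  proof (rule tendstoI)
    fix e :: real assume "e > 0"
    define \<epsilon> where "\<epsilon> = min 1 (e / (2 * (C + 1)))"
    have "\<epsilon> > 0" "\<epsilon> \<le> 1" using \<open>e > 0\<close> \<open>C \<ge> 0\<close> by (auto simp: \<epsilon>_def)
    have "C * \<epsilon> \<le> (C + 1) * (e / (2 * (C + 1)))"
      using \<open>C \<ge> 0\<close> \<open>\<epsilon> > 0\<close> by (intro mult_mono) (auto simp: \<epsilon>_def)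
    also have "\<dots> = e / 2" using \<open>C \<ge> 0\<close> by (simp add: field_simps)
    also have "\<dots> < e" using \<open>e > 0\<close> by simp
    finally have "C * \<epsilon> < e" .
    obtain U where U: "q0 \<in> U" "open U"
      "\<forall>q\<in>U \<inter> UNIV. \<forall>t\<in>{0..T}. dist (case (q, t) of (q, t) \<Rightarrow> \<alpha> q t) (case (q0, t) of (q, t) \<Rightarrow> \<alpha> q t) \<le> \<epsilon>"
      using continuous_on_prod_compactE[OF continuous_on_subset[OF \<alpha> subset_UNIV] compact_Icc UNIV_I \<open>\<epsilon> > 0\<close>]
      by metis
    obtain V where V: "q0 \<in> V" "open V"
      "\<forall>q\<in>V \<inter> UNIV. \<forall>t\<in>{0..T}. dist (case (q, t) of (q, t) \<Rightarrow> \<beta> q t) (case (q0, t) of (q, t) \<Rightarrow> \<beta> q t) \<le> \<epsilon>"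
      using continuous_on_prod_compactE[OF continuous_on_subset[OF \<beta> subset_UNIV] compact_Icc UNIV_I \<open>\<epsilon> > 0\<close>]
      by metis
    have "dist (Blinfun (propagator T (\<alpha> q) (\<beta> q))) (Blinfun (propagator T (\<alpha> q0) (\<beta> q0))) < e"
      if q: "q \<in> U \<inter> V" for q
    proof -
      have close: "\<bar>\<alpha> q t - \<alpha> q0 t\<bar> \<le> \<epsilon> \<and> \<bar>\<beta> q t - \<beta> q0 t\<bar> \<le> \<epsilon>" if "0 \<le> t" "t \<le> T" for t
        using U(3) V(3) q that by (auto simp: dist_real_def)
      have bound: "\<bar>\<alpha> q t\<bar> \<le> L + 1 \<and> \<bar>\<beta> q t\<bar> \<le> L + 1 \<and> \<bar>\<alpha> q0 t\<bar> \<le> L + 1 \<and> \<bar>\<beta> q0 t\<bar> \<le> L + 1"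
        if "0 \<le> t" "t \<le> T" for t
        using L[OF that] close[OF that] \<open>\<epsilon> \<le> 1\<close> by linarith
      have "norm (Blinfun (propagator T (\<alpha> q) (\<beta> q)) - Blinfun (propagator T (\<alpha> q0) (\<beta> q0))) \<le> C * \<epsilon>"
      proof (rule norm_blinfun_bound)
        show "norm (blinfun_apply (Blinfun (propagator T (\<alpha> q) (\<beta> q)) - Blinfun (propagator T (\<alpha> q0) (\<beta> q0))) v)
            \<le> C * \<epsilon> * norm v" for v
          using propagator_perturbation[OF \<open>T \<ge> 0\<close> cont cont bound close, of v]
          by (simp add: blinfun.diff_left bounded_linear_Blinfun_apply
              bounded_linear_propagator[OF \<open>T \<ge> 0\<close> cont] C_def)
      qed (use \<open>C \<ge> 0\<close> \<open>\<epsilon> > 0\<close> in auto)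
      then show ?thesis using \<open>C * \<epsilon> < e\<close> by (simp add: dist_norm)
    qed
    then show "\<forall>\<^sub>F q in at q0. dist (Blinfun (propagator T (\<alpha> q) (\<beta> q)))
        (Blinfun (propagator T (\<alpha> q0) (\<beta> q0))) < e"
      using U V unfolding eventually_at_topological by (intro exI[of _ "U \<inter> V"]) (auto intro!: open_Int)
  qed
qed

locale lienard_system =
  fixes F f G G' p :: "real \<Rightarrow> real" and M c d B :: real
  assumes F_deriv: "\<And>x. (F has_real_derivative f x) (at x)"
    and f_cont: "continuous_on UNIV f"
    and f_bound: "\<And>x. \<bar>f x\<bar> \<le> M"
    and G_deriv: "\<And>x. (G has_real_derivative G' x) (at x)"
    and G'_cont: "continuous_on UNIV G'"
    and G_mono: "strict_mono G"
    and G_surj: "surj G"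
    and G_growth: "\<And>x. \<bar>G x\<bar> \<le> c + d * \<bar>x\<bar>"
    and c_nonneg: "c \<ge> 0" and d_nonneg: "d \<ge> 0"
    and p_cont: "continuous_on UNIV p"
    and p_bound: "\<And>t. \<bar>p t\<bar> \<le> B"
begin

definition field :: "real \<Rightarrow> real \<times> real \<Rightarrow> real \<times> real" where
  "field t z = (snd z - F (fst z), G (fst z) + p t)"

definition sol_on :: "real \<Rightarrow> (real \<Rightarrow> real \<times> real) \<Rightarrow> bool" where
  "sol_on N u \<longleftrightarrow> (\<forall>t. \<bar>t\<bar> \<le> N \<longrightarrow> (u has_vector_derivative field t (u t)) (at t))"

definition sol :: "(real \<Rightarrow> real \<times> real) \<Rightarrow> bool" where
  "sol u \<longleftrightarrow> (\<forall>t. (u has_vector_derivative field t (u t)) (at t))"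

lemma sol_imp_sol_on: "sol u \<Longrightarrow> sol_on N u"
  by (simp add: sol_def sol_on_def)

lemma M_nonneg: "M \<ge> 0"
  using f_bound[of 0] by linarith

lemma F_cont: "continuous_on A F"
  using DERIV_continuous_on[of A F f] F_deriv has_field_derivative_at_within by blast

lemma G_cont: "continuous_on A G"
  using DERIV_continuous_on[of A G G'] G_deriv has_field_derivative_at_within by blast

lemma slope_f_bound: "\<bar>slope f x y\<bar> \<le> M"
  using slope_bounds[OF f_cont, of x y "- M" M] f_bound by (simp add: abs_le_iff minus_le_iff)

lemma F_lipschitz: "\<bar>F x - F y\<bar> \<le> M * \<bar>x - y\<bar>"
  unfolding slope_mult_diff[OF F_deriv, symmetric] abs_mult
  by (intro mult_right_mono slope_f_bound) simp

lemma slope_bound_exists: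
  "\<exists>L\<ge>0. \<forall>x y. \<bar>x\<bar> \<le> R \<longrightarrow> \<bar>y\<bar> \<le> R \<longrightarrow> \<bar>slope f x y\<bar> \<le> L \<and> \<bar>slope G' x y\<bar> \<le> L"
proof -
  have "bounded (G' ` {- R..R})"
    by (intro compact_imp_bounded compact_continuous_image compact_Icc
        continuous_on_subset[OF G'_cont]) simp
  then obtain L where "\<forall>y\<in>G' ` {- R..R}. norm y \<le> L"
    unfolding bounded_iff by blast
  then have L: "\<bar>G' x\<bar> \<le> L" if "\<bar>x\<bar> \<le> R" for x
    using that by (simp add: abs_le_iff)
  have "\<bar>slope G' x y\<bar> \<le> L" if "\<bar>x\<bar> \<le> R" "\<bar>y\<bar> \<le> R" for x y
  proof -
    have "- L \<le> G' z \<and> G' z \<le> L" if "min x y \<le> z" "z \<le> max x y" for z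
      using L[of z] that \<open>\<bar>x\<bar> \<le> R\<close> \<open>\<bar>y\<bar> \<le> R\<close> by linarith
    from slope_bounds[OF G'_cont this] show ?thesis by (simp add: abs_le_iff minus_le_iff)
  qed
  then show ?thesis
    using slope_f_bound M_nonneg by (intro exI[of _ "max M L"]) (auto simp: le_max_iff_disj)
qed

text \<open>An exact identity without remainder: the difference of two solutions solves a linear
  system whose coefficients depend continuously on the two trajectories. Lipschitz dependence and
  differentiability of the flow both rest on it.\<close>

lemma field_diff:
  "field t z - field t w
    = lin_field (slope f (fst z) (fst w)) (slope G' (fst z) (fst w)) (z - w)"
  using slope_mult_diff[OF F_deriv] slope_mult_diff[OF G_deriv]
  by (simp add: field_def lin_field_def)

section \<open>A priori bounds from the linear growth of the field\<close>

definition bound_rate :: real where "bound_rate = 1 + M + d"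
definition bound_const :: real where "bound_const = \<bar>F 0\<bar> + c + B"
definition apriori_bound :: "real \<Rightarrow> real \<Rightarrow> real" where
  "apriori_bound r N = sqrt ((r\<^sup>2 + bound_const\<^sup>2 * N) * exp ((2 * bound_rate + 1) * N))"

text \<open>The number w stands for G at x or at a truncated x, so one estimate serves the true
  field and the truncated one. The rate collects 1 from y, M from F and d from G.\<close>

lemma norm_growth:
  assumes "\<bar>w\<bar> \<le> c + d * \<bar>fst z\<bar>"
  shows "norm (snd z - F (fst z), w + p t) \<le> bound_rate * norm z + bound_const"
proof -
  have "norm (snd z - F (fst z), w + p t) \<le> \<bar>snd z - F (fst z)\<bar> + \<bar>w + p t\<bar>"
    using norm_Pair_le[of "snd z - F (fst z)" "w + p t"] by simp
  also have "\<dots> \<le> \<bar>snd z\<bar> + (\<bar>F 0\<bar> + M * \<bar>fst z\<bar>) + (c + d * \<bar>fst z\<bar>) + B"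
    using F_lipschitz[of "fst z" 0] assms p_bound[of t] by simp linarith
  also have "\<dots> \<le> norm z + (\<bar>F 0\<bar> + M * norm z) + (c + d * norm z) + B"
    using abs_fst_le_norm[of z] abs_snd_le_norm[of z] M_nonneg d_nonneg
    by (intro add_mono mult_left_mono order_refl) auto
  finally show ?thesis by (simp add: bound_rate_def bound_const_def algebra_simps)
qed

lemma apriori_bound:
  assumes "\<And>s. \<bar>s\<bar> \<le> N \<Longrightarrow>
      (u has_vector_derivative (snd (u s) - F (fst (u s)), w s + p s)) (at s)"
    and "\<And>s. \<bar>s\<bar> \<le> N \<Longrightarrow> \<bar>w s\<bar> \<le> c + d * \<bar>fst (u s)\<bar>"
    and "norm (u 0) \<le> r" "\<bar>t\<bar> \<le> N"
  shows "norm (u t) \<le> apriori_bound r N"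
proof -
  have rate: "bound_rate \<ge> 0" using M_nonneg d_nonneg by (simp add: bound_rate_def)
  have "(norm (u t))\<^sup>2 \<le> ((norm (u 0))\<^sup>2 + bound_const\<^sup>2 * \<bar>t\<bar>) * exp ((2 * bound_rate + 1) * \<bar>t\<bar>)"
    by (rule gronwall_norm_two_sided[OF assms(1) norm_growth[OF assms(2)] rate assms(4)])
  also have "\<dots> \<le> (r\<^sup>2 + bound_const\<^sup>2 * N) * exp ((2 * bound_rate + 1) * N)"
    using assms(3,4) rate by (intro mult_mono add_mono power_mono mult_left_mono) auto
  finally show ?thesis unfolding apriori_bound_def by (rule real_le_rsqrt)
qed

lemma sol_on_apriori_bound:
  assumes "sol_on N u" "norm (u 0) \<le> r" "\<bar>t\<bar> \<le> N"
  shows "norm (u t) \<le> apriori_bound r N"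
proof (rule apriori_bound[of N u "\<lambda>s. G (fst (u s))", OF _ _ assms(2,3)])
  show "(u has_vector_derivative (snd (u s) - F (fst (u s)), G (fst (u s)) + p s)) (at s)"
    if "\<bar>s\<bar> \<le> N" for s
    using assms(1) that by (simp add: sol_on_def field_def)
qed (rule G_growth)

text \<open>Up to time N, solutions starting in the ball of radius r stay within the a priori bound,
  where the divided differences are bounded; Gronwall's inequality then applies to the linear system
  for the difference.\<close>

lemma sol_on_lipschitz:
  "\<exists>C\<ge>0. \<forall>u v t. sol_on N u \<longrightarrow> sol_on N v \<longrightarrow> norm (u 0) \<le> r \<longrightarrow> norm (v 0) \<le> r \<longrightarrow> \<bar>t\<bar> \<le> N \<longrightarrow>
    norm (u t - v t) \<le> C * norm (u 0 - v 0)"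
proof -
  obtain L where L: "L \<ge> 0" "\<And>x y. \<bar>x\<bar> \<le> apriori_bound r N \<Longrightarrow> \<bar>y\<bar> \<le> apriori_bound r N \<Longrightarrow>
      \<bar>slope f x y\<bar> \<le> L \<and> \<bar>slope G' x y\<bar> \<le> L"
    using slope_bound_exists[of "apriori_bound r N"] by blast
  define k where "k = 2 * (2 * L + 1) + 1"
  show ?thesis
  proof (intro exI[of _ "exp (k * N / 2)"] conjI allI impI)
    fix u v :: "real \<Rightarrow> real \<times> real" and t
    assume *: "sol_on N u" "sol_on N v" "norm (u 0) \<le> r" "norm (v 0) \<le> r" "\<bar>t\<bar> \<le> N"
    have "(norm (u t - v t))\<^sup>2 \<le> ((norm (u 0 - v 0))\<^sup>2 + 0\<^sup>2 * \<bar>t\<bar>) * exp (k * \<bar>t\<bar>)"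
      unfolding k_def
    proof (rule gronwall_norm_two_sided)
      fix s assume s: "\<bar>s\<bar> \<le> N"
      show "((\<lambda>t. u t - v t) has_vector_derivative field s (u s) - field s (v s)) (at s)"
        using * s by (intro has_vector_derivative_diff) (auto simp: sol_on_def)
      have "\<bar>fst (u s)\<bar> \<le> apriori_bound r N" "\<bar>fst (v s)\<bar> \<le> apriori_bound r N"
        using sol_on_apriori_bound * s abs_fst_le_norm order_trans by blast+
      with L(2) show "norm (field s (u s) - field s (v s)) \<le> (2 * L + 1) * norm (u s - v s) + 0"
        unfolding field_diff by (simp add: norm_lin_field)
    qed (use * L in auto)
    also have "\<dots> \<le> (norm (u 0 - v 0))\<^sup>2 * exp (k * N)"
      using * L by (auto intro!: mult_left_mono simp: k_def)
    also have "\<dots> = (exp (k * N / 2) * norm (u 0 - v 0))\<^sup>2"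
      by (simp add: power_mult_distrib exp_double[symmetric])
    finally show "norm (u t - v t) \<le> exp (k * N / 2) * norm (u 0 - v 0)"
      by (rule power2_le_imp_le) auto
  qed simp
qed

lemma sol_on_unique:
  assumes "sol_on N u" "sol_on N v" "u 0 = v 0" "\<bar>t\<bar> \<le> N"
  shows "u t = v t"
proof -
  show ?thesis using sol_on_lipschitz[of N "norm (u 0)"] assms by force
qed

lemma sol_unique: "sol u \<Longrightarrow> sol v \<Longrightarrow> u 0 = v 0 \<Longrightarrow> u = v"
  using sol_on_unique[of "\<bar>t\<bar>" u v t for t] sol_imp_sol_on by blast

text \<open>Truncating \<open>G\<close> outside the a priori bound makes the field globally Lipschitz without changing
  the solution up to time \<open>N\<close>.\<close>
lemma sol_on_exists: obtains u where "sol_on N u" "u 0 = q"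
proof -
  \<comment> \<open>The maximum with 0 keeps the interval [- R, R] nonempty: for negative N the
    argument of the square root in \<open>apriori_bound\<close> can be negative, and then so is its
    value.\<close>
  define R where "R = max 0 (apriori_bound (norm q) N)"
  define cl where "cl x = max (- R) (min x R)" for x
  have cl: "\<bar>cl x\<bar> \<le> R" "\<bar>cl x\<bar> \<le> \<bar>x\<bar>" "\<bar>cl x - cl y\<bar> \<le> \<bar>x - y\<bar>" for x y
    unfolding cl_def R_def by linarith+
  have cl_cont: "continuous_on UNIV cl" unfolding cl_def[abs_def] by (intro continuous_intros)
  obtain L where L: "L \<ge> 0" "\<And>x y. \<bar>x\<bar> \<le> R \<Longrightarrow> \<bar>y\<bar> \<le> R \<Longrightarrow> \<bar>slope G' x y\<bar> \<le> L"
    using slope_bound_exists[of R] by blast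
  define V where "V t z = (snd z - F (fst z), G (cl (fst z)) + p t)" for t z
  obtain u where u: "u 0 = q" "\<And>t. (u has_vector_derivative V t (u t)) (at t)"
  proof (rule global_ode_solution_exists[where V = V and q = q])
    show "continuous_on UNIV (\<lambda>(t, z). V t z)"
      unfolding V_def case_prod_beta
      by (intro continuous_intros continuous_on_compose2[OF p_cont]
          continuous_on_compose2[OF F_cont] continuous_on_compose2[OF G_cont]
          continuous_on_compose2[OF cl_cont]) auto
    show "norm (V t z - V t w) \<le> (1 + M + L) * norm (z - w)" for t z w
    proof -
      let ?x = "fst z" and ?y = "fst w"
      have "\<bar>G (cl ?x) - G (cl ?y)\<bar> \<le> L * \<bar>cl ?x - cl ?y\<bar>"
        unfolding slope_mult_diff[OF G_deriv, symmetric] abs_mult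
        using L cl by (intro mult_right_mono) auto
      also have "\<dots> \<le> L * \<bar>?x - ?y\<bar>" using L cl by (intro mult_left_mono) auto
      finally have *: "\<bar>G (cl ?x) - G (cl ?y)\<bar> \<le> L * \<bar>?x - ?y\<bar>" .
      have "norm (V t z - V t w) \<le> \<bar>snd z - F ?x - (snd w - F ?y)\<bar> + \<bar>G (cl ?x) - G (cl ?y)\<bar>"
        using norm_le_abs_add_abs[of "V t z - V t w"] by (simp add: V_def)
      also have "\<dots> \<le> \<bar>snd (z - w)\<bar> + M * \<bar>fst (z - w)\<bar> + L * \<bar>fst (z - w)\<bar>"
        using * F_lipschitz[of ?x ?y] by simp
      also have "\<dots> \<le> norm (z - w) + M * norm (z - w) + L * norm (z - w)"
        by (intro add_mono mult_left_mono abs_fst_le_norm abs_snd_le_norm M_nonneg L(1))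
      finally show ?thesis by (simp add: algebra_simps)
    qed
    show "norm (V t 0) \<le> bound_rate * norm (0 :: real \<times> real) + bound_const" for t
      unfolding V_def using norm_growth[of "G (cl 0)" 0 t] cl(2)[of 0] G_growth[of "cl 0"] by simp
  qed blast
  have bound: "norm (u t) \<le> apriori_bound (norm q) N" if "\<bar>t\<bar> \<le> N" for t
  proof (rule apriori_bound[OF _ _ _ that])
    show "(u has_vector_derivative (snd (u s) - F (fst (u s)), G (cl (fst (u s))) + p s)) (at s)" for s
      using u(2) by (simp add: V_def)
    show "\<bar>G (cl (fst (u s)))\<bar> \<le> c + d * \<bar>fst (u s)\<bar>" for s
      using G_growth[of "cl (fst (u s))"] mult_left_mono[OF cl(2) d_nonneg, of "fst (u s)"]
      by linarith
  qed (simp add: u)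
  have "cl (fst (u t)) = fst (u t)" if "\<bar>t\<bar> \<le> N" for t
    using bound[OF that] abs_fst_le_norm[of "u t"] unfolding cl_def R_def by linarith
  then have "V t (u t) = field t (u t)" if "\<bar>t\<bar> \<le> N" for t
    using that by (simp add: V_def field_def)
  then have "sol_on N u"
    using u(2) by (metis sol_on_def)
  then show ?thesis using that u(1) by blast
qed

lemma sol_exists: obtains u where "sol u" "u 0 = q"
proof -
  define \<upsilon> where "\<upsilon> N = (SOME u. sol_on N u \<and> u 0 = q)" for N
  have \<upsilon>: "sol_on N (\<upsilon> N)" "\<upsilon> N 0 = q" for N
    using someI_ex[of "\<lambda>u. sol_on N u \<and> u 0 = q"] sol_on_exists[of N q] unfolding \<upsilon>_def by metis+
  \<comment> \<open>The extra 1 makes u agree with a single local solution on a whole neighbourhood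
    of t, so that the derivative carries over.\<close>
  define u where "u t = \<upsilon> (\<bar>t\<bar> + 1) t" for t
  have u_eq: "u t = \<upsilon> N t" if "\<bar>t\<bar> \<le> N" for t N
    unfolding u_def
  proof (rule sol_on_unique[of "\<bar>t\<bar>" "\<upsilon> (\<bar>t\<bar> + 1)" "\<upsilon> N"])
    show "sol_on \<bar>t\<bar> (\<upsilon> (\<bar>t\<bar> + 1))" using \<upsilon>(1)[of "\<bar>t\<bar> + 1"] by (auto simp: sol_on_def)
    show "sol_on \<bar>t\<bar> (\<upsilon> N)" using \<upsilon>(1)[of N] that by (auto simp: sol_on_def)
  qed (simp_all add: \<upsilon>)
  have "(u has_vector_derivative field t (u t)) (at t)" for t
  proof (rule has_vector_derivative_transform_within_open)
    show "(\<upsilon> (\<bar>t\<bar> + 1) has_vector_derivative field t (u t)) (at t)"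
      using \<upsilon>(1)[of "\<bar>t\<bar> + 1"] by (simp add: sol_on_def u_def)
    show "open {- (\<bar>t\<bar> + 1)<..<\<bar>t\<bar> + 1}" by simp
    show "t \<in> {- (\<bar>t\<bar> + 1)<..<\<bar>t\<bar> + 1}" by auto
    show "\<upsilon> (\<bar>t\<bar> + 1) s = u s" if "s \<in> {- (\<bar>t\<bar> + 1)<..<\<bar>t\<bar> + 1}" for s
      using that by (intro u_eq[symmetric]) auto
  qed
  then show ?thesis using that[of u] by (simp add: sol_def u_def \<upsilon>)
qed

text \<open>The same description as in \<open>lienard_flow\<close>, so that the two coincide once
  the notions of solution are identified.\<close>

definition flow :: "real \<Rightarrow> real \<times> real \<Rightarrow> real \<times> real" where
  "flow t q = (THE u. sol u \<and> u 0 = q) t"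

lemma sol_flow: "sol (\<lambda>t. flow t q)" and flow_0: "flow 0 q = q"
proof -
  have "\<exists>!u. sol u \<and> u 0 = q" using sol_exists[of q] sol_unique by metis
  from theI'[OF this] show "sol (\<lambda>t. flow t q)" "flow 0 q = q"
    by (auto simp: flow_def)
qed

lemma sol_eq_flow: "sol u \<Longrightarrow> u t = flow t (u 0)"
  using sol_unique[of u "\<lambda>t. flow t (u 0)"] sol_flow flow_0 by metis

lemma sol_continuous: "sol u \<Longrightarrow> continuous_on A u"
  unfolding sol_def
  by (meson continuous_at_imp_continuous_on has_vector_derivative_continuous)

lemma flow_lipschitz:
  "\<exists>C\<ge>0. \<forall>q q' t. norm q \<le> r \<longrightarrow> norm q' \<le> r \<longrightarrow> \<bar>t\<bar> \<le> N \<longrightarrow>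
    norm (flow t q - flow t q') \<le> C * norm (q - q')"
proof -
  obtain C where C: "C \<ge> 0" "\<forall>u v t. sol_on N u \<longrightarrow> sol_on N v \<longrightarrow> norm (u 0) \<le> r \<longrightarrow>
      norm (v 0) \<le> r \<longrightarrow> \<bar>t\<bar> \<le> N \<longrightarrow> norm (u t - v t) \<le> C * norm (u 0 - v 0)"
    using sol_on_lipschitz by blast
  have "norm (flow t q - flow t q') \<le> C * norm (q - q')"
    if "norm q \<le> r" "norm q' \<le> r" "\<bar>t\<bar> \<le> N" for q q' t
    using C(2)[rule_format, OF sol_imp_sol_on sol_imp_sol_on, OF sol_flow sol_flow, of q q' t] that
    by (simp add: flow_0)
  then show ?thesis using C(1) by blast
qed

text \<open>Continuity in t for each q, together with a Lipschitz constant in q that is locally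
  uniform in t, gives joint continuity.\<close>

lemma continuous_on_flow: "continuous_on UNIV (\<lambda>(t, q). flow t q)"
proof -
  have "local_lipschitz UNIV UNIV flow"
    unfolding local_lipschitz_def
  proof (intro ballI)
    fix q :: "real \<times> real" and t :: real
    obtain C where C: "C \<ge> 0" "\<And>y y' s. norm y \<le> norm q + 1 \<Longrightarrow> norm y' \<le> norm q + 1 \<Longrightarrow>
        \<bar>s\<bar> \<le> \<bar>t\<bar> + 1 \<Longrightarrow> norm (flow s y - flow s y') \<le> C * norm (y - y')"
      using flow_lipschitz[of "norm q + 1" "\<bar>t\<bar> + 1"] by blast
    have "C-lipschitz_on (cball q 1 \<inter> UNIV) (flow s)" if "s \<in> cball t 1 \<inter> UNIV" for s
    proof (rule lipschitz_onI)
      fix y y' assume "y \<in> cball q 1 \<inter> UNIV" "y' \<in> cball q 1 \<inter> UNIV"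
      then have "norm y \<le> norm q + 1" "norm y' \<le> norm q + 1"
        using norm_triangle_ineq2[of y q] norm_triangle_ineq2[of y' q]
        by (auto simp: dist_norm norm_minus_commute)
      then show "dist (flow s y) (flow s y') \<le> C * dist y y'"
        using C(2) that by (auto simp: dist_norm)
    qed (rule C)
    then show "\<exists>u>0. \<exists>L. \<forall>s\<in>cball t u \<inter> UNIV. L-lipschitz_on (cball q u \<inter> UNIV) (flow s)"
      by (meson zero_less_one)
  qed
  from continuous_on_TimesI[OF this] sol_continuous[OF sol_flow] show ?thesis by simp
qed

lemma continuous_on_flow_compose:
  "continuous_on A a \<Longrightarrow> continuous_on A b \<Longrightarrow> continuous_on A (\<lambda>x. flow (a x) (b x))"
  using continuous_on_compose2[OF continuous_on_flow, of A "\<lambda>x. (a x, b x)"]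
  by (auto intro: continuous_on_Pair)

text \<open>Coefficient of the linear system solved by the difference of the trajectories from q and
  q'. For q = q' it becomes a coefficient of the variational equation along the trajectory.\<close>

definition flow_slope_f :: "real \<times> real \<Rightarrow> real \<times> real \<Rightarrow> real \<Rightarrow> real" where
  "flow_slope_f q q' t = slope f (fst (flow t q)) (fst (flow t q'))"

definition flow_slope_G :: "real \<times> real \<Rightarrow> real \<times> real \<Rightarrow> real \<Rightarrow> real" where
  "flow_slope_G q q' t = slope G' (fst (flow t q)) (fst (flow t q'))"

lemma continuous_on_flow_slopes:
  "continuous_on A (\<lambda>t. flow_slope_f q q' t)" "continuous_on A (\<lambda>t. flow_slope_G q q' t)"
  "continuous_on C (\<lambda>(q', t). flow_slope_f q' q' t)" "continuous_on C (\<lambda>(q', t). flow_slope_G q' q' t)"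
  "continuous_on C (\<lambda>(q', t). flow_slope_f q' q t)" "continuous_on C (\<lambda>(q', t). flow_slope_G q' q t)"
  unfolding flow_slope_f_def flow_slope_G_def case_prod_beta
  by (rule continuous_on_compose2[OF continuous_on_slope[OF f_cont], of _ "\<lambda>x. (a x, b x)" for a b, simplified]
      continuous_on_compose2[OF continuous_on_slope[OF G'_cont], of _ "\<lambda>x. (a x, b x)" for a b, simplified],
      intro continuous_intros continuous_on_flow_compose)+

lemma lin_sol_flow_diff:
  "lin_sol T (flow_slope_f q q') (flow_slope_G q q') (\<lambda>t. flow t q - flow t q')"
proof -
  have "((\<lambda>t. flow t q - flow t q') has_vector_derivative field t (flow t q) - field t (flow t q'))
      (at t)" for t
    using sol_flow[of q] sol_flow[of q'] by (intro has_vector_derivative_diff) (auto simp: sol_def)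
  then show ?thesis
    unfolding lin_sol_def flow_slope_f_def flow_slope_G_def field_diff by blast
qed

definition flow_matrix :: "real \<Rightarrow> real \<times> real \<Rightarrow> real \<times> real \<Rightarrow> (real \<times> real) \<Rightarrow>\<^sub>L (real \<times> real)" where
  "flow_matrix T q q' = Blinfun (propagator T (flow_slope_f q q') (flow_slope_G q q'))"

lemma flow_matrix_apply:
  "T \<ge> 0 \<Longrightarrow> blinfun_apply (flow_matrix T q q') = propagator T (flow_slope_f q q') (flow_slope_G q q')"
  unfolding flow_matrix_def
  by (intro bounded_linear_Blinfun_apply bounded_linear_propagator continuous_on_flow_slopes)

lemma flow_diff_eq_matrix:
  assumes "T \<ge> 0"
  shows "flow T q - flow T q' = flow_matrix T q q' (q - q')"
  using propagator_eq[OF lin_sol_flow_diff assms continuous_on_flow_slopes(1,2), of q q']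
  by (simp add: flow_matrix_apply assms flow_0)

text \<open>The increment of the flow is exactly \<open>flow_matrix T y q\<close> applied to y - q.
  Differentiability at q therefore reduces to continuity of this matrix in y at y = q, and
  continuity of the derivative to continuity along the diagonal.\<close>

lemma C1_map_flow:
  assumes "T \<ge> 0"
  shows "(flow T has_derivative blinfun_apply (flow_matrix T q q)) (at q)"
    and "continuous_on UNIV (\<lambda>q. flow_matrix T q q)"
proof -
  have *: "isCont (\<lambda>q'. flow_matrix T q' q) q"
    unfolding flow_matrix_def
    by (rule isCont_propagator[OF assms continuous_on_flow_slopes(5,6)])
  show "(flow T has_derivative blinfun_apply (flow_matrix T q q)) (at q)"
    unfolding has_derivative_at2
  proof (intro conjI)
    show "bounded_linear (blinfun_apply (flow_matrix T q q))" by (rule blinfun.bounded_linear_right)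
    show "((\<lambda>y. (1 / norm (y - q)) *\<^sub>R (flow T y - (flow T q + flow_matrix T q q (y - q))))
        \<longlongrightarrow> 0) (at q)"
    proof (rule Lim_null_comparison)
      show "\<forall>\<^sub>F y in at q. norm ((1 / norm (y - q)) *\<^sub>R (flow T y - (flow T q + flow_matrix T q q (y - q))))
          \<le> norm (flow_matrix T y q - flow_matrix T q q)"
      proof (rule always_eventually, rule allI)
        fix y
        have "flow T y - (flow T q + flow_matrix T q q (y - q))
            = (flow_matrix T y q - flow_matrix T q q) (y - q)"
          using flow_diff_eq_matrix[OF assms, of y q] by (simp add: blinfun.diff_left algebra_simps)
        then show "norm ((1 / norm (y - q)) *\<^sub>R (flow T y - (flow T q + flow_matrix T q q (y - q))))
            \<le> norm (flow_matrix T y q - flow_matrix T q q)"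
          using norm_blinfun[of "flow_matrix T y q - flow_matrix T q q" "y - q"]
          by (cases "y = q") (simp_all add: field_simps)
      qed
      show "((\<lambda>y. norm (flow_matrix T y q - flow_matrix T q q)) \<longlongrightarrow> 0) (at q)"
        using * by (intro tendsto_norm_zero LIM_zero) (simp add: isCont_def)
    qed
  qed
  show "continuous_on UNIV (\<lambda>q. flow_matrix T q q)"
    unfolding flow_matrix_def
    by (intro continuous_at_imp_continuous_on ballI
        isCont_propagator[OF assms continuous_on_flow_slopes(3,4)])
qed

end

section \<open>Differences of solutions\<close>

lemma has_vector_derivative_shift_arg:
  fixes t a :: real
  assumes "(f has_vector_derivative f') (at (t + a))"
  shows "((\<lambda>t. f (t + a)) has_vector_derivative f') (at t)"
proof -
  have "((\<lambda>t. t + a) has_vector_derivative 1) (at t)"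
    by (auto intro!: derivative_eq_intros)
  from vector_diff_chain_at[OF this, of f f'] assms show ?thesis by (simp add: o_def)
qed

lemma linear_lower_bound:
  fixes Y Y' :: "real \<Rightarrow> real"
  assumes "\<And>s. a \<le> s \<Longrightarrow> s \<le> t \<Longrightarrow> (Y has_real_derivative Y' s) (at s)"
    and "\<And>s. a \<le> s \<Longrightarrow> s \<le> t \<Longrightarrow> c \<le> Y' s" and "a \<le> t"
  shows "Y a + c * (t - a) \<le> Y t"
proof -
  have "Y a - c * a \<le> Y t - c * t"
  proof (rule DERIV_nonneg_imp_nondecreasing[OF \<open>a \<le> t\<close>])
    fix s assume s: "a \<le> s" "s \<le> t"
    have "((\<lambda>s. Y s - c * s) has_real_derivative Y' s - c) (at s)"
      using assms(1)[OF s] by (auto intro!: derivative_eq_intros)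
    then show "\<exists>y. ((\<lambda>s. Y s - c * s) has_real_derivative y) (at s) \<and> 0 \<le> y"
      using assms(2)[OF s] by fastforce
  qed
  then show ?thesis by (simp add: algebra_simps)
qed

text \<open>The integrating factor for comparing X with the equilibrium k of a linear equation of
  rate m; k = 0 gives a plain exponential weight.\<close>

lemma exp_shift_mult_has_real_derivative:
  assumes "(X has_real_derivative D) (at s)"
  shows "((\<lambda>t. exp (m * (t - t0)) * (X t - k)) has_real_derivative
    exp (m * (s - t0)) * (m * (X s - k) + D)) (at s)"
  using assms by (auto intro!: derivative_eq_intros simp: algebra_simps)

context lienard_system
begin

lemma sol_fst: "sol u \<Longrightarrow> ((\<lambda>t. fst (u t)) has_real_derivative snd (u t) - F (fst (u t))) (at t)"
  using bounded_linear.has_vector_derivative[OF bounded_linear_fst, of u "field t (u t)" "at t"]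
  by (simp add: sol_def has_real_derivative_iff_has_vector_derivative field_def)

lemma sol_snd: "sol u \<Longrightarrow> ((\<lambda>t. snd (u t)) has_real_derivative G (fst (u t)) + p t) (at t)"
  using bounded_linear.has_vector_derivative[OF bounded_linear_snd, of u "field t (u t)" "at t"]
  by (simp add: sol_def has_real_derivative_iff_has_vector_derivative field_def)

lemma sol_diff_fst:
  "sol u \<Longrightarrow> sol v \<Longrightarrow> ((\<lambda>t. fst (u t) - fst (v t)) has_real_derivative
     snd (u t) - snd (v t) - slope f (fst (u t)) (fst (v t)) * (fst (u t) - fst (v t))) (at t)"
  unfolding slope_mult_diff[OF F_deriv]
  using DERIV_diff[OF sol_fst sol_fst, of u v t] by (simp add: algebra_simps)

lemma sol_diff_snd:
  "sol u \<Longrightarrow> sol v \<Longrightarrow> ((\<lambda>t. snd (u t) - snd (v t)) has_real_derivative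
     G (fst (u t)) - G (fst (v t))) (at t)"
  using DERIV_diff[OF sol_snd sol_snd, of u v t] by simp

lemma sol_slopes_bounded:
  assumes "sol u" "sol v"
  shows "\<exists>L\<ge>0. \<forall>t. \<bar>t\<bar> \<le> N \<longrightarrow> \<bar>slope f (fst (u t)) (fst (v t))\<bar> \<le> L \<and>
    \<bar>slope G' (fst (u t)) (fst (v t))\<bar> \<le> L"
proof -
  define r where "r = max (norm (u 0)) (norm (v 0))"
  have "\<bar>fst (u t)\<bar> \<le> apriori_bound r N" "\<bar>fst (v t)\<bar> \<le> apriori_bound r N" if "\<bar>t\<bar> \<le> N" for t
    using sol_on_apriori_bound[OF sol_imp_sol_on[OF assms(1)] _ that, of r]
      sol_on_apriori_bound[OF sol_imp_sol_on[OF assms(2)] _ that, of r]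
      abs_fst_le_norm[of "u t"] abs_fst_le_norm[of "v t"] by (auto simp: r_def)
  then show ?thesis using slope_bound_exists[of "apriori_bound r N"] by metis
qed

text \<open>Gronwall's inequality is started at time a. The equation depends on time, so a cannot be
  moved to 0 by shifting a solution.\<close>

lemma sol_unique_at:
  assumes "sol u" "sol v" "u a = v a"
  shows "u = v"
proof
  fix t
  define N where "N = \<bar>a\<bar> + \<bar>t - a\<bar>"
  obtain L where L: "L \<ge> 0" "\<And>t. \<bar>t\<bar> \<le> N \<Longrightarrow> \<bar>slope f (fst (u t)) (fst (v t))\<bar> \<le> L \<and>
      \<bar>slope G' (fst (u t)) (fst (v t))\<bar> \<le> L"
    using sol_slopes_bounded[OF assms(1,2)] by metis
  let ?E = "\<lambda>s. u (s + a) - v (s + a)"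
  have "(norm (?E (t - a)))\<^sup>2
      \<le> ((norm (?E 0))\<^sup>2 + 0\<^sup>2 * \<bar>t - a\<bar>) * exp ((2 * (2 * L + 1) + 1) * \<bar>t - a\<bar>)"
  proof (rule gronwall_norm_two_sided[where N = "\<bar>t - a\<bar>"])
    fix s assume s: "\<bar>s\<bar> \<le> \<bar>t - a\<bar>"
    show "(?E has_vector_derivative field (s + a) (u (s + a)) - field (s + a) (v (s + a))) (at s)"
      using assms(1,2)
      by (intro has_vector_derivative_diff has_vector_derivative_shift_arg) (auto simp: sol_def)
    show "norm (field (s + a) (u (s + a)) - field (s + a) (v (s + a))) \<le> (2 * L + 1) * norm (?E s) + 0"
      unfolding field_diff using L(2)[of "s + a"] s by (simp add: norm_lin_field N_def)
  qed (use L in auto)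
  then show "u t = v t" using assms(3) by simp
qed

text \<open>The order on pairs is the componentwise one; the system is cooperative because \<open>G\<close> is
  increasing.\<close>
lemma sol_order_preserving:
  assumes "sol u" "sol v" "v a \<le> u a" "a \<le> b"
  shows "v b \<le> u b"
proof -
  define N where "N = max \<bar>a\<bar> \<bar>b\<bar>"
  obtain L where L: "L \<ge> 0" "\<And>t. \<bar>t\<bar> \<le> N \<Longrightarrow> \<bar>slope f (fst (u t)) (fst (v t))\<bar> \<le> L \<and>
      \<bar>slope G' (fst (u t)) (fst (v t))\<bar> \<le> L"
    using sol_slopes_bounded[OF assms(1,2)] by metis
  let ?X = "\<lambda>t. fst (u t) - fst (v t)" and ?Y = "\<lambda>t. snd (u t) - snd (v t)"
  have "?X b \<ge> 0 \<and> ?Y b \<ge> 0"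
  proof (rule cooperative_quadrant_invariant[where X = ?X and Y = ?Y and L = L,
        OF sol_diff_fst[OF assms(1,2)] sol_diff_snd[OF assms(1,2)]])
    fix s assume s: "a \<le> s" "s \<le> b"
    then have "\<bar>s\<bar> \<le> N" by (auto simp: N_def)
    note L_s = L(2)[OF this]
    then show "\<bar>slope f (fst (u s)) (fst (v s))\<bar> \<le> L" by blast
    show "L * ?X s \<le> G (fst (u s)) - G (fst (v s))" if "?X s < 0"
      unfolding slope_mult_diff[OF G_deriv, symmetric]
      using L_s that by (intro mult_right_mono_neg) auto
    show "0 \<le> G (fst (u s)) - G (fst (v s))" if "0 \<le> ?X s"
      using that G_mono by (simp add: strict_mono_less_eq)
  qed (use assms in \<open>auto simp: less_eq_prod_def\<close>)
  then show ?thesis by (simp add: less_eq_prod_def)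
qed

text \<open>The increment of G over a step of length \<delta> is continuous and positive, hence has
  a positive minimum on a compact interval; larger gaps only increase it by monotonicity. One
  bounded endpoint suffices: the step is taken upwards from y or downwards from x.\<close>

lemma G_gap:
  assumes "\<delta> > 0"
  shows "\<exists>\<gamma>>0. \<forall>x y. x \<ge> y + \<delta> \<longrightarrow> \<bar>x\<bar> \<le> R \<or> \<bar>y\<bar> \<le> R \<longrightarrow> G x - G y \<ge> \<gamma>"
proof -
  define S where "S = {- \<bar>R\<bar> - \<delta>..\<bar>R\<bar> + \<delta>}"
  have "continuous_on S (\<lambda>x. G (x + \<delta>) - G x)"
    by (intro continuous_intros continuous_on_compose2[OF G_cont[of UNIV]] G_cont) auto
  moreover have "S \<noteq> {}" using assms by (auto simp: S_def)
  ultimately obtain x0 where x0: "\<And>x. x \<in> S \<Longrightarrow> G (x0 + \<delta>) - G x0 \<le> G (x + \<delta>) - G x"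
    using continuous_attains_inf[of S "\<lambda>x. G (x + \<delta>) - G x"] compact_Icc unfolding S_def by metis
  have "G (x0 + \<delta>) - G x0 \<le> G x - G y" if "x \<ge> y + \<delta>" "\<bar>x\<bar> \<le> R \<or> \<bar>y\<bar> \<le> R" for x y
  proof (cases "\<bar>y\<bar> \<le> R")
    case True
    have "G (y + \<delta>) \<le> G x" using that G_mono by (simp add: strict_mono_less_eq)
    moreover have "y \<in> S" unfolding S_def atLeastAtMost_iff using True assms by linarith
    ultimately show ?thesis using x0[of y] by linarith
  next
    case False
    have "G y \<le> G (x - \<delta>)" using that G_mono by (simp add: strict_mono_less_eq)
    moreover have "x - \<delta> \<in> S"
      unfolding S_def atLeastAtMost_iff using False that assms by linarith
    ultimately show ?thesis using x0[of "x - \<delta>"] by simp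
  qed
  moreover have "G (x0 + \<delta>) - G x0 > 0" using assms G_mono by (simp add: strict_mono_less)
  ultimately show ?thesis by blast
qed

text \<open>The difference Y never decreases and becomes positive. A positive Y pushes X above some
  \<delta> within one unit of time, against a damping of rate at most M; from then on
  \<open>G_gap\<close> makes Y grow at least linearly.\<close>

lemma sol_ordered_escape:
  assumes "sol u" "sol v" "v a \<le> u a" "v a \<noteq> u a"
    and R: "(\<forall>t\<ge>a. \<bar>fst (u t)\<bar> \<le> R) \<or> (\<forall>t\<ge>a. \<bar>fst (v t)\<bar> \<le> R)"
  shows "filterlim (\<lambda>t. snd (u t) - snd (v t)) at_top at_top"
proof -
  let ?X = "\<lambda>t. fst (u t) - fst (v t)" and ?Y = "\<lambda>t. snd (u t) - snd (v t)"
  note X' = sol_diff_fst[OF assms(1,2)] and Y' = sol_diff_snd[OF assms(1,2)]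
  have nonneg: "?X t \<ge> 0" "?Y t \<ge> 0" if "t \<ge> a" for t
    using sol_order_preserving[OF assms(1-3) that] by (auto simp: less_eq_prod_def)
  have "G (fst (u t)) - G (fst (v t)) \<ge> 0" if "t \<ge> a" for t
    using nonneg(1)[OF that] G_mono by (simp add: strict_mono_less_eq)
  then have Y_mono: "?Y s \<le> ?Y t" if "a \<le> s" "s \<le> t" for s t
    using linear_lower_bound[of s t ?Y "\<lambda>t. G (fst (u t)) - G (fst (v t))" 0] Y' that by auto
  \<comment> \<open>If Y vanishes at a, then X is positive there, so the derivative of Y is positive
    and Y is positive immediately afterwards.\<close>
  obtain t0 where t0: "t0 \<ge> a" "?Y t0 > 0"
  proof (cases "?Y a > 0")
    case True
    then show ?thesis using that by blast
  next
    case False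
    then have "?Y a = 0" "?X a > 0"
      using nonneg[of a] assms(4) by (auto simp: prod_eq_iff)
    then have "G (fst (u a)) - G (fst (v a)) > 0" using G_mono by (simp add: strict_mono_less)
    from DERIV_pos_inc_right[OF Y' this] obtain \<epsilon> where "\<epsilon> > 0" "\<And>h. 0 < h \<Longrightarrow> h < \<epsilon> \<Longrightarrow> ?Y a < ?Y (a + h)"
      by blast
    from this(2)[of "\<epsilon> / 2"] \<open>\<epsilon> > 0\<close> \<open>?Y a = 0\<close> show ?thesis using that[of "a + \<epsilon> / 2"] by auto
  qed
  \<comment> \<open>The comparison equation is X' = Y(t0) - m X, with equilibrium k; its solution
    starting from 0 reaches \<delta> after one unit of time. Taking M + 1 in place of M allows the
    division by m when M = 0.\<close>
  define m where "m = M + 1"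
  have "m > 0" using M_nonneg by (simp add: m_def)
  define k where "k = ?Y t0 / m"
  have "k > 0" using t0 \<open>m > 0\<close> by (simp add: k_def)
  define \<delta> where "\<delta> = k * (1 - exp (- m))"
  have "\<delta> > 0" using \<open>k > 0\<close> \<open>m > 0\<close> by (simp add: \<delta>_def)
  have X_ge: "?X t \<ge> \<delta>" if t: "t \<ge> t0 + 1" for t
  proof -
    let ?\<xi> = "\<lambda>t. exp (m * (t - t0)) * (?X t - k)"
    have "?\<xi> t0 \<le> ?\<xi> t"
    proof (rule DERIV_nonneg_imp_nondecreasing[where f = ?\<xi>])
      fix s assume s: "t0 \<le> s" "s \<le> t"
      let ?\<sigma> = "slope f (fst (u s)) (fst (v s))"
      have "(?\<xi> has_real_derivative exp (m * (s - t0)) * (m * (?X s - k) + (?Y s - ?\<sigma> * ?X s))) (at s)"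
        by (rule exp_shift_mult_has_real_derivative[OF X'])
      moreover have "?\<sigma> * ?X s \<le> m * ?X s"
        using slope_f_bound[of "fst (u s)" "fst (v s)"] nonneg(1)[of s] s t0
        by (intro mult_right_mono) (auto simp: m_def)
      moreover have "m * k \<le> ?Y s"
        using Y_mono[OF t0(1) s(1)] \<open>m > 0\<close> by (simp add: k_def)
      then have "0 \<le> m * (?X s - k) + (?Y s - ?\<sigma> * ?X s)"
        using calculation(2) by (simp add: right_diff_distrib)
      ultimately show "\<exists>y. (?\<xi> has_real_derivative y) (at s) \<and> 0 \<le> y"
        by (meson exp_ge_zero mult_nonneg_nonneg)
    qed (use t in simp)
    moreover have "- k \<le> ?\<xi> t0" using nonneg(1)[OF t0(1)] by simp
    ultimately have "exp (- (m * (t - t0))) * (- k) \<le> exp (- (m * (t - t0))) * ?\<xi> t"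
      by (intro mult_left_mono) auto
    also have "\<dots> = ?X t - k"
      by (simp add: mult.assoc[symmetric] exp_add[symmetric])
    finally have "k - k * exp (- (m * (t - t0))) \<le> ?X t" by (simp add: mult.commute)
    moreover have "k * exp (- (m * (t - t0))) \<le> k * exp (- m)"
      using t \<open>k > 0\<close> \<open>m > 0\<close> by (intro mult_left_mono) auto
    ultimately show ?thesis by (simp add: \<delta>_def algebra_simps)
  qed
  obtain \<gamma> where \<gamma>: "\<gamma> > 0" "\<And>x y. x \<ge> y + \<delta> \<Longrightarrow> \<bar>x\<bar> \<le> R \<or> \<bar>y\<bar> \<le> R \<Longrightarrow> G x - G y \<ge> \<gamma>"
    using G_gap[OF \<open>\<delta> > 0\<close>] by metis
  have "G (fst (u t)) - G (fst (v t)) \<ge> \<gamma>" if "t \<ge> t0 + 1" for t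
    using X_ge[OF that] R that t0(1) by (intro \<gamma>(2)) auto
  then have "?Y (t0 + 1) + \<gamma> * (t - (t0 + 1)) \<le> ?Y t" if "t \<ge> t0 + 1" for t
    using linear_lower_bound[of "t0 + 1" t ?Y "\<lambda>t. G (fst (u t)) - G (fst (v t))" \<gamma>] Y' that by auto
  then have "\<forall>\<^sub>F t in at_top. ?Y (t0 + 1) - \<gamma> * (t0 + 1) + \<gamma> * t \<le> ?Y t"
    by (intro eventually_at_top_linorderI[of "t0 + 1"]) (simp add: algebra_simps)
  moreover have "filterlim (\<lambda>t. ?Y (t0 + 1) - \<gamma> * (t0 + 1) + \<gamma> * t) at_top at_top"
    by (intro filterlim_tendsto_add_at_top[OF tendsto_const] filterlim_ident
        filterlim_tendsto_pos_mult_at_top[OF tendsto_const \<gamma>(1)])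
  ultimately show ?thesis by (rule filterlim_at_top_mono[rotated])
qed

text \<open>Y is negative and nondecreasing, so what it can still gain tends to 0. An X that is not
  small would make Y gain a fixed amount, so X tends to 0. If Y stayed below some - \<epsilon>, it
  would drive the small X below 0 in finite time.\<close>

lemma sol_incomparable_decay:
  assumes "sol u" "sol v"
    and sgn: "\<And>t. t \<ge> 0 \<Longrightarrow> fst (v t) < fst (u t) \<and> snd (u t) < snd (v t)"
    and R: "(\<forall>t\<ge>0. \<bar>fst (u t)\<bar> \<le> R) \<or> (\<forall>t\<ge>0. \<bar>fst (v t)\<bar> \<le> R)"
  shows "((\<lambda>t. u t - v t) \<longlongrightarrow> 0) at_top"
proof -
  let ?X = "\<lambda>t. fst (u t) - fst (v t)" and ?Y = "\<lambda>t. snd (u t) - snd (v t)"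
  note X' = sol_diff_fst[OF assms(1,2)] and Y' = sol_diff_snd[OF assms(1,2)]
  have pos: "?X t > 0" "?Y t < 0" if "t \<ge> 0" for t using sgn[OF that] by auto
  have G_pos: "G (fst (u t)) - G (fst (v t)) \<ge> 0" if "t \<ge> 0" for t
    using sgn[OF that] G_mono by (simp add: strict_mono_less_eq)
  then have Y_mono: "?Y s \<le> ?Y t" if "0 \<le> s" "s \<le> t" for s t
    using linear_lower_bound[of s t ?Y "\<lambda>t. G (fst (u t)) - G (fst (v t))" 0] Y' that by auto
  \<comment> \<open>Because Y < 0, X grows at most at rate M: a large value at t forces a comparable
    value throughout the preceding unit interval.\<close>
  have X_back: "?X t * exp (- M) \<le> ?X s" if s: "0 \<le> s" "s \<le> t" "t \<le> s + 1" for s t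
  proof -
    let ?\<xi> = "\<lambda>t. exp (- M * (t - 0)) * (?X t - 0)"
    have "?\<xi> t \<le> ?\<xi> s"
    proof (rule DERIV_nonpos_imp_nonincreasing[where f = ?\<xi>])
      fix r assume r: "s \<le> r" "r \<le> t"
      let ?\<sigma> = "slope f (fst (u r)) (fst (v r))"
      have "(?\<xi> has_real_derivative exp (- M * (r - 0)) * (- M * (?X r - 0) + (?Y r - ?\<sigma> * ?X r))) (at r)"
        by (rule exp_shift_mult_has_real_derivative[OF X'])
      moreover have "(- ?\<sigma>) * ?X r \<le> M * ?X r"
        using slope_f_bound[of "fst (u r)" "fst (v r)"] pos(1)[of r] r s
        by (intro mult_right_mono) auto
      then have "- M * (?X r - 0) + (?Y r - ?\<sigma> * ?X r) \<le> 0" using pos(2)[of r] r s by simp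
      ultimately show "\<exists>y. (?\<xi> has_real_derivative y) (at r) \<and> y \<le> 0"
        by (meson exp_ge_zero mult_nonneg_nonpos)
    qed (use s in simp)
    then have ineq: "exp (M * s) * ?\<xi> t \<le> exp (M * s) * ?\<xi> s" by (intro mult_left_mono) auto
    have eq: "exp (M * s) * (exp (- M * (r - 0)) * x) = exp (- (M * (r - s))) * x" for r x
      unfolding mult.assoc[symmetric] exp_add[symmetric] by (simp add: algebra_simps)
    from ineq have "exp (- (M * (t - s))) * ?X t \<le> ?X s" unfolding eq by simp
    moreover have "M * (t - s) \<le> M * 1" using M_nonneg s by (intro mult_left_mono) auto
    then have "exp (- M) * ?X t \<le> exp (- (M * (t - s))) * ?X t"
      using pos(1)[of t] s by (intro mult_right_mono) auto
    ultimately show ?thesis by (simp add: mult.commute)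
  qed
  have X_small: "\<exists>t1\<ge>0. \<forall>t\<ge>t1. ?X t < \<epsilon>" if "\<epsilon> > 0" for \<epsilon>
  proof -
    obtain \<gamma> where \<gamma>: "\<gamma> > 0"
      "\<And>x y. x \<ge> y + \<epsilon> * exp (- M) \<Longrightarrow> \<bar>x\<bar> \<le> R \<or> \<bar>y\<bar> \<le> R \<Longrightarrow> G x - G y \<ge> \<gamma>"
      using G_gap[of "\<epsilon> * exp (- M)"] \<open>\<epsilon> > 0\<close> by (metis exp_gt_zero mult_pos_pos)
    have bdd: "bdd_above (?Y ` {0..})" using pos(2) by (auto intro!: bdd_aboveI2[of _ _ 0] less_imp_le)
    \<comment> \<open>After t2 less than \<gamma> is left for Y to gain, whereas X(t) \<ge>
      \<epsilon> would make it gain \<gamma> on [t - 1, t].\<close>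
    obtain t2 where t2: "t2 \<ge> 0" "(SUP t\<in>{0..}. ?Y t) - \<gamma> < ?Y t2"
      using less_cSUP_iff[OF _ bdd, of "(SUP t\<in>{0..}. ?Y t) - \<gamma>"] \<gamma>(1) by auto
    have "?X t < \<epsilon>" if t: "t \<ge> t2 + 1" for t
    proof (rule ccontr)
      assume "\<not> ?X t < \<epsilon>"
      then have "\<epsilon> * exp (- M) \<le> ?X t * exp (- M)" by (intro mult_right_mono) auto
      from order_trans[OF this X_back] have X_ge: "\<epsilon> * exp (- M) \<le> ?X s"
        if "t - 1 \<le> s" "s \<le> t" for s
        using that t t2(1) by simp
      have "\<gamma> \<le> ?Y t - ?Y (t - 1)"
      proof -
        have "?Y (t - 1) + \<gamma> * (t - (t - 1)) \<le> ?Y t"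
        proof (rule linear_lower_bound)
          fix s assume s: "t - 1 \<le> s" "s \<le> t"
          show "(?Y has_real_derivative G (fst (u s)) - G (fst (v s))) (at s)" by (rule Y')
          show "\<gamma> \<le> G (fst (u s)) - G (fst (v s))"
            using X_ge[OF s] R s t t2(1) by (intro \<gamma>(2)) auto
        qed simp
        then show ?thesis by simp
      qed
      moreover have "?Y t \<le> (SUP t\<in>{0..}. ?Y t)" using t t2(1) by (intro cSUP_upper bdd) auto
      moreover have "?Y t2 \<le> ?Y (t - 1)" using t t2(1) by (intro Y_mono) auto
      ultimately show False using t2(2) by linarith
    qed
    then show ?thesis using t2(1) by (intro exI[of _ "t2 + 1"]) auto
  qed
  have Y_small: "\<exists>t1\<ge>0. \<forall>t\<ge>t1. - \<epsilon> < ?Y t" if "\<epsilon> > 0" for \<epsilon>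
  proof -
    have "\<exists>t1\<ge>0. - \<epsilon> < ?Y t1"
    proof (rule ccontr)
      assume "\<not> ?thesis"
      then have Y_le: "?Y t \<le> - \<epsilon>" if "t \<ge> 0" for t using that by force
      define m where "m = M + 1"
      have "m > 0" using M_nonneg by (simp add: m_def)
      obtain t1 where t1: "t1 \<ge> 0" "\<And>t. t \<ge> t1 \<Longrightarrow> ?X t < \<epsilon> / (2 * m)"
        using X_small[of "\<epsilon> / (2 * m)"] \<open>\<epsilon> > 0\<close> \<open>m > 0\<close> by auto
      \<comment> \<open>From t1 on, X falls at rate at least \<epsilon> / 2; this is the time by
        which it would have reached 0.\<close>
      define t where "t = t1 + 2 * ?X t1 / \<epsilon>"
      have "t \<ge> t1" using pos(1)[OF t1(1)] \<open>\<epsilon> > 0\<close> by (simp add: t_def)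
      have "- ?X t1 + \<epsilon> / 2 * (t - t1) \<le> - ?X t"
      proof (rule linear_lower_bound[OF _ _ \<open>t \<ge> t1\<close>])
        fix s assume s: "t1 \<le> s"
        let ?\<sigma> = "slope f (fst (u s)) (fst (v s))"
        show "((\<lambda>t. - ?X t) has_real_derivative - (?Y s - ?\<sigma> * ?X s)) (at s)"
          by (rule DERIV_minus[OF X'])
        have "- ?\<sigma> * ?X s \<le> m * ?X s"
          using slope_f_bound[of "fst (u s)" "fst (v s)"] pos(1)[of s] s t1(1)
          by (intro mult_right_mono) (auto simp: m_def)
        also have "\<dots> \<le> m * (\<epsilon> / (2 * m))"
          using t1(2)[OF s] \<open>m > 0\<close> by (intro mult_left_mono) auto
        also have "\<dots> = \<epsilon> / 2" using \<open>m > 0\<close> by simp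
        finally show "\<epsilon> / 2 \<le> - (?Y s - ?\<sigma> * ?X s)" using Y_le[of s] s t1(1) by simp
      qed
      also have "- ?X t1 + \<epsilon> / 2 * (t - t1) = 0" using \<open>\<epsilon> > 0\<close> by (simp add: t_def field_simps)
      finally show False using pos(1)[of t] \<open>t \<ge> t1\<close> t1(1) by simp
    qed
    then show ?thesis using Y_mono by (meson less_le_trans)
  qed
  have "(?X \<longlongrightarrow> 0) at_top"
  proof (rule tendstoI)
    fix \<epsilon> :: real assume "\<epsilon> > 0"
    from X_small[OF this] obtain t1 where "t1 \<ge> 0" "\<forall>t\<ge>t1. ?X t < \<epsilon>" by blast
    moreover have "\<bar>?X t\<bar> < \<epsilon>" if "t \<ge> t1" for t
      using calculation pos(1)[of t] that by (auto simp: abs_if)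
    ultimately show "\<forall>\<^sub>F t in at_top. dist (?X t) 0 < \<epsilon>"
      by (intro eventually_at_top_linorderI[of t1]) (simp add: dist_real_def)
  qed
  moreover have "(?Y \<longlongrightarrow> 0) at_top"
  proof (rule tendstoI)
    fix \<epsilon> :: real assume "\<epsilon> > 0"
    from Y_small[OF this] obtain t1 where "t1 \<ge> 0" "\<forall>t\<ge>t1. - \<epsilon> < ?Y t" by blast
    moreover have "\<bar>?Y t\<bar> < \<epsilon>" if "t \<ge> t1" for t
      using calculation pos(2)[of t] that by (auto simp: abs_if)
    ultimately show "\<forall>\<^sub>F t in at_top. dist (?Y t) 0 < \<epsilon>"
      by (intro eventually_at_top_linorderI[of t1]) (simp add: dist_real_def)
  qed
  ultimately have "((\<lambda>t. (?X t, ?Y t)) \<longlongrightarrow> (0, 0)) at_top" by (rule tendsto_Pair)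
  then show ?thesis by (simp add: minus_prod_def zero_prod_def)
qed

end

section \<open>Points with bounded forward orbit\<close>

text \<open>Without a fixed point \<psi> - id has constant sign, so every orbit is monotone. A
  bounded orbit then converges, and its limit is a fixed point after all.\<close>

lemma continuous_real_map_fixed_point:
  fixes \<psi> :: "real \<Rightarrow> real"
  assumes cont: "continuous_on UNIV \<psi>" and orbit: "bounded (range (\<lambda>n. (\<psi> ^^ n) a))"
  shows "\<exists>x. \<psi> x = x"
proof (rule ccontr)
  assume no_fix: "\<not> ?thesis"
  define s where "s n = (\<psi> ^^ n) a" for n
  have s_Suc: "s (Suc n) = \<psi> (s n)" for n by (simp add: s_def)
  have "monoseq s"
  proof (cases "\<exists>x. \<psi> x > x")
    case True
    then obtain x where x: "\<psi> x > x" by blast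
    have "\<psi> y > y" for y
    proof (rule ccontr)
      assume "\<not> \<psi> y > y"
      then have y: "\<psi> y \<le> y" by simp
      have "connected ((\<lambda>x. \<psi> x - x) ` UNIV)"
        by (intro connected_continuous_image continuous_intros cont connected_UNIV)
      then have "0 \<in> range (\<lambda>x. \<psi> x - x)"
        using x y connectedD_interval[of "range (\<lambda>x. \<psi> x - x)" "\<psi> y - y" "\<psi> x - x" 0] by auto
      then show False using no_fix by auto
    qed
    then show ?thesis by (intro monoI1) (auto simp: s_Suc incseq_SucI less_imp_le intro: incseqD)
  next
    case False
    then have "\<psi> y \<le> y" for y by (meson not_le)
    then show ?thesis by (intro monoI2) (auto simp: s_Suc decseq_SucI intro: decseqD)
  qed
  moreover have "Bseq s" using orbit by (simp add: s_def[abs_def] Bseq_eq_bounded)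
  ultimately obtain l where l: "s \<longlonglongrightarrow> l"
    using Bseq_monoseq_convergent by (auto simp: convergent_def)
  then have "(\<lambda>n. s (Suc n)) \<longlonglongrightarrow> l" by (rule LIMSEQ_Suc)
  moreover have "(\<lambda>n. s (Suc n)) \<longlonglongrightarrow> \<psi> l"
    unfolding s_Suc using cont l by (intro continuous_on_tendsto_compose[OF cont]) auto
  ultimately show False using no_fix LIMSEQ_unique by metis
qed

lemma norm_at_top_not_bounded:
  fixes u :: "real \<Rightarrow> 'a::real_normed_vector"
  assumes "filterlim (\<lambda>t. norm (u t)) at_top at_top"
  shows "\<not> bounded (u ` {0..})"
proof
  assume "bounded (u ` {0..})"
  then obtain R where R: "\<And>t. t \<ge> 0 \<Longrightarrow> norm (u t) \<le> R" by (auto simp: bounded_iff)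
  have "\<forall>\<^sub>F t in at_top. norm (u t) > R" using assms by (simp add: filterlim_at_top_dense)
  then obtain t where "t \<ge> 0" "norm (u t) > R"
    by (metis eventually_at_top_linorder max.cobounded1 max.cobounded2)
  then show False using R[of t] by simp
qed

context lienard_system
begin

definition fwd_bounded :: "(real \<times> real) set" where
  "fwd_bounded = {q. bounded ((\<lambda>t. flow t q) ` {0..})}"

text \<open>The y-difference escapes, in one direction or the other; as v is bounded, the
  y-component of u must carry this escape.\<close>

lemma sol_comparable_escape:
  assumes "sol u" "sol v" "bounded (v ` {0..})" "a \<ge> 0"
    and "u a \<le> v a \<or> v a \<le> u a" "u a \<noteq> v a"
  shows "filterlim (\<lambda>t. norm (u t)) at_top at_top"
proof -
  obtain R where R: "\<And>t. t \<ge> 0 \<Longrightarrow> norm (v t) \<le> R"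
    using assms(3) by (auto simp: bounded_iff)
  have vR: "\<bar>fst (v t)\<bar> \<le> R" "\<bar>snd (v t)\<bar> \<le> R" if "t \<ge> 0" for t
    using R[OF that] abs_fst_le_norm[of "v t"] abs_snd_le_norm[of "v t"] by auto
  have vRa: "\<forall>t\<ge>a. \<bar>fst (v t)\<bar> \<le> R" using vR(1) assms(4) by auto
  obtain h where h: "filterlim h at_top at_top" "\<And>t. t \<ge> 0 \<Longrightarrow> - R + h t \<le> \<bar>snd (u t)\<bar>"
  proof (cases "v a \<le> u a")
    case True
    have "filterlim (\<lambda>t. snd (u t) - snd (v t)) at_top at_top"
      by (rule sol_ordered_escape[OF assms(1,2) True assms(6)[symmetric] disjI2[OF vRa]])
    moreover have "- R + (snd (u t) - snd (v t)) \<le> \<bar>snd (u t)\<bar>" if "t \<ge> 0" for t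
      using vR(2)[OF that] by linarith
    ultimately show ?thesis using that by blast
  next
    case False
    then have "u a \<le> v a" using assms(5) by blast
    then have "filterlim (\<lambda>t. snd (v t) - snd (u t)) at_top at_top"
      by (rule sol_ordered_escape[OF assms(2,1) _ assms(6) disjI1[OF vRa]])
    moreover have "- R + (snd (v t) - snd (u t)) \<le> \<bar>snd (u t)\<bar>" if "t \<ge> 0" for t
      using vR(2)[OF that] by linarith
    ultimately show ?thesis using that by blast
  qed
  have "filterlim (\<lambda>t. - R + h t) at_top at_top"
    by (intro filterlim_tendsto_add_at_top[OF tendsto_const] h(1))
  moreover have "- R + h t \<le> norm (u t)" if "t \<ge> 0" for t
    using h(2)[OF that] abs_snd_le_norm[of "u t"] by linarith
  then have "\<forall>\<^sub>F t in at_top. - R + h t \<le> norm (u t)"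
    by (rule eventually_at_top_linorderI)
  ultimately show ?thesis by (rule filterlim_at_top_mono)
qed

lemma fwd_bounded_incomparable:
  assumes "q \<in> fwd_bounded" "q' \<in> fwd_bounded" "q \<le> q' \<or> q' \<le> q"
  shows "q = q'"
proof (rule ccontr)
  assume "q \<noteq> q'"
  then have "filterlim (\<lambda>t. norm (flow t q)) at_top at_top"
    using assms sol_comparable_escape[OF sol_flow[of q] sol_flow[of q'], of 0, simplified flow_0]
    by (auto simp: fwd_bounded_def flow_0)
  from norm_at_top_not_bounded[OF this] show False using assms(1) by (simp add: fwd_bounded_def)
qed

text \<open>A zero of the x-difference would make the two points comparable at that time. The sign
  of the x-difference is therefore constant by connectedness, the y-difference has the opposite
  sign, and the decay lemma applies with u and v in one order or the other.\<close>

lemma sol_incomparable_tendsto: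
  assumes "sol u" "sol v" "bounded (v ` {0..})"
    and inc: "\<And>t. t \<ge> 0 \<Longrightarrow> \<not> u t \<le> v t \<and> \<not> v t \<le> u t"
  shows "((\<lambda>t. u t - v t) \<longlongrightarrow> 0) at_top"
proof -
  obtain R where "\<And>t. t \<ge> 0 \<Longrightarrow> norm (v t) \<le> R"
    using assms(3) by (auto simp: bounded_iff)
  then have R: "\<forall>t\<ge>0. \<bar>fst (v t)\<bar> \<le> R"
    using abs_fst_le_norm order_trans by blast
  have nz: "fst (u t) \<noteq> fst (v t)" if "t \<ge> 0" for t
    using inc[OF that] by (auto simp: less_eq_prod_def)
  have cont: "continuous_on A (\<lambda>t. fst (u t) - fst (v t))" for A
    using sol_continuous[OF assms(1)] sol_continuous[OF assms(2)] by (intro continuous_intros)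
  have conn: "connected ((\<lambda>t. fst (u t) - fst (v t)) ` {0..})"
    by (intro connected_continuous_image cont) (simp add: convex_connected)
  have no_zero: "0 \<notin> (\<lambda>t. fst (u t) - fst (v t)) ` {0..}" using nz by auto
  consider "\<forall>t\<ge>0. fst (v t) < fst (u t)" | "\<forall>t\<ge>0. fst (u t) < fst (v t)"
  proof (cases "fst (v 0) < fst (u 0)")
    case True
    have "fst (v t) < fst (u t)" if "t \<ge> 0" for t
    proof (rule ccontr)
      assume "\<not> ?thesis"
      then have "0 \<in> (\<lambda>t. fst (u t) - fst (v t)) ` {0..}"
        using connectedD_interval[OF conn, of "fst (u t) - fst (v t)" "fst (u 0) - fst (v 0)" 0]
          True that by auto
      then show False using no_zero by simp
    qed
    then show ?thesis using that(1) by blast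
  next
    case False
    have "fst (u t) < fst (v t)" if "t \<ge> 0" for t
    proof (rule ccontr)
      assume "\<not> ?thesis"
      then have "0 \<in> (\<lambda>t. fst (u t) - fst (v t)) ` {0..}"
        using connectedD_interval[OF conn, of "fst (u 0) - fst (v 0)" "fst (u t) - fst (v t)" 0]
          False that by auto
      then show False using no_zero by simp
    qed
    then show ?thesis using that(2) by blast
  qed
  then show ?thesis
  proof cases
    case 1
    then have "fst (v t) < fst (u t) \<and> snd (u t) < snd (v t)" if "t \<ge> 0" for t
      using inc[OF that] that by (force simp: less_eq_prod_def)
    from sol_incomparable_decay[OF assms(1,2) this disjI2[OF R]] show ?thesis .
  next
    case 2
    then have "fst (u t) < fst (v t) \<and> snd (v t) < snd (u t)" if "t \<ge> 0" for t
      using inc[OF that] that by (force simp: less_eq_prod_def)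
    from tendsto_minus[OF sol_incomparable_decay[OF assms(2,1) this disjI1[OF R]]]
    show ?thesis by simp
  qed
qed

section \<open>The dichotomy between bounded and escaping orbits\<close>

lemma flow_eq_imp_eq: "flow t q = flow t q' \<Longrightarrow> q = q'"
  using sol_unique_at[OF sol_flow sol_flow, of t q q'] by (metis flow_0)

lemma fwd_bounded_tendsto:
  assumes "q \<in> fwd_bounded" "q0 \<in> fwd_bounded"
  shows "((\<lambda>t. flow t q - flow t q0) \<longlongrightarrow> 0) at_top"
proof (cases "q = q0")
  case False
  have bdd: "bounded ((\<lambda>t. flow t q) ` {0..})" "bounded ((\<lambda>t. flow t q0) ` {0..})"
    using assms by (auto simp: fwd_bounded_def)
  have "\<not> flow t q \<le> flow t q0 \<and> \<not> flow t q0 \<le> flow t q" if "t \<ge> 0" for t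
    using sol_comparable_escape[OF sol_flow sol_flow bdd(2) that, of q] flow_eq_imp_eq[of t q q0] False
      norm_at_top_not_bounded[of "\<lambda>t. flow t q"] bdd(1) by auto
  then show ?thesis by (rule sol_incomparable_tendsto[OF sol_flow sol_flow bdd(2)])
qed simp

text \<open>An orbit that never becomes comparable with the bounded one is asymptotic to it and
  hence bounded itself. An unbounded orbit is thus comparable at some time, and comparability with a
  different bounded orbit forces escape.\<close>

lemma not_fwd_bounded_escape:
  assumes "q \<notin> fwd_bounded" "q0 \<in> fwd_bounded"
  shows "filterlim (\<lambda>t. norm (flow t q)) at_top at_top"
proof (cases "\<exists>t\<ge>0. flow t q \<le> flow t q0 \<or> flow t q0 \<le> flow t q")
  case True
  then obtain t where t: "t \<ge> 0" "flow t q \<le> flow t q0 \<or> flow t q0 \<le> flow t q" by blast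
  have "flow t q \<noteq> flow t q0" using assms flow_eq_imp_eq by blast
  then show ?thesis
    using sol_comparable_escape[OF sol_flow sol_flow _ t(1,2)] assms(2) by (simp add: fwd_bounded_def)
next
  case False
  have bdd: "bounded ((\<lambda>t. flow t q0) ` {0..})" using assms by (simp add: fwd_bounded_def)
  have "((\<lambda>t. flow t q - flow t q0) \<longlongrightarrow> 0) at_top"
    using False by (intro sol_incomparable_tendsto[OF sol_flow sol_flow bdd]) auto
  from tendstoD[OF this, of 1] have "\<forall>\<^sub>F t in at_top. norm (flow t q - flow t q0) < 1"
    by (simp add: dist_norm)
  then obtain a where a: "\<And>t. t \<ge> a \<Longrightarrow> norm (flow t q - flow t q0) < 1"
    by (auto simp: eventually_at_top_linorder)
  obtain R where R: "\<And>t. t \<ge> 0 \<Longrightarrow> norm (flow t q0) \<le> R"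
    using bdd by (auto simp: bounded_iff)
  have "bounded ((\<lambda>t. flow t q) ` {0..a})"
    by (intro compact_imp_bounded compact_continuous_image sol_continuous sol_flow compact_Icc)
  then obtain S where "\<forall>z\<in>(\<lambda>t. flow t q) ` {0..a}. norm z \<le> S"
    by (auto simp only: bounded_iff)
  then have S: "norm (flow t q) \<le> S" if "0 \<le> t" "t \<le> a" for t
    using that by simp
  have "norm (flow t q) \<le> max S (R + 1)" if "t \<ge> 0" for t
  proof (cases "t \<le> a")
    case True
    then show ?thesis using S[OF that] by simp
  next
    case False
    then show ?thesis
      using a[of t] R[OF that] norm_triangle_sub[of "flow t q" "flow t q0"] by auto
  qed
  then have "q \<in> fwd_bounded" by (auto simp: fwd_bounded_def bounded_iff)
  then show ?thesis using assms(1) by simp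
qed

text \<open>With \<open>\<sigma> = 1\<close> and \<open>\<sigma> = - 1\<close> these lemmas treat the right and the left exit region
  \<open>\<sigma> x \<ge> K\<close>, \<open>\<sigma> x' \<ge> 0\<close>.\<close>
lemma exit_region_invariant:
  assumes \<sigma>: "\<sigma> = 1 \<or> \<sigma> = - 1" and K: "B \<le> \<sigma> * G (\<sigma> * K)"
    and "sol u" "K \<le> \<sigma> * fst (u a)" "0 \<le> \<sigma> * (snd (u a) - F (fst (u a)))" "a \<le> b"
  shows "K \<le> \<sigma> * fst (u b) \<and> 0 \<le> \<sigma> * (snd (u b) - F (fst (u b)))"
proof -
  define N where "N = max \<bar>a\<bar> \<bar>b\<bar>"
  define R where "R = max \<bar>K\<bar> (apriori_bound (norm (u 0)) N)"
  obtain L where L: "L \<ge> 0" "\<And>x y. \<bar>x\<bar> \<le> R \<Longrightarrow> \<bar>y\<bar> \<le> R \<Longrightarrow> \<bar>slope G' x y\<bar> \<le> L"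
    using slope_bound_exists[of R] by blast
  \<comment> \<open>In these coordinates the exit region is the closed first quadrant and the
    derivative of ?X is ?Y. The choice of K makes G outweigh p at the edge of the region; slightly
    inside the edge G loses at most L times the distance to it.\<close>
  let ?X = "\<lambda>t. \<sigma> * fst (u t) - K" and ?Y = "\<lambda>t. \<sigma> * (snd (u t) - F (fst (u t)))"
  let ?Y' = "\<lambda>t. \<sigma> * (G (fst (u t)) + p t) - f (fst (u t)) * ?Y t"
  have "?X b \<ge> 0 \<and> ?Y b \<ge> 0"
  proof (rule quadrant_invariant[where X = ?X and Y = ?Y and X' = ?Y and Y' = ?Y' and k = "L + M + 1" and a = a])
    fix s assume s: "a \<le> s" "s \<le> b"
    show "(?X has_real_derivative ?Y s) (at s)"
      using sol_fst[OF \<open>sol u\<close>, of s] by (auto intro!: derivative_eq_intros)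
    show "(?Y has_real_derivative ?Y' s) (at s)"
      using sol_fst[OF \<open>sol u\<close>, of s] sol_snd[OF \<open>sol u\<close>, of s] DERIV_chain2[OF F_deriv sol_fst[OF \<open>sol u\<close>]]
      by (auto intro!: derivative_eq_intros simp: algebra_simps)
    let ?x = "min (?X s) 0" and ?y = "min (?Y s) 0"
    have "(L + M + 1) * ?x \<le> L * ?x" "(L + M + 1) * ?y \<le> M * ?y"
      "(L + M + 1) * ?x \<le> 0 * ?x" "(L + M + 1) * ?y \<le> 1 * ?y"
      using L(1) M_nonneg by (intro mult_right_mono_neg; simp)+
    then have m: "(L + M + 1) * (?x + ?y) \<le> L * ?x + M * ?y" "(L + M + 1) * (?x + ?y) \<le> ?y"
      unfolding distrib_left[of "L + M + 1"] by linarith+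
    then show "(L + M + 1) * (?x + ?y) \<le> ?Y s" by (meson min.cobounded1 order_trans)
    have "norm (u s) \<le> apriori_bound (norm (u 0)) N"
      using s by (intro sol_on_apriori_bound sol_imp_sol_on \<open>sol u\<close>) (auto simp: N_def)
    then have xR: "\<bar>fst (u s)\<bar> \<le> R" using abs_fst_le_norm[of "u s"] by (auto simp: R_def)
    have KR: "\<bar>\<sigma> * K\<bar> \<le> R" using \<sigma> by (auto simp: R_def)
    have G: "L * ?x \<le> \<sigma> * (G (fst (u s)) + p s)"
    proof -
      have Bp: "0 \<le> B + \<sigma> * p s" using p_bound[of s] \<sigma> by auto
      show ?thesis
      proof (cases "?X s < 0")
        case True
        have "\<sigma> * (G (fst (u s)) - G (\<sigma> * K)) = slope G' (fst (u s)) (\<sigma> * K) * ?X s"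
          unfolding slope_mult_diff[OF G_deriv, symmetric] using \<sigma> by (auto simp: algebra_simps)
        moreover have "L * ?X s \<le> slope G' (fst (u s)) (\<sigma> * K) * ?X s"
          using True L(2)[OF xR KR] by (intro mult_right_mono_neg) auto
        ultimately show ?thesis using Bp K True by (simp add: algebra_simps)
      next
        case False
        have "\<sigma> * G (\<sigma> * K) \<le> \<sigma> * G (fst (u s))"
          using \<sigma> False G_mono by (auto simp: strict_mono_less_eq)
        then show ?thesis using Bp K False by (simp add: algebra_simps)
      qed
    qed
    show "(L + M + 1) * (?x + ?y) \<le> ?Y' s" if "?Y s < 0"
    proof -
      have "M * ?Y s \<le> - f (fst (u s)) * ?Y s"
        using f_bound[of "fst (u s)"] that by (intro mult_right_mono_neg) auto
      then show ?thesis using m(1) G that by simp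
    qed
  qed (use assms L M_nonneg in auto)
  then show ?thesis by simp
qed

text \<open>Wherever |x| > K the velocity of x does not point outwards, so |x| never exceeds the
  larger of its initial value and K. A bounded x makes y slowly varying, and a large y would carry x
  out of its range.\<close>

lemma never_exits_bounded:
  assumes "sol u" and "K \<ge> 0"
    and stay: "\<And>\<sigma> t. \<sigma> = 1 \<or> \<sigma> = - 1 \<Longrightarrow> t \<ge> 0 \<Longrightarrow> K < \<sigma> * fst (u t) \<Longrightarrow>
      \<sigma> * (snd (u t) - F (fst (u t))) \<le> 0"
  shows "bounded (u ` {0..})"
proof -
  define R where "R = max \<bar>fst (u 0)\<bar> K"
  have x_le: "\<sigma> * fst (u t) \<le> R" if \<sigma>: "\<sigma> = 1 \<or> \<sigma> = - 1" and "t \<ge> 0" for \<sigma> t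
  proof -
    have "R - \<sigma> * fst (u t) \<ge> 0 \<and> (0 :: real) \<ge> 0"
    \<comment> \<open>With second coordinate 0 and rate 0 the quadrant lemma becomes a
      one-dimensional barrier argument at R.\<close>
    proof (rule quadrant_invariant[where X = "\<lambda>t. R - \<sigma> * fst (u t)" and Y = "\<lambda>_. 0" and k = 0 and a = 0
          and X' = "\<lambda>t. - \<sigma> * (snd (u t) - F (fst (u t)))" and Y' = "\<lambda>_. 0"])
      fix s assume s: "0 \<le> s" "s \<le> t"
      show "((\<lambda>t. R - \<sigma> * fst (u t)) has_real_derivative - \<sigma> * (snd (u s) - F (fst (u s)))) (at s)"
        using sol_fst[OF \<open>sol u\<close>, of s] by (auto intro!: derivative_eq_intros)
      show "0 * (min (R - \<sigma> * fst (u s)) 0 + min 0 0) \<le> - \<sigma> * (snd (u s) - F (fst (u s)))"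
        if "R - \<sigma> * fst (u s) < 0"
        using stay[OF \<sigma> s(1)] that by (simp add: R_def)
    qed (use \<sigma> \<open>t \<ge> 0\<close> in \<open>auto simp: R_def\<close>)
    then show ?thesis by simp
  qed
  have x_bound: "\<bar>fst (u t)\<bar> \<le> R" if "t \<ge> 0" for t
    using x_le[of 1 t] x_le[of "- 1" t] that by auto
  have "R \<ge> 0" by (simp add: R_def)
  define C1 where "C1 = c + d * R + B"
  define C2 where "C2 = \<bar>F 0\<bar> + M * R"
  have y'_bound: "\<bar>G (fst (u t)) + p t\<bar> \<le> C1" if "t \<ge> 0" for t
    using G_growth[of "fst (u t)"] p_bound[of t] mult_left_mono[OF x_bound[OF that] d_nonneg]
    by (simp add: C1_def)
  have F_bound: "\<bar>F (fst (u t))\<bar> \<le> C2" if "t \<ge> 0" for t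
    using F_lipschitz[of "fst (u t)" 0] mult_left_mono[OF x_bound[OF that] M_nonneg]
    by (simp add: C2_def)
  text \<open>If \<open>y\<close> were large at time \<open>t\<close>, then \<open>x\<close> would leave \<open>[- R, R]\<close> before time \<open>t + 1\<close>.\<close>
  have y_le: "\<sigma> * snd (u t) \<le> 2 * R + C1 + C2" if \<sigma>: "\<sigma> = 1 \<or> \<sigma> = - 1" and "t \<ge> 0" for \<sigma> t
  proof -
    have y_ge: "\<sigma> * snd (u t) - C1 \<le> \<sigma> * snd (u s)" if s: "t \<le> s" "s \<le> t + 1" for s
    proof -
      have "\<sigma> * snd (u t) + (- C1) * (s - t) \<le> \<sigma> * snd (u s)"
      proof (rule linear_lower_bound[OF _ _ s(1)])
        fix r assume r: "t \<le> r" "r \<le> s"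
        show "((\<lambda>t. \<sigma> * snd (u t)) has_real_derivative \<sigma> * (G (fst (u r)) + p r)) (at r)"
          using sol_snd[OF \<open>sol u\<close>, of r] by (auto intro!: derivative_eq_intros)
        show "- C1 \<le> \<sigma> * (G (fst (u r)) + p r)"
          using y'_bound[of r] r \<open>t \<ge> 0\<close> \<sigma> by auto
      qed
      moreover have "C1 * (s - t) \<le> C1 * 1"
        using s y'_bound[OF \<open>t \<ge> 0\<close>] by (intro mult_left_mono) auto
      ultimately show ?thesis by simp
    qed
    have "\<sigma> * fst (u t) + (\<sigma> * snd (u t) - C1 - C2) * ((t + 1) - t) \<le> \<sigma> * fst (u (t + 1))"
    proof (rule linear_lower_bound)
      fix s assume s: "t \<le> s" "s \<le> t + 1"
      show "((\<lambda>t. \<sigma> * fst (u t)) has_real_derivative \<sigma> * (snd (u s) - F (fst (u s)))) (at s)"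
        using sol_fst[OF \<open>sol u\<close>, of s] by (auto intro!: derivative_eq_intros)
      show "\<sigma> * snd (u t) - C1 - C2 \<le> \<sigma> * (snd (u s) - F (fst (u s)))"
        using y_ge[OF s] F_bound[of s] s \<open>t \<ge> 0\<close> \<sigma> by auto
    qed simp
    moreover have "\<sigma> * fst (u (t + 1)) \<le> R" "- R \<le> \<sigma> * fst (u t)"
      using x_le[OF \<sigma>, of "t + 1"] x_bound[of t] \<open>t \<ge> 0\<close> \<sigma> by auto
    ultimately show ?thesis by simp
  qed
  have "norm (u t) \<le> R + (2 * R + C1 + C2)" if "t \<ge> 0" for t
    using norm_le_abs_add_abs[of "u t"] x_bound[OF that] y_le[of 1 t] y_le[of "- 1" t] that by auto
  then show ?thesis by (auto simp: bounded_iff)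
qed

text \<open>The coordinate along the future stable set: restricted to \<open>fwd_bounded\<close> it
  turns out to be a bijection onto the reals, with inverse \<open>section_point\<close>.\<close>

definition tilt :: "real \<times> real \<Rightarrow> real" where
  "tilt z = (M + 1) * fst z - snd z"

lemma continuous_on_tilt: "continuous_on A tilt"
  unfolding tilt_def by (intro continuous_intros)

text \<open>On the line \<open>tilt = s\<close>, of slope \<open>M + 1 > M\<close>, the far ends lie in the right and left exit
  regions; by connectedness some point of the line never exits.\<close>
lemma fwd_bounded_exists: "\<exists>q\<in>fwd_bounded. tilt q = s"
proof -
  obtain x1 x2 where x: "G x1 = B" "G x2 = - B" using G_surj by (metis surjD)
  \<comment> \<open>Beyond K in either direction G outweighs the bound B of p, so both exit regions
    are invariant. The lower bound 1 makes K positive, which keeps the two regions apart.\<close>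
  define K where "K = max 1 (max \<bar>x1\<bar> \<bar>x2\<bar>)"
  have "K > 0" by (simp add: K_def)
  have "G x1 \<le> G K" "G (- K) \<le> G x2" using G_mono by (auto simp: strict_mono_less_eq K_def)
  then have K: "B \<le> \<sigma> * G (\<sigma> * K)" if "\<sigma> = 1 \<or> \<sigma> = - 1" for \<sigma> using that x by auto
  define line where "line r = (r, (M + 1) * r - s)" for r :: real
  define E where "E \<sigma> = {z. K < \<sigma> * fst z \<and> 0 < \<sigma> * (snd z - F (fst z))}" for \<sigma> :: real
  define A where "A \<sigma> = (\<Union>t\<in>{0..}. (\<lambda>r. flow t (line r)) -` E \<sigma>)" for \<sigma>
  have "open (E \<sigma>)" for \<sigma>
    unfolding E_def
    by (intro open_Collect_conj open_Collect_less continuous_intros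
        continuous_on_compose2[OF F_cont[of UNIV]]) auto
  moreover have "continuous_on UNIV (\<lambda>r. flow t (line r))" for t
    unfolding line_def by (intro continuous_on_flow_compose continuous_intros)
  ultimately have A_open: "open (A \<sigma>)" for \<sigma>
    unfolding A_def by (intro open_UN ballI open_vimage)
  have A_nonempty: "\<sigma> * (K + \<bar>s\<bar> + \<bar>F 0\<bar> + 1) \<in> A \<sigma>" if \<sigma>: "\<sigma> = 1 \<or> \<sigma> = - 1" for \<sigma>
  proof -
    \<comment> \<open>At abscissa \<sigma> r the value of F is at most |F 0| + M r in absolute
      value. The line of slope M + 1 therefore leaves a surplus of at least r - |s| - |F 0|, which
      this r makes positive.\<close>
    define r where "r = K + \<bar>s\<bar> + \<bar>F 0\<bar> + 1"
    have "r > 0" using \<open>K > 0\<close> by (simp add: r_def)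
    have "\<sigma> * F (\<sigma> * r) \<le> \<bar>F 0\<bar> + M * r"
      using F_lipschitz[of "\<sigma> * r" 0] \<sigma> \<open>r > 0\<close> by (auto simp: abs_mult)
    moreover have "\<sigma> * ((M + 1) * (\<sigma> * r) - s) = M * r + r - \<sigma> * s"
      using \<sigma> by (auto simp: algebra_simps)
    moreover have "\<sigma> * s \<le> \<bar>s\<bar>" using \<sigma> by auto
    ultimately have "0 < \<sigma> * ((M + 1) * (\<sigma> * r) - s - F (\<sigma> * r))"
      using \<open>K > 0\<close> unfolding r_def by (simp add: right_diff_distrib)
    moreover have "K < \<sigma> * (\<sigma> * r)" using \<sigma> by (auto simp: r_def)
    ultimately have "flow 0 (line (\<sigma> * r)) \<in> E \<sigma>" by (simp add: E_def line_def flow_0)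
    then show ?thesis unfolding A_def r_def by (intro UN_I[of 0]) auto
  qed
  have A_disjoint: "A 1 \<inter> A (- 1) = {}"
  proof (rule ccontr)
    assume "\<not> ?thesis"
    then obtain r t1 t2 where r: "t1 \<ge> 0" "flow t1 (line r) \<in> E 1" "t2 \<ge> 0" "flow t2 (line r) \<in> E (- 1)"
      unfolding A_def by blast
    have "K \<le> 1 * fst (flow (max t1 t2) (line r))"
      using r exit_region_invariant[OF _ K sol_flow[of "line r"], of 1 t1 "max t1 t2"] by (auto simp: E_def)
    moreover have "K \<le> - 1 * fst (flow (max t1 t2) (line r))"
      using r exit_region_invariant[OF _ K sol_flow[of "line r"], of "- 1" t2 "max t1 t2"] by (auto simp: E_def)
    ultimately show False using \<open>K > 0\<close> by simp
  qed
  have "A 1 \<union> A (- 1) \<noteq> UNIV"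
    using connectedD[OF connected_UNIV A_open A_open, of 1 "- 1"] A_disjoint A_nonempty[of 1] A_nonempty[of "- 1"]
    by blast
  then obtain r where r: "r \<notin> A 1" "r \<notin> A (- 1)" by blast
  have "bounded ((\<lambda>t. flow t (line r)) ` {0..})"
  proof (rule never_exits_bounded[OF sol_flow, of K])
    fix \<sigma> t :: real assume "\<sigma> = 1 \<or> \<sigma> = - 1" "t \<ge> 0" "K < \<sigma> * fst (flow t (line r))"
    then show "\<sigma> * (snd (flow t (line r)) - F (fst (flow t (line r)))) \<le> 0"
      using r by (force simp: A_def E_def)
  qed (use \<open>K > 0\<close> in simp)
  then show ?thesis by (intro bexI[of _ "line r"]) (simp_all add: fwd_bounded_def tilt_def line_def)
qed

text \<open>Incomparable points have x- and y-differences of opposite sign, so nothing cancels in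
  \<open>tilt\<close>, whose coefficients have absolute value at least 1. The inverse of
  \<open>tilt\<close> on \<open>fwd_bounded\<close> is therefore 1-Lipschitz.\<close>

lemma fwd_bounded_tilt_expanding:
  assumes "q \<in> fwd_bounded" "q' \<in> fwd_bounded"
  shows "norm (q - q') \<le> \<bar>tilt q - tilt q'\<bar>"
proof (cases "q = q'")
  case False
  let ?X = "fst q - fst q'" and ?Y = "snd q - snd q'"
  have "\<not> q \<le> q'" "\<not> q' \<le> q" using fwd_bounded_incomparable[OF assms] False by auto
  then have sgn: "?X > 0 \<and> ?Y < 0 \<or> ?X < 0 \<and> ?Y > 0"
    by (auto simp: less_eq_prod_def)
  have "norm (q - q') \<le> \<bar>?X\<bar> + \<bar>?Y\<bar>" using norm_le_abs_add_abs[of "q - q'"] by simp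
  also have "\<dots> \<le> \<bar>(M + 1) * ?X\<bar> + \<bar>?Y\<bar>"
    using M_nonneg mult_right_mono[of 1 "M + 1" "\<bar>?X\<bar>"] by (simp add: abs_mult)
  also have "\<dots> = \<bar>(M + 1) * ?X - ?Y\<bar>"
    using sgn
  proof
    assume "?X > 0 \<and> ?Y < 0"
    moreover from this have "(M + 1) * ?X > 0" using M_nonneg by simp
    ultimately show ?thesis by linarith
  next
    assume "?X < 0 \<and> ?Y > 0"
    moreover from this have "(M + 1) * ?X < 0" using M_nonneg by (simp add: mult_less_0_iff)
    ultimately show ?thesis by linarith
  qed
  also have "\<dots> = \<bar>tilt q - tilt q'\<bar>" by (simp add: tilt_def algebra_simps)
  finally show ?thesis .
qed simp

definition section_point :: "real \<Rightarrow> real \<times> real" where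
  "section_point s = (SOME q. q \<in> fwd_bounded \<and> tilt q = s)"

lemma section_point: "section_point s \<in> fwd_bounded" "tilt (section_point s) = s"
  using someI_ex[of "\<lambda>q. q \<in> fwd_bounded \<and> tilt q = s"] fwd_bounded_exists[of s]
  unfolding section_point_def by blast+

lemma section_point_tilt: "q \<in> fwd_bounded \<Longrightarrow> section_point (tilt q) = q"
  using fwd_bounded_tilt_expanding[OF section_point(1), of q "tilt q"] by (simp add: section_point(2))

lemma continuous_on_section_point: "continuous_on A section_point"
proof (rule continuous_on_subset)
  have "1-lipschitz_on UNIV section_point"
    using fwd_bounded_tilt_expanding[OF section_point(1) section_point(1)]
    by (intro lipschitz_onI) (auto simp: dist_norm section_point(2))
  then show "continuous_on UNIV section_point" by (rule lipschitz_on_continuous_on)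
qed simp

lemma range_section_point: "range section_point = fwd_bounded"
  using section_point(1) section_point_tilt by (auto simp: image_iff) (metis)

end

section \<open>Properly embedded lines and hyperbolicity\<close>

lemma periodic_range:
  fixes u :: "real \<Rightarrow> 'a" and T :: real
  assumes "T > 0" and per: "\<And>t. u (t + T) = u t"
  shows "range u = u ` {0..T}"
proof -
  have nat: "u (t + of_nat n * T) = u t" for n t
  proof (induction n)
    case (Suc n)
    have "u (t + of_nat (Suc n) * T) = u ((t + of_nat n * T) + T)" by (simp add: algebra_simps)
    then show ?case using Suc per by simp
  qed simp
  have int: "u (t + of_int k * T) = u t" for k t
  proof (cases "k \<ge> 0")
    case True
    then show ?thesis using nat[of t "nat k"] by simp
  next
    case False
    then show ?thesis using nat[of "t + of_int k * T" "nat (- k)"] by simp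
  qed
  have "u t \<in> u ` {0..T}" for t
  proof -
    define s where "s = frac (t / T) * T"
    have "s \<in> {0..T}"
      using \<open>T > 0\<close> frac_lt_1[of "t / T"] mult_right_mono[of "frac (t / T)" 1 T] by (simp add: s_def)
    moreover have "t = s + of_int \<lfloor>t / T\<rfloor> * T" using \<open>T > 0\<close> by (simp add: s_def frac_def field_simps)
    then have "u t = u s" using int by metis
    ultimately show ?thesis by blast
  qed
  then show ?thesis by auto
qed

lemma periodic_bounded:
  fixes u :: "real \<Rightarrow> 'a::metric_space"
  assumes "T > 0" "\<And>t. u (t + T) = u t" "continuous_on UNIV u"
  shows "bounded (range u)"
  unfolding periodic_range[of T u, OF assms(1,2)]
  by (intro compact_imp_bounded compact_continuous_image compact_Icc continuous_on_subset[OF assms(3)]) simp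

text \<open>If the values on one half line were bounded by R, then R + 1 and - (R + 1) would both be
  attained on the other half line, although they lie on opposite sides of \<psi> 0. Monotonicity
  forbids this.\<close>

lemma monotone_half_line_unbounded:
  fixes \<psi> :: "real \<Rightarrow> real"
  assumes mono: "strict_mono_on UNIV \<psi> \<or> strict_antimono_on UNIV \<psi>" and "surj \<psi>"
  shows "\<not> bounded (\<psi> ` {0..})" "\<not> bounded (\<psi> ` {..0})"
proof -
  have bounded_abs: "\<exists>R. \<forall>s\<in>S. \<bar>\<psi> s\<bar> \<le> R" if "bounded (\<psi> ` S)" for S
    using that by (auto simp: bounded_iff)
  show "\<not> bounded (\<psi> ` {0..})"
  proof
    assume "bounded (\<psi> ` {0..})"
    then obtain R where R: "\<And>s. s \<ge> 0 \<Longrightarrow> \<bar>\<psi> s\<bar> \<le> R" using bounded_abs by fastforce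
    obtain s s' where s: "\<psi> s = R + 1" "\<psi> s' = - (R + 1)" using \<open>surj \<psi>\<close> by (metis surjD)
    have "s < 0" "s' < 0" using R[of s] R[of s'] R[of 0] s by (auto simp: not_le[symmetric])
    then show False using mono R[of 0] s by (fastforce simp: monotone_on_def)
  qed
  show "\<not> bounded (\<psi> ` {..0})"
  proof
    assume "bounded (\<psi> ` {..0})"
    then obtain R where R: "\<And>s. s \<le> 0 \<Longrightarrow> \<bar>\<psi> s\<bar> \<le> R" using bounded_abs by fastforce
    obtain s s' where s: "\<psi> s = R + 1" "\<psi> s' = - (R + 1)" using \<open>surj \<psi>\<close> by (metis surjD)
    have "s > 0" "s' > 0" using R[of s] R[of s'] R[of 0] s by (auto simp: not_le[symmetric])
    then show False using mono R[of 0] s by (fastforce simp: monotone_on_def)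
  qed
qed

text \<open>A set with a continuous real coordinate \<open>\<sigma>\<close> that maps it bijectively onto the line is properly
  embedded, so its branches leave every compact set.\<close>
lemma limit_set_empty:
  assumes \<sigma>: "continuous_on UNIV \<sigma>" "inj_on \<sigma> W" "\<sigma> ` W = (UNIV :: real set)"
  shows "limit_set q0 W = {}"
proof -
  have "x \<notin> branch_limit_set \<beta>" if \<beta>: "\<beta> \<in> branches q0 W" for x \<beta>
  proof
    assume "x \<in> branch_limit_set \<beta>"
    then obtain \<zeta> :: "real \<Rightarrow> real \<times> real" where \<zeta>: "continuous_on {0..} \<zeta>" "bij_betw \<zeta> {0..} \<beta>"
      and x: "\<And>t. t \<ge> 0 \<Longrightarrow> x \<in> closure (\<zeta> ` {t..})"
      unfolding branch_limit_set_def by auto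
    obtain \<tau> where "\<tau> \<in> curves_onto q0 W" "\<beta> \<in> {\<tau> ` {0..}, \<tau> ` {..0}}"
      using \<beta> unfolding branches_def by (rule UN_E)
    then have \<tau>: "continuous_on UNIV \<tau>" "inj \<tau>" "range \<tau> = W" "\<beta> = \<tau> ` {0..} \<or> \<beta> = \<tau> ` {..0}"
      unfolding curves_onto_def by blast+
    define \<psi> where "\<psi> = \<sigma> \<circ> \<tau>"
    have "continuous_on UNIV \<psi>"
      unfolding \<psi>_def using \<tau>(1) \<sigma>(1) by (intro continuous_on_compose) (auto intro: continuous_on_subset)
    moreover have "inj \<psi>" unfolding \<psi>_def using \<tau> \<sigma>(2) by (intro comp_inj_on) auto
    moreover have "surj \<psi>" unfolding \<psi>_def image_comp[symmetric] \<tau>(3) by (rule \<sigma>(3))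
    ultimately have "\<not> bounded (\<psi> ` {0..})" "\<not> bounded (\<psi> ` {..0})"
      using monotone_half_line_unbounded[of \<psi>] injective_eq_monotone_map[of UNIV \<psi>] by auto
    then have unbounded: "\<not> bounded (\<sigma> ` \<beta>)"
      using \<tau>(4) by (auto simp: \<psi>_def image_comp)
    define \<theta> where "\<theta> = \<sigma> \<circ> \<zeta>"
    have \<beta>_eq: "\<beta> = \<zeta> ` {0..}" using \<zeta>(2) by (simp add: bij_betw_def)
    have "\<beta> \<subseteq> W" using \<tau> by auto
    then have "inj_on \<sigma> (\<zeta> ` {0..})" using \<sigma>(2) inj_on_subset unfolding \<beta>_eq by blast
    then have "inj_on \<theta> {0..}"
      unfolding \<theta>_def using \<zeta>(2) by (intro comp_inj_on) (auto simp: bij_betw_def)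
    moreover have "continuous_on {0..} \<theta>"
      unfolding \<theta>_def using \<zeta>(1) \<sigma>(1) by (intro continuous_on_compose) (auto intro: continuous_on_subset)
    ultimately have mono: "strict_mono_on {0..} \<theta> \<or> strict_antimono_on {0..} \<theta>"
      using injective_eq_monotone_map[of "{0..}" \<theta>] by (simp add: is_interval_ci)
    have \<sigma>x: "\<sigma> x \<in> closure (\<theta> ` {t..})" if "t \<ge> 0" for t
    proof -
      have "\<sigma> ` closure (\<zeta> ` {t..}) \<subseteq> closure (\<sigma> ` \<zeta> ` {t..})"
        by (intro image_closure_subset closure_subset closed_closure continuous_on_subset[OF \<sigma>(1)]) auto
      then show ?thesis using x[OF that] by (auto simp: \<theta>_def image_comp)
    qed
    \<comment> \<open>The number \<sigma> x is a limit of values of \<theta> beyond t; by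
      monotonicity \<theta> t lies between \<theta> 0 and \<sigma> x. A limit point would thus bound
      the coordinate on the whole branch.\<close>
    have "\<bar>\<theta> t\<bar> \<le> \<bar>\<theta> 0\<bar> + \<bar>\<sigma> x\<bar>" if t: "t \<ge> 0" for t
      using mono
    proof
      assume m: "strict_mono_on {0..} \<theta>"
      have "\<theta> s \<le> \<theta> s'" if "0 \<le> s" "s \<le> s'" for s s'
        using m that by (cases "s = s'") (auto simp: monotone_on_def less_imp_le)
      then have "\<theta> ` {t..} \<subseteq> {\<theta> t..}" "\<theta> 0 \<le> \<theta> t" using t by auto
      moreover from this have "closure (\<theta> ` {t..}) \<subseteq> {\<theta> t..}" by (intro closure_minimal) auto
      ultimately show ?thesis using \<sigma>x[OF t] by auto
    next
      assume m: "strict_antimono_on {0..} \<theta>"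
      have "\<theta> s' \<le> \<theta> s" if "0 \<le> s" "s \<le> s'" for s s'
        using m that by (cases "s = s'") (auto simp: monotone_on_def less_imp_le)
      then have "\<theta> ` {t..} \<subseteq> {..\<theta> t}" "\<theta> t \<le> \<theta> 0" using t by auto
      moreover from this have "closure (\<theta> ` {t..}) \<subseteq> {..\<theta> t}" by (intro closure_minimal) auto
      ultimately show ?thesis using \<sigma>x[OF t] by auto
    qed
    then have "bounded (\<theta> ` {0..})" by (auto simp: bounded_iff)
    then show False using unbounded by (simp add: \<beta>_eq \<theta>_def image_comp)
  qed
  then show ?thesis by (auto simp: limit_set_def)
qed

lemma real_line_curve:
  assumes \<sigma>: "continuous_on UNIV \<sigma>" and \<tau>: "continuous_on UNIV \<tau>" "range \<tau> = W"
    and inverse: "\<And>s :: real. \<sigma> (\<tau> s) = s" and "q0 \<in> W"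
  shows "curves_onto q0 W \<noteq> {}" "\<not> bounded W" "limit_set q0 W = {}"
proof -
  have \<tau>\<sigma>: "\<tau> (\<sigma> q) = q" if "q \<in> W" for q using that \<tau>(2) inverse by auto
  have onto: "\<sigma> ` W = UNIV" unfolding \<tau>(2)[symmetric] image_image inverse by simp
  have "(\<lambda>s. \<tau> (s + \<sigma> q0)) \<in> curves_onto q0 W"
    unfolding curves_onto_def
  proof (intro CollectI conjI)
    show "continuous_on UNIV (\<lambda>s. \<tau> (s + \<sigma> q0))"
      by (intro continuous_on_compose2[OF \<tau>(1)] continuous_intros) auto
    show "inj (\<lambda>s. \<tau> (s + \<sigma> q0))" by (rule injI) (metis inverse add_right_cancel)
    show "\<tau> (0 + \<sigma> q0) = q0" using \<tau>\<sigma> \<open>q0 \<in> W\<close> by simp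
    have "\<tau> s \<in> range (\<lambda>s. \<tau> (s + \<sigma> q0))" for s by (rule range_eqI[of _ _ "s - \<sigma> q0"]) simp
    then show "range (\<lambda>s. \<tau> (s + \<sigma> q0)) = W" unfolding \<tau>(2)[symmetric] by auto
  qed
  then show "curves_onto q0 W \<noteq> {}" by blast
  show "\<not> bounded W"
  proof
    assume "bounded W"
    then have "compact (closure W)" by (simp add: compact_closure)
    then have "bounded (\<sigma> ` closure W)"
      by (intro compact_imp_bounded compact_continuous_image continuous_on_subset[OF \<sigma>]) auto
    then have "bounded (\<sigma> ` W)" by (rule bounded_subset) (auto intro: closure_subset[THEN subsetD])
    then show False unfolding onto by simp
  qed
  have "inj_on \<sigma> W" using \<tau>\<sigma> by (rule inj_on_inverseI)
  then show "limit_set q0 W = {}" by (rule limit_set_empty[OF \<sigma> _ onto])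
qed

text \<open>The characteristic polynomial is positive at 0, negative at 1, and equals the
  determinant, hence is positive, at the trace. The intermediate value theorem gives one root in (0,
  1) and one beyond 1; m12 > 0 provides the eigenvector (m12, z - m11).\<close>

lemma saddle_eigenvalues:
  fixes D :: "real \<times> real \<Rightarrow> real \<times> real"
  assumes "linear D" and D: "D (1, 0) = (m11, m21)" "D (0, 1) = (m12, m22)"
    and "m21 \<ge> 0" "m12 > 0" "m22 > 1"
    and det: "0 < m11 * m22 - m12 * m21" "m11 * m22 - m12 * m21 \<le> 1"
  shows "\<exists>\<kappa> \<mu>. real_eigenvalue D \<kappa> \<and> real_eigenvalue D \<mu> \<and> 0 < \<kappa> \<and> \<kappa> < 1 \<and> 1 < \<mu>"
proof -
  define cp where "cp z = (m11 - z) * (m22 - z) - m12 * m21" for z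
  have cont: "continuous_on A cp" for A unfolding cp_def by (intro continuous_intros)
  have "m11 > 0"
  proof (rule ccontr)
    assume "\<not> m11 > 0"
    then have "m11 * m22 \<le> 0" "0 \<le> m12 * m21"
      using assms(4-6) by (auto simp: mult_le_0_iff)
    then show False using det(1) by linarith
  qed
  have cp0: "cp 0 > 0" using det(1) by (simp add: cp_def)
  \<comment> \<open>For m11 < 1 the product of the diagonal terms is already negative. Otherwise cp
    1 = 1 - trace + det is at most 2 - m11 - m22 < 0, which is where the determinant bound
    enters.\<close>
  have cp1: "cp 1 < 0"
  proof (cases "m11 < 1")
    case True
    have "(1 - m11) * (m22 - 1) > 0" using True assms(6) by simp
    moreover have "m12 * m21 \<ge> 0" using assms(4,5) by simp
    ultimately show ?thesis by (simp add: cp_def algebra_simps)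
  next
    case False
    then show ?thesis using det(2) assms(6) by (simp add: cp_def algebra_simps)
  qed
  have cp2: "cp (m11 + m22) > 0" using det(1) by (simp add: cp_def algebra_simps)
  obtain \<kappa> where \<kappa>: "0 \<le> \<kappa>" "\<kappa> \<le> 1" "cp \<kappa> = 0"
    using IVT2'[of cp 1 0 0] cp0 cp1 cont by auto
  obtain \<mu> where \<mu>: "1 \<le> \<mu>" "cp \<mu> = 0"
    using IVT'[of cp 1 0 "m11 + m22"] cp1 cp2 cont \<open>m11 > 0\<close> assms(6) by auto
  have eig: "real_eigenvalue D z" if "cp z = 0" for z
  proof -
    have "D (m12, z - m11) = m12 *\<^sub>R D (1, 0) + (z - m11) *\<^sub>R D (0, 1)"
      unfolding linear_scale[OF \<open>linear D\<close>, symmetric] linear_add[OF \<open>linear D\<close>, symmetric] by simp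
    also have "\<dots> = z *\<^sub>R (m12, z - m11)"
      using that by (simp add: D cp_def algebra_simps)
    finally show ?thesis
      unfolding real_eigenvalue_def using \<open>m12 > 0\<close> by (intro exI[of _ "(m12, z - m11)"]) (simp add: zero_prod_def)
  qed
  have "\<kappa> \<noteq> 0" "\<kappa> \<noteq> 1" "\<mu> \<noteq> 1" using \<kappa>(3) \<mu>(2) cp0 cp1 by auto
  then show ?thesis using eig[OF \<kappa>(3)] eig[OF \<mu>(2)] \<kappa> \<mu> by (intro exI[of _ \<kappa>] exI[of _ \<mu>]) auto
qed

section \<open>Signs and Wronskian for the planar linear system\<close>

lemma lin_sol_fst:
  assumes "lin_sol T \<alpha> \<beta> u" "0 \<le> t" "t \<le> T"
  shows "((\<lambda>t. fst (u t)) has_real_derivative snd (u t) - \<alpha> t * fst (u t)) (at t)"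
  using bounded_linear.has_vector_derivative[OF bounded_linear_fst, of u _ "at t"] assms
  by (fastforce simp: lin_sol_def lin_field_def has_real_derivative_iff_has_vector_derivative)

lemma lin_sol_snd:
  assumes "lin_sol T \<alpha> \<beta> u" "0 \<le> t" "t \<le> T"
  shows "((\<lambda>t. snd (u t)) has_real_derivative \<beta> t * fst (u t)) (at t)"
  using bounded_linear.has_vector_derivative[OF bounded_linear_snd, of u _ "at t"] assms
  by (fastforce simp: lin_sol_def lin_field_def has_real_derivative_iff_has_vector_derivative)

lemma lin_sol_quadrant:
  assumes u: "lin_sol T \<alpha> \<beta> u" and "0 \<le> t" "t \<le> T"
    and cont: "continuous_on {0..T} \<alpha>" "continuous_on {0..T} \<beta>" and \<beta>: "\<And>t. \<beta> t \<ge> 0"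
    and init: "fst (u 0) \<ge> 0" "snd (u 0) \<ge> 0"
  shows "fst (u t) \<ge> 0 \<and> snd (u t) \<ge> 0"
proof -
  obtain L where L: "\<And>t. 0 \<le> t \<Longrightarrow> t \<le> T \<Longrightarrow> \<bar>\<alpha> t\<bar> \<le> L \<and> \<bar>\<beta> t\<bar> \<le> L"
    using common_bound_obtain[OF cont] by blast
  show ?thesis
  proof (rule cooperative_quadrant_invariant[where X = "\<lambda>t. fst (u t)" and Y = "\<lambda>t. snd (u t)"
        and a = 0 and L = L, OF lin_sol_fst[OF u] lin_sol_snd[OF u]])
    fix s assume s: "0 \<le> s" "s \<le> t"
    then have "\<bar>\<alpha> s\<bar> \<le> L \<and> \<bar>\<beta> s\<bar> \<le> L" using L \<open>t \<le> T\<close> by simp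
    then show "\<bar>\<alpha> s\<bar> \<le> L" by simp
    show "L * fst (u s) \<le> \<beta> s * fst (u s)" if "fst (u s) < 0"
      using that \<open>\<bar>\<alpha> s\<bar> \<le> L \<and> \<bar>\<beta> s\<bar> \<le> L\<close> by (intro mult_right_mono_neg) auto
  qed (use assms in auto)
qed

text \<open>Liouville's formula: the trace of the system is - \<alpha>, so the Wronskian at T is exp
  (- A T), where A is the antiderivative of \<alpha> vanishing at 0. Nonnegative damping makes it at
  most 1.\<close>

lemma lin_sol_wronskian:
  assumes "lin_sol T \<alpha> \<beta> u" "lin_sol T \<alpha> \<beta> v" "T \<ge> 0"
    and cont: "continuous_on UNIV \<alpha>" and \<alpha>: "\<And>t. \<alpha> t \<ge> 0"
    and w0: "fst (u 0) * snd (v 0) - snd (u 0) * fst (v 0) = 1"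
  shows "0 < fst (u T) * snd (v T) - snd (u T) * fst (v T)"
    and "fst (u T) * snd (v T) - snd (u T) * fst (v T) \<le> 1"
proof -
  define w where "w t = fst (u t) * snd (v t) - snd (u t) * fst (v t)" for t
  define A where "A t = (LBINT s=0..t. \<alpha> s)" for t :: real
  have A': "(A has_real_derivative \<alpha> t) (at t)" for t
    using interval_integral_has_vector_derivative[OF cont]
    by (simp add: A_def[abs_def] has_real_derivative_iff_has_vector_derivative)
  have "A 0 = 0" by (simp add: A_def zero_ereal_def)
  have "A 0 \<le> A T"
    using A' \<alpha> by (intro DERIV_nonneg_imp_nondecreasing[OF \<open>T \<ge> 0\<close>]) blast
  have "exp (A T) * w T = exp (A 0) * w 0"
  proof (cases "T = 0")
    case False
    have D: "((\<lambda>t. exp (A t) * w t) has_real_derivative 0) (at t)" if "0 \<le> t" "t \<le> T" for t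
      unfolding w_def
      using lin_sol_fst[OF assms(1) that] lin_sol_snd[OF assms(1) that]
        lin_sol_fst[OF assms(2) that] lin_sol_snd[OF assms(2) that] A'[of t]
      by (auto intro!: derivative_eq_intros simp: algebra_simps)
    show ?thesis
    proof (rule DERIV_isconst_end[where f = "\<lambda>t. exp (A t) * w t"])
      show "continuous_on {0..T} (\<lambda>t. exp (A t) * w t)"
        using D by (meson DERIV_isCont atLeastAtMost_iff continuous_at_imp_continuous_on)
    qed (use D False \<open>T \<ge> 0\<close> in auto)
  qed simp
  then have "exp (A T) * w T = 1" using w0 \<open>A 0 = 0\<close> by (simp add: w_def)
  then have "w T = exp (- A T)" by (simp add: exp_minus field_simps)
  moreover have "exp (- A T) \<le> 1" using \<open>A 0 \<le> A T\<close> \<open>A 0 = 0\<close> by simp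
  ultimately show "0 < fst (u T) * snd (v T) - snd (u T) * fst (v T)"
    "fst (u T) * snd (v T) - snd (u T) * fst (v T) \<le> 1" by (simp_all add: w_def[symmetric])
qed

text \<open>The columns of the propagator are the values at T of the solutions u and v from the unit
  vectors. Cooperativity gives the signs of the entries, and one time with \<beta> > 0 makes the
  lower right entry strictly larger than 1.\<close>

lemma propagator_saddle:
  assumes "T > 0"
    and cont: "continuous_on UNIV \<alpha>" "continuous_on UNIV \<beta>"
    and \<alpha>: "\<And>t. \<alpha> t \<ge> 0" and \<beta>: "\<And>t. \<beta> t \<ge> 0"
    and nontrivial: "t0 \<in> {0<..<T}" "\<beta> t0 \<noteq> 0"
  shows "\<exists>\<kappa> \<mu>. real_eigenvalue (propagator T \<alpha> \<beta>) \<kappa> \<and> real_eigenvalue (propagator T \<alpha> \<beta>) \<mu> \<and>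
    0 < \<kappa> \<and> \<kappa> < 1 \<and> 1 < \<mu>"
proof -
  have c: "continuous_on {0..T} \<alpha>" "continuous_on {0..T} \<beta>"
    using cont by (auto intro: continuous_on_subset)
  obtain L where L: "\<And>t. 0 \<le> t \<Longrightarrow> t \<le> T \<Longrightarrow> \<bar>\<alpha> t\<bar> \<le> L \<and> \<bar>\<beta> t\<bar> \<le> L"
    using common_bound_obtain[OF c] by blast
  have "T \<ge> 0" "L \<ge> 0" using \<open>T > 0\<close> L[of 0] by auto
  obtain u where u: "lin_sol T \<alpha> \<beta> u" "u 0 = (1, 0)" using lin_sol_exists[OF c \<open>T \<ge> 0\<close>] by blast
  obtain v where v: "lin_sol T \<alpha> \<beta> v" "v 0 = (0, 1)" using lin_sol_exists[OF c \<open>T \<ge> 0\<close>] by blast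
  have u_nonneg: "snd (u T) \<ge> 0"
    using lin_sol_quadrant[OF u(1) \<open>T \<ge> 0\<close> order_refl c \<beta>] by (simp add: u)
  have v_nonneg: "fst (v t) \<ge> 0" if "0 \<le> t" "t \<le> T" for t
    using lin_sol_quadrant[OF v(1) that c \<beta>] by (simp add: v)
  have Y_mono: "snd (v s) \<le> snd (v t)" if "0 \<le> s" "s \<le> t" "t \<le> T" for s t
    using linear_lower_bound[of s t "\<lambda>t. snd (v t)" "\<lambda>t. \<beta> t * fst (v t)" 0] lin_sol_snd[OF v(1)]
      v_nonneg \<beta> that by simp
  have Y_ge: "snd (v t) \<ge> 1" if "0 \<le> t" "t \<le> T" for t
    using Y_mono[of 0 t] that by (simp add: v)
  have X_pos: "fst (v t) > 0" if t: "0 < t" "t \<le> T" for t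
  proof -
    \<comment> \<open>After weighting with exp (L t), the first component of v grows at rate at
      least 1, because its second component is at least 1.\<close>
    have "exp (L * (0 - 0)) * (fst (v 0) - 0) + 1 * (t - 0) \<le> exp (L * (t - 0)) * (fst (v t) - 0)"
    proof (rule linear_lower_bound[where Y = "\<lambda>t. exp (L * (t - 0)) * (fst (v t) - 0)"])
      fix s assume s: "0 \<le> s" "s \<le> t"
      then have s': "0 \<le> s" "s \<le> T" using t by auto
      show "((\<lambda>t. exp (L * (t - 0)) * (fst (v t) - 0)) has_real_derivative
          exp (L * (s - 0)) * (L * (fst (v s) - 0) + (snd (v s) - \<alpha> s * fst (v s)))) (at s)"
        by (rule exp_shift_mult_has_real_derivative[OF lin_sol_fst[OF v(1) s']])
      have "\<alpha> s * fst (v s) \<le> L * fst (v s)"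
        using L[OF s'] v_nonneg[OF s'] by (intro mult_right_mono) auto
      then have "1 * 1 \<le> exp (L * (s - 0)) * (L * (fst (v s) - 0) + (snd (v s) - \<alpha> s * fst (v s)))"
        using Y_ge[OF s'] \<open>L \<ge> 0\<close> s by (intro mult_mono) auto
      then show "1 \<le> exp (L * (s - 0)) * (L * (fst (v s) - 0) + (snd (v s) - \<alpha> s * fst (v s)))"
        by simp
    qed (use t in simp)
    then have "0 < exp (L * t) * fst (v t)" using t by (simp add: v)
    then show ?thesis by (simp add: zero_less_mult_iff)
  qed
  \<comment> \<open>The second component starts at 1 and does not decrease. If it ended at 1 it
    would be constant, and its derivative \<beta> X would vanish at t0, although X > 0
    there.\<close>
  have Y_gt: "snd (v T) > 1"
  proof (rule ccontr)
    assume "\<not> ?thesis"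
    then have const: "snd (v t) = 1" if "0 \<le> t" "t \<le> T" for t
      using Y_ge[OF that] Y_mono[OF that] by simp
    have t0: "0 < t0" "t0 < T" using nontrivial(1) by auto
    have "((\<lambda>t. snd (v t)) has_real_derivative \<beta> t0 * fst (v t0)) (at t0)"
      using lin_sol_snd[OF v(1)] t0 by simp
    moreover have "((\<lambda>t. snd (v t)) has_real_derivative 0) (at t0)"
    proof (rule has_field_derivative_transform_within_open[of "\<lambda>_. 1" 0 t0 "{0<..<T}"])
      show "\<And>t. t \<in> {0<..<T} \<Longrightarrow> 1 = snd (v t)" using const by simp
    qed (use nontrivial in auto)
    ultimately have "\<beta> t0 * fst (v t0) = 0" by (rule DERIV_unique)
    then show False using nontrivial(2) X_pos[of t0] t0 by simp
  qed
  show ?thesis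
  proof (rule saddle_eigenvalues)
    show "linear (propagator T \<alpha> \<beta>)"
      using bounded_linear_propagator[OF \<open>T \<ge> 0\<close> c] by (rule bounded_linear.linear)
    show "propagator T \<alpha> \<beta> (1, 0) = (fst (u T), snd (u T))"
      using propagator_eq[OF u(1) \<open>T \<ge> 0\<close> c] by (simp add: u(2))
    show "propagator T \<alpha> \<beta> (0, 1) = (fst (v T), snd (v T))"
      using propagator_eq[OF v(1) \<open>T \<ge> 0\<close> c] by (simp add: v(2))
    show "0 < fst (u T) * snd (v T) - fst (v T) * snd (u T)"
      "fst (u T) * snd (v T) - fst (v T) * snd (u T) \<le> 1"
      using lin_sol_wronskian[OF u(1) v(1) \<open>T \<ge> 0\<close> cont(1) \<alpha>] by (simp_all add: u(2) v(2) mult.commute)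
  qed (use u_nonneg X_pos \<open>T > 0\<close> Y_gt in auto)
qed

section \<open>The periodic system and time reversal\<close>

definition reflect :: "real \<times> real \<Rightarrow> real \<times> real" where
  "reflect z = (fst z, - snd z)"

lemma reflect_reflect [simp]: "reflect (reflect z) = z"
  by (simp add: reflect_def)

lemma bounded_linear_reflect: "bounded_linear reflect"
  unfolding reflect_def by (intro bounded_linear_Pair bounded_linear_fst bounded_linear_minus bounded_linear_snd)

lemma continuous_on_reflect: "continuous_on A reflect"
  by (rule linear_continuous_on[OF bounded_linear_reflect])

lemma norm_reflect [simp]: "norm (reflect z) = norm z"
  by (simp add: reflect_def norm_prod_def)

lemma C1_map_reflect_conj:
  assumes "C1_map h"
  shows "C1_map (\<lambda>z. reflect (h (reflect z)))"
proof -
  obtain h' :: "real \<times> real \<Rightarrow> (real \<times> real) \<Rightarrow>\<^sub>L (real \<times> real)"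
    where h': "\<And>x. (h has_derivative blinfun_apply (h' x)) (at x)" "continuous_on UNIV h'"
    using assms by (auto simp: C1_map_def)
  define R where "R = Blinfun reflect"
  have R: "blinfun_apply R = reflect"
    unfolding R_def by (rule bounded_linear_Blinfun_apply[OF bounded_linear_reflect])
  define k where "k z = R o\<^sub>L (h' (reflect z) o\<^sub>L R)" for z
  have "((\<lambda>z. reflect (h (reflect z))) has_derivative blinfun_apply (k z)) (at z)" for z
  proof -
    have "((\<lambda>z. h (reflect z)) has_derivative (\<lambda>v. h' (reflect z) (reflect v))) (at z)"
      by (rule has_derivative_compose[OF bounded_linear_imp_has_derivative[OF bounded_linear_reflect] h'(1)])
    from bounded_linear.has_derivative[OF bounded_linear_reflect this]
    show ?thesis by (simp add: k_def R blinfun_apply_blinfun_compose[abs_def])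
  qed
  moreover have "continuous_on UNIV k"
    unfolding k_def
    by (intro bounded_bilinear.continuous_on[OF bounded_bilinear_blinfun_compose] continuous_on_const
        continuous_on_compose2[OF h'(2) continuous_on_reflect]) auto
  ultimately show ?thesis unfolding C1_map_def by blast
qed

locale periodic_lienard_system = lienard_system +
  fixes T :: real
  assumes T_pos: "T > 0" and p_periodic: "\<And>t. p (t + T) = p t"
begin

section \<open>The period map and its iterates\<close>

lemma sol_shift:
  assumes "sol u"
  shows "sol (\<lambda>t. u (t + T))" "sol (\<lambda>t. u (t - T))"
proof -
  have p': "p (t - T) = p t" for t using p_periodic[of "t - T"] by simp
  have field: "field (t + T) = field t" "field (t + - T) = field t" for t
    by (simp_all add: field_def fun_eq_iff p_periodic p')
  have u: "(u has_vector_derivative field t (u t)) (at t)" for t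
    using assms by (simp add: sol_def)
  show "sol (\<lambda>t. u (t + T))"
    unfolding sol_def
  proof
    show "((\<lambda>t. u (t + T)) has_vector_derivative field t (u (t + T))) (at t)" for t
      using has_vector_derivative_shift_arg[OF u, where t = t and a = T] by (simp only: field)
  qed
  have "((\<lambda>t. u (t + - T)) has_vector_derivative field t (u (t + - T))) (at t)" for t
    using has_vector_derivative_shift_arg[OF u, where t = t and a = "- T"] by (simp only: field)
  then show "sol (\<lambda>t. u (t - T))" unfolding sol_def by simp
qed

lemma flow_shift: "flow (t + T) q = flow t (flow T q)" "flow (t - T) q = flow t (flow (- T) q)"
  using sol_eq_flow[OF sol_shift(1)[OF sol_flow], of t q] sol_eq_flow[OF sol_shift(2)[OF sol_flow], of t q]
  by simp_all

lemma flow_inverse: "flow (- T) (flow T q) = q" "flow T (flow (- T) q) = q"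
  using flow_shift(1)[of "- T" q] flow_shift(2)[of T q] by (simp_all add: flow_0)

lemma bij_flow: "bij (flow T)"
  by (rule bijI') (metis flow_inverse)+

lemma inv_flow: "inv (flow T) = flow (- T)"
  by (rule inv_equality) (rule flow_inverse)+

lemma flow_iterate: "(flow T ^^ n) q = flow (of_nat n * T) q"
proof (induction n arbitrary: q)
  case (Suc n)
  have "(flow T ^^ Suc n) q = flow (of_nat n * T) (flow T q)"
    by (simp add: Suc funpow_Suc_right del: funpow.simps)
  also have "\<dots> = flow (of_nat n * T + T) q" by (rule flow_shift(1)[symmetric])
  finally show ?case by (simp add: algebra_simps)
qed (simp add: flow_0)

lemma sol_periodic_iff: "sol u \<Longrightarrow> (\<forall>t. u (t + T) = u t) \<longleftrightarrow> flow T (u 0) = u 0"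
  by (metis add_0 flow_shift(1) sol_eq_flow)

lemma filterlim_nat_times_T: "filterlim (\<lambda>n. of_nat n * T) at_top sequentially"
  by (rule filterlim_at_top_mult_tendsto_pos[OF tendsto_const T_pos filterlim_real_sequentially])

lemma fixed_point_fwd_bounded:
  assumes "flow T q = q"
  shows "q \<in> fwd_bounded"
proof -
  have "flow (t + T) q = flow t q" for t using flow_shift(1)[of t q] assms by simp
  from periodic_bounded[OF T_pos this sol_continuous[OF sol_flow]] show ?thesis
    unfolding fwd_bounded_def by (auto intro: bounded_subset)
qed

lemma flow_fwd_bounded:
  assumes "q \<in> fwd_bounded"
  shows "flow T q \<in> fwd_bounded"
proof -
  have "(\<lambda>t. flow t (flow T q)) ` {0..} \<subseteq> (\<lambda>t. flow t q) ` {0..}"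
    using T_pos by (auto simp: flow_shift(1)[symmetric])
  then show ?thesis using assms bounded_subset unfolding fwd_bounded_def by blast
qed

text \<open>Read in the coordinate \<open>tilt\<close>, the period map on \<open>fwd_bounded\<close>
  is a continuous map \<psi> of the real line. Its orbits come from bounded orbits of the flow, so
  the one-dimensional fixed point lemma applies.\<close>

lemma fixed_point_exists: "\<exists>q. flow T q = q"
proof -
  define \<psi> where "\<psi> s = tilt (flow T (section_point s))" for s
  have mem: "flow T (section_point s) \<in> fwd_bounded" for s
    by (intro flow_fwd_bounded section_point)
  have \<psi>_tilt: "\<psi> (tilt q) = tilt (flow T q)" if "q \<in> fwd_bounded" for q
    using that by (simp add: \<psi>_def section_point_tilt)
  have "(\<psi> ^^ n) 0 = tilt (flow (of_nat n * T) (section_point 0))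
      \<and> flow (of_nat n * T) (section_point 0) \<in> fwd_bounded" for n
  proof (induction n)
    case (Suc n)
    have "(\<psi> ^^ Suc n) 0 = tilt (flow T (flow (of_nat n * T) (section_point 0)))"
      using Suc by (simp add: \<psi>_tilt)
    moreover have "flow T (flow (of_nat n * T) (section_point 0)) = flow (of_nat (Suc n) * T) (section_point 0)"
      unfolding flow_iterate[symmetric] by simp
    ultimately show ?case using flow_fwd_bounded Suc by metis
  qed (simp add: flow_0 section_point)
  moreover have "bounded (tilt ` closure ((\<lambda>t. flow t (section_point 0)) ` {0..}))"
    using section_point(1)[of 0] unfolding fwd_bounded_def
    by (intro compact_imp_bounded compact_continuous_image continuous_on_tilt) (simp add: compact_closure)
  moreover have "flow (of_nat n * T) (section_point 0) \<in> closure ((\<lambda>t. flow t (section_point 0)) ` {0..})" for n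
    using T_pos by (intro closure_subset[THEN subsetD] imageI) auto
  ultimately have "bounded (range (\<lambda>n. (\<psi> ^^ n) 0))"
    by (elim bounded_subset) auto
  moreover have "continuous_on UNIV \<psi>"
    unfolding \<psi>_def
    by (intro continuous_on_compose2[OF continuous_on_tilt[of UNIV]] continuous_on_flow_compose
        continuous_on_section_point continuous_on_const) auto
  ultimately obtain s where "\<psi> s = s" using continuous_real_map_fixed_point by blast
  then have "flow T (section_point s) = section_point s"
    using section_point_tilt[OF mem[of s]] by (simp add: \<psi>_def)
  then show ?thesis by blast
qed

text \<open>Two bounded orbits are asymptotic, so a bounded orbit converges to \<open>q0\<close>
  along multiples of T. An unbounded orbit tends to infinity in continuous time, hence also along
  these multiples, and no subsequence of iterates can return.\<close>

lemma stable_set_flow: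
  assumes "flow T q0 = q0"
  shows "stable_set (flow T) q0 = fwd_bounded"
proof (intro equalityI subsetI)
  have q0: "flow (of_nat n * T) q0 = q0" for n
  proof -
    have "(flow T ^^ n) q0 = q0" by (induction n) (simp_all add: assms)
    then show ?thesis by (simp add: flow_iterate)
  qed
  fix q
  {
    assume "q \<in> fwd_bounded"
    then have "((\<lambda>t. flow t q - flow t q0) \<longlongrightarrow> 0) at_top"
      by (rule fwd_bounded_tendsto[OF _ fixed_point_fwd_bounded[OF assms]])
    from filterlim_compose[OF this filterlim_nat_times_T]
    have "(\<lambda>n. flow (of_nat n * T) q - q0) \<longlonglongrightarrow> 0" by (simp add: q0)
    then show "q \<in> stable_set (flow T) q0"
      by (simp add: stable_set_def flow_iterate LIM_zero_iff)
  next
    assume q: "q \<in> stable_set (flow T) q0"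
    show "q \<in> fwd_bounded"
    proof (rule ccontr)
      assume "q \<notin> fwd_bounded"
      then have "filterlim (\<lambda>t. norm (flow t q)) at_top at_top"
        by (rule not_fwd_bounded_escape[OF _ fixed_point_fwd_bounded[OF assms]])
      from filterlim_compose[OF this filterlim_nat_times_T]
      have "filterlim (\<lambda>n. norm ((flow T ^^ n) q)) at_top sequentially" by (simp add: flow_iterate)
      moreover have "(\<lambda>n. norm ((flow T ^^ n) q)) \<longlonglongrightarrow> norm q0"
        using q by (auto simp: stable_set_def intro: tendsto_norm)
      ultimately show False using not_tendsto_and_filterlim_at_infinity[OF sequentially_bot]
          filterlim_at_top_imp_at_infinity by blast
    qed
  }
qed

lemma iterates_escape:
  assumes "flow T q0 = q0" "q \<notin> stable_set (flow T) q0"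
  shows "filterlim (\<lambda>n. norm ((flow T ^^ n) q)) at_top sequentially"
  using filterlim_compose[OF not_fwd_bounded_escape[OF _ fixed_point_fwd_bounded[OF assms(1)]]
      filterlim_nat_times_T, of q] assms
  by (simp add: flow_iterate stable_set_flow)

lemma C1_map_flow_T: "C1_map (flow T)"
  unfolding C1_map_def
  using C1_map_flow(1)[of T] C1_map_flow(2)[of T] T_pos
  by (intro exI[of _ "\<lambda>q. flow_matrix T q q"]) auto

section \<open>Time reversal and the unstable set\<close>

lemma time_reversed: "periodic_lienard_system (\<lambda>x. - F x) (\<lambda>x. - f x) G G' (\<lambda>t. p (- t)) M c d B T"
proof unfold_locales
  show "((\<lambda>x. - F x) has_real_derivative - f x) (at x)" for x by (rule DERIV_minus[OF F_deriv])
  show "continuous_on UNIV (\<lambda>x. - f x)" by (intro continuous_intros f_cont)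
  show "continuous_on UNIV (\<lambda>t. p (- t))"
    by (intro continuous_on_compose2[OF p_cont] continuous_intros) auto
  show "p (- (t + T)) = p (- t)" for t using p_periodic[of "- (t + T)"] by simp
qed (use f_bound p_bound T_pos in \<open>auto simp: G_deriv G'_cont G_mono G_surj G_growth c_nonneg d_nonneg\<close>)

interpretation rev: periodic_lienard_system "\<lambda>x. - F x" "\<lambda>x. - f x" G G' "\<lambda>t. p (- t)" M c d B T
  by (rule time_reversed)

text \<open>The reflected backward trajectory solves the reversed system; uniqueness of solutions
  identifies it with the reversed flow.\<close>

lemma rev_flow: "rev.flow t q = reflect (flow (- t) (reflect q))"
proof -
  have "rev.sol (\<lambda>t. reflect (flow (- t) (reflect q)))"
    unfolding rev.sol_def
  proof
    fix t
    have "((\<lambda>t. flow (- t) (reflect q)) has_vector_derivative - field (- t) (flow (- t) (reflect q))) (at t)"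
      using sol_flow[of "reflect q"] by (intro has_vector_derivative_reflect) (auto simp: sol_def)
    from bounded_linear.has_vector_derivative[OF bounded_linear_reflect this]
    show "((\<lambda>t. reflect (flow (- t) (reflect q))) has_vector_derivative
        rev.field t (reflect (flow (- t) (reflect q)))) (at t)"
      by (simp add: reflect_def field_def rev.field_def add.commute)
  qed
  from rev.sol_eq_flow[OF this, of t] show ?thesis by (simp add: flow_0)
qed

lemma inv_flow_eq: "inv (flow T) = (\<lambda>q. reflect (rev.flow T (reflect q)))"
  by (simp add: inv_flow rev_flow fun_eq_iff)

lemma inv_flow_iterate: "(inv (flow T) ^^ n) q = reflect ((rev.flow T ^^ n) (reflect q))"
  by (induction n) (simp_all add: inv_flow_eq)

lemma rev_fixed_point: "flow T q0 = q0 \<Longrightarrow> rev.flow T (reflect q0) = reflect q0"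
  by (metis flow_inverse(1) reflect_reflect rev_flow)

lemma unstable_set_eq: "unstable_set (flow T) q0 = reflect -` stable_set (rev.flow T) (reflect q0)"
proof -
  have "(\<lambda>n. reflect (x n)) \<longlonglongrightarrow> q0 \<longleftrightarrow> x \<longlonglongrightarrow> reflect q0" for x
    using bounded_linear.tendsto[OF bounded_linear_reflect, of x "reflect q0"]
      bounded_linear.tendsto[OF bounded_linear_reflect, of "\<lambda>n. reflect (x n)" q0] by auto
  then show ?thesis
    by (auto simp: unstable_set_def stable_set_def inv_flow_iterate)
qed

text \<open>Any two points are comparable before or after reflecting y. Forward boundedness settles
  the first case and backward boundedness the second.\<close>

lemma fwd_bounded_Int_bwd_bounded:
  assumes "q \<in> fwd_bounded" "reflect q \<in> rev.fwd_bounded" "q0 \<in> fwd_bounded" "reflect q0 \<in> rev.fwd_bounded"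
  shows "q = q0"
proof -
  have "q \<le> q0 \<or> q0 \<le> q \<or> reflect q \<le> reflect q0 \<or> reflect q0 \<le> reflect q"
    by (auto simp: less_eq_prod_def reflect_def)
  then show ?thesis
    using fwd_bounded_incomparable[OF assms(1,3)] rev.fwd_bounded_incomparable[OF assms(2,4)]
    by (metis reflect_reflect)
qed

lemma fixed_point_unique:
  assumes "flow T q = q" "flow T q0 = q0"
  shows "q = q0"
  by (rule fwd_bounded_Int_bwd_bounded[OF
        fixed_point_fwd_bounded[OF assms(1)] rev.fixed_point_fwd_bounded[OF rev_fixed_point[OF assms(1)]]
        fixed_point_fwd_bounded[OF assms(2)] rev.fixed_point_fwd_bounded[OF rev_fixed_point[OF assms(2)]]])

text \<open>What has to be checked is that G' does not vanish along the whole periodic solution. If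
  it did, G (x t) and thus x would be constant by strict monotonicity; the first equation would then
  fix y, and the second would make p constant.\<close>

lemma local_saddle_flow:
  assumes fixed: "flow T q0 = q0" and f_nonneg: "\<And>x. f x \<ge> 0" and nonconst: "\<And>k. \<exists>t. p t \<noteq> k"
  shows "local_saddle (flow T) q0"
proof -
  let ?\<alpha> = "flow_slope_f q0 q0" and ?\<beta> = "flow_slope_G q0 q0"
  define x where "x t = fst (flow t q0)" for t
  have \<alpha>: "?\<alpha> t = f (x t)" and \<beta>: "?\<beta> t = G' (x t)" for t
    by (simp_all add: flow_slope_f_def flow_slope_G_def slope_self x_def)
  have "mono_on UNIV G" using strict_mono_mono[OF G_mono] by simp
  then have G'_nonneg: "G' z \<ge> 0" for z
    using mono_on_imp_deriv_nonneg[OF _ G_deriv] by simp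
  have "\<exists>t\<in>{0<..<T}. ?\<beta> t \<noteq> 0"
  proof (rule ccontr)
    assume "\<not> ?thesis"
    then have zero: "G' (x t) = 0" if "0 < t" "t < T" for t using that by (auto simp: \<beta>)
    note x' = sol_fst[OF sol_flow[of q0], folded x_def]
    have x_cont: "continuous_on A x" for A
      unfolding x_def by (intro continuous_intros sol_continuous[OF sol_flow])
    have "G (x t) = G (x 0)" if "t \<in> {0..T}" for t
    proof (rule DERIV_isconst2[OF T_pos])
      show "continuous_on {0..T} (\<lambda>t. G (x t))"
        by (intro continuous_on_compose2[OF G_cont[of UNIV]] x_cont) auto
      show "((\<lambda>t. G (x t)) has_real_derivative 0) (at s)" if "0 < s" "s < T" for s
        using DERIV_chain2[OF G_deriv x', of s] zero[OF that] by simp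
    qed (use that in auto)
    then have "x t = x 0" if "t \<in> {0..T}" for t using that strict_mono_eq[OF G_mono] by blast
    then have "x ` {0..T} \<subseteq> {x 0}" by blast
    moreover have "x (t + T) = x t" for t using flow_shift(1)[of t q0] fixed by (simp add: x_def)
    ultimately have "range x \<subseteq> {x 0}" using periodic_range[of T x, OF T_pos] by simp
    then have x_const: "x t = x 0" for t by auto
    have y: "snd (flow t q0) = F (x 0)" for t
    proof -
      have "(x has_real_derivative 0) (at t)"
        using x_const by (subst ext[of x "\<lambda>_. x 0"]) auto
      from DERIV_unique[OF x' this] show ?thesis by (simp add: x_const[of t])
    qed
    have "p t = - G (x 0)" for t
      using DERIV_unique[OF sol_snd[OF sol_flow[of q0], folded x_def, of t, unfolded y] DERIV_const]
      by (simp add: x_const[of t])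
    then show False using nonconst[of "- G (x 0)"] by simp
  qed
  then obtain t0 where t0: "t0 \<in> {0<..<T}" "?\<beta> t0 \<noteq> 0" by blast
  have "?\<alpha> t \<ge> 0" "?\<beta> t \<ge> 0" for t using f_nonneg G'_nonneg by (simp_all add: \<alpha> \<beta>)
  from propagator_saddle[OF T_pos continuous_on_flow_slopes(1,2) this t0]
  obtain \<kappa> \<mu> where "real_eigenvalue (propagator T ?\<alpha> ?\<beta>) \<kappa>" "real_eigenvalue (propagator T ?\<alpha> ?\<beta>) \<mu>"
    "0 < \<kappa>" "\<kappa> < 1" "1 < \<mu>"
    by blast
  moreover have "(flow T has_derivative propagator T ?\<alpha> ?\<beta>) (at q0)"
    using C1_map_flow(1)[of T q0] flow_matrix_apply[of T q0 q0] T_pos by simp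
  ultimately show ?thesis
    unfolding local_saddle_def by (intro exI[of _ "propagator T ?\<alpha> ?\<beta>"] exI[of _ \<kappa>] exI[of _ \<mu>]) simp
qed

text \<open>Homoclinic points are excluded because an orbit bounded in both directions is that of
  \<open>q0\<close>. The other two kinds of contact are excluded because both invariant curves are
  properly embedded, so their limit sets are empty whatever the closures are.\<close>

lemma global_saddle_flow:
  assumes fixed: "flow T q0 = q0" and saddle: "local_saddle (flow T) q0"
  shows "global_saddle (flow T) q0"
proof -
  let ?Ws = "stable_set (flow T) q0" and ?Wu = "unstable_set (flow T) q0"
  note rev_fix = rev_fixed_point[OF fixed]
  have Ws: "?Ws = fwd_bounded" by (rule stable_set_flow[OF fixed])
  have Wu: "?Wu = reflect -` rev.fwd_bounded"
    unfolding unstable_set_eq rev.stable_set_flow[OF rev_fix] ..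
  have q0: "q0 \<in> fwd_bounded" "reflect q0 \<in> rev.fwd_bounded"
    using fixed_point_fwd_bounded[OF fixed] rev.fixed_point_fwd_bounded[OF rev_fix] by auto
  have "curves_onto q0 ?Ws \<noteq> {} \<and> \<not> bounded ?Ws \<and> limit_set q0 ?Ws = {}"
    unfolding Ws
    by (intro conjI real_line_curve[OF continuous_on_tilt continuous_on_section_point
        range_section_point section_point(2) q0(1)])
  moreover have "curves_onto q0 ?Wu \<noteq> {} \<and> \<not> bounded ?Wu \<and> limit_set q0 ?Wu = {}"
  proof -
    have \<sigma>: "continuous_on UNIV (\<lambda>z. rev.tilt (reflect z))"
      by (rule continuous_on_compose2[OF rev.continuous_on_tilt[of UNIV] continuous_on_reflect]) simp
    have \<tau>: "continuous_on UNIV (\<lambda>s. reflect (rev.section_point s))"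
      by (rule continuous_on_compose2[OF continuous_on_reflect[of UNIV] rev.continuous_on_section_point]) simp
    have "reflect -` A = reflect ` A" for A
      by (rule set_eqI) (metis image_eqI image_iff reflect_reflect vimage_eq)
    then have range: "range (\<lambda>s. reflect (rev.section_point s)) = reflect -` rev.fwd_bounded"
      by (simp add: rev.range_section_point[symmetric] image_image)
    have inverse: "rev.tilt (reflect (reflect (rev.section_point s))) = s" for s
      by (simp add: rev.section_point(2))
    have "q0 \<in> reflect -` rev.fwd_bounded" using q0(2) by simp
    then show ?thesis
      unfolding Wu using real_line_curve[OF \<sigma> \<tau> range inverse] by blast
  qed
  moreover have "?Wu \<inter> ?Ws - {q0} = {}"
    using fwd_bounded_Int_bwd_bounded q0 unfolding Ws Wu by blast
  moreover have "C1_diffeomorphism (flow T)"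
    using bij_flow C1_map_flow_T C1_map_reflect_conj[OF rev.C1_map_flow_T]
    by (simp add: C1_diffeomorphism_def inv_flow_eq)
  moreover have "filterlim (\<lambda>n. norm ((inv (flow T) ^^ n) q)) at_top sequentially" if "q \<notin> ?Wu" for q
    using rev.iterates_escape[OF rev_fix, of "reflect q"] that
    by (simp add: inv_flow_iterate unstable_set_eq)
  moreover have "filterlim (\<lambda>n. norm ((flow T ^^ n) q)) at_top sequentially" if "q \<notin> ?Ws" for q
    by (rule iterates_escape[OF fixed that])
  ultimately show ?thesis
    using fixed saddle by (simp add: global_saddle_def homoclinic_contacts_def Let_def)
qed

end

theorem proposition5p1:
  fixes f g p :: "real \<Rightarrow> real" and T c d :: real
  assumes f_lip: "local_lipschitz (UNIV :: real set) UNIV (\<lambda>_. f)"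
    and g_lip: "local_lipschitz (UNIV :: real set) UNIV (\<lambda>_. g)"
    and f_C1: "f C1_differentiable_on UNIV"
    and g_C1: "g C1_differentiable_on UNIV"
    and p_cont: "continuous_on UNIV p"
    and T_pos: "T > 0"
    and p_periodic: "\<forall>t. p (t + T) = p t"
    and T_minimal: "\<forall>S. 0 < S \<and> S < T \<longrightarrow> \<not> (\<forall>t. p (t + S) = p t)"
    and f_bounded: "bounded (range f)"
    and f_nonneg: "\<forall>x. f x \<ge> 0"
    and g_decreasing: "strict_antimono_on UNIV g"
    and g_homeo: "\<exists>g'. homeomorphism UNIV UNIV g g'"
    and c_nonneg: "c \<ge> 0" and d_nonneg: "d \<ge> 0"
    and g_growth: "\<forall>x. \<bar>g x\<bar> \<le> c + d * \<bar>x\<bar>"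
  shows "(\<exists>!u. lienard_solution f g p u \<and> (\<forall>t. u (t + T) = u t)) \<and>
         (\<forall>u. lienard_solution f g p u \<and> (\<forall>t. u (t + T) = u t) \<longrightarrow>
              global_saddle (poincare_map f g p T) (u 0))"
proof -
  have f_cont: "continuous_on UNIV f" by (rule C1_differentiable_imp_continuous_on[OF f_C1])
  obtain g' where g': "\<And>x. (g has_real_derivative g' x) (at x)" "continuous_on UNIV g'"
    using g_C1 by (auto simp: C1_differentiable_on_def has_real_derivative_iff_has_vector_derivative)
  obtain M where M: "\<And>x. \<bar>f x\<bar> \<le> M" using f_bounded by (auto simp: bounded_iff)
  have "bounded (range p)" using p_periodic by (intro periodic_bounded[OF T_pos _ p_cont]) simp
  then obtain B where B: "\<And>t. \<bar>p t\<bar> \<le> B" by (auto simp: bounded_iff)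
  interpret periodic_lienard_system "lienard_F f" f "\<lambda>x. - g x" "\<lambda>x. - g' x" p M c d B T
  proof unfold_locales
    show "(lienard_F f has_real_derivative f x) (at x)" for x
      using interval_integral_has_vector_derivative[OF f_cont, of x]
      by (simp add: lienard_F_def[abs_def] has_real_derivative_iff_has_vector_derivative)
    show "((\<lambda>x. - g x) has_real_derivative - g' x) (at x)" for x by (rule DERIV_minus[OF g'(1)])
    show "continuous_on UNIV (\<lambda>x. - g' x)" by (intro continuous_intros g'(2))
    show "strict_mono (\<lambda>x. - g x)" using g_decreasing by (auto simp: monotone_on_def)
    have "surj g" using g_homeo by (auto simp: homeomorphism_def)
    then show "surj (\<lambda>x. - g x)" by (metis minus_minus surj_def)
  qed (use f_cont M B p_cont c_nonneg d_nonneg g_growth T_pos p_periodic in auto)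
  have sol_eq: "lienard_solution f g p u \<longleftrightarrow> sol u" for u
    by (simp add: lienard_solution_def sol_def field_def)
  have P: "poincare_map f g p T = flow T"
    by (simp add: fun_eq_iff poincare_map_def lienard_flow_def flow_def sol_eq)
  \<comment> \<open>A constant p would also have the period T / 2, which minimality of T
    forbids.\<close>
  have "\<exists>t. p t \<noteq> k" for k
    using T_minimal[rule_format, of "T / 2"] T_pos by fastforce
  then have "global_saddle (flow T) q" if "flow T q = q" for q
    using that f_nonneg by (intro global_saddle_flow local_saddle_flow) auto
  then have "global_saddle (poincare_map f g p T) (u 0)"
    if "lienard_solution f g p u" "\<forall>t. u (t + T) = u t" for u
    using that by (simp add: P sol_eq sol_periodic_iff)
  moreover obtain q where q: "flow T q = q" using fixed_point_exists by blast
  have "\<exists>!u. lienard_solution f g p u \<and> (\<forall>t. u (t + T) = u t)"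
  proof (rule ex1I[of _ "\<lambda>t. flow t q"])
    show "lienard_solution f g p (\<lambda>t. flow t q) \<and> (\<forall>t. flow (t + T) q = flow t q)"
      using sol_periodic_iff[OF sol_flow] q by (simp add: sol_eq sol_flow flow_0)
    fix u assume "lienard_solution f g p u \<and> (\<forall>t. u (t + T) = u t)"
    then have u: "sol u" "flow T (u 0) = u 0" using sol_periodic_iff by (auto simp: sol_eq)
    show "u = (\<lambda>t. flow t q)"
    proof
      show "u t = flow t q" for t
        using sol_eq_flow[OF u(1), of t] fixed_point_unique[OF u(2) q] by simp
    qed
  qed
  ultimately show ?thesis by blast
qed

end
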